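(* Every planar graph without $4$-cycles and without $8$-cycles is DP-$B_{A}$-$3$-colorable.
   Context: All graphs are finite, simple and undirected. A $k$-assignment $L$ for a graph $G$ assigns to each vertex $u$ a list $L(u)$ of $k$ colours, the colours being $1,2,\dots,k$. A cover $H$ of $G$ (with respect to $L$) is a graph with vertex set $\{(u,c): u\in V(G), c\in L(u)\}$ and edge set $\bigcup_{uv\in E(G)}\mathscr{M}_{uv}$, where each $\mathscr{M}_{uv}$ is a matching (not necessarily perfect) between $\{u\}\times L(u)$ and $\{v\}\times L(v)$; there are no other edges. A transversal of $H$ is a set $T\subseteq V(H)$ with $|T\cap(\{u\}\times L(u))|=1$ for every $u\in V(G)$. A transversal $T$ is a DP-$B_{A}$-coloring if the vertices of $T$ can be linearly ordered ("from left to right") such that: (1) each $(v,1)\in T$ has no $H$-neighbour in $T$ to its left; (2) each $(v,c)\in T$ with $c\neq 1$ has at most one $H$-neighbour in $T$ to its left, and that neighbour (if it exists) is adjacent in $H$ to at most one vertex of $T$ lying to the left of $(v,c)$. A graph $G$ is DP-$B_{A}$-$3$-colorable if every cover $H$ of $G$ with respect to every $3$-assignment $L$ has a DP-$B_{A}$-coloring. *)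

theory Defs
  imports "HOL-Analysis.Path_Connected" "Graph_Theory.Pair_Digraph"
begin

text \<open>
  Finite simple undirected graphs are values \<open>G\<close> satisfying \<^term>\<open>pair_graph\<close>: an undirected
  edge \<open>uv\<close> is the pair of arcs \<open>(u, v)\<close>, \<open>(v, u)\<close>.
\<close>

text \<open>The two arcs \<open>(u, v)\<close>, \<open>(v, u)\<close> of one edge must trace the same curve.\<close>

definition plane_drawing ::
    "'a pair_pre_digraph \<Rightarrow> ('a \<Rightarrow> complex) \<Rightarrow> ('a \<times> 'a \<Rightarrow> real \<Rightarrow> complex) \<Rightarrow> bool" where
  "plane_drawing G pos crv \<longleftrightarrow>
     inj_on pos (pverts G) \<and>
     (\<forall>(u, v) \<in> parcs G.
        arc (crv (u, v)) \<and>
        pathstart (crv (u, v)) = pos u \<and>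
        pathfinish (crv (u, v)) = pos v \<and>
        crv (v, u) = reversepath (crv (u, v)) \<and>
        path_image (crv (u, v)) \<inter> pos ` pverts G = {pos u, pos v}) \<and>
     (\<forall>(u, v) \<in> parcs G. \<forall>(x, y) \<in> parcs G. {u, v} \<noteq> {x, y} \<longrightarrow>
        path_image (crv (u, v)) \<inter> path_image (crv (x, y)) \<subseteq> pos ` ({u, v} \<inter> {x, y}))"

definition planar :: "'a pair_pre_digraph \<Rightarrow> bool" where
  "planar G \<longleftrightarrow> (\<exists>pos crv. plane_drawing G pos crv)"

text \<open>
  For \<open>n \<ge> 3\<close> the directed \<open>n\<close>-cycles of a symmetric digraph are exactly the oriented \<open>n\<close>-cycles
  of the undirected graph. (For \<open>n = 2\<close> this fails: \<open>u\<close>, \<open>v\<close>, \<open>u\<close> is a directed cycle.)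
\<close>

definition has_cycle_of_length :: "'a pair_pre_digraph \<Rightarrow> nat \<Rightarrow> bool" where
  "has_cycle_of_length G n \<longleftrightarrow> (\<exists>p. pre_digraph.cycle (with_proj G) p \<and> length p = n)"

definition k_assignment :: "nat \<Rightarrow> 'a pair_pre_digraph \<Rightarrow> ('a \<Rightarrow> nat set) \<Rightarrow> bool" where
  "k_assignment k G L \<longleftrightarrow> (\<forall>u \<in> pverts G. L u = {1..k})"

definition matching_between :: "'b set \<Rightarrow> 'b set \<Rightarrow> ('b \<times> 'b) set \<Rightarrow> bool" where
  "matching_between A B M \<longleftrightarrow> M \<subseteq> A \<times> B \<and>
     (\<forall>e \<in> M. \<forall>f \<in> M. fst e = fst f \<or> snd e = snd f \<longrightarrow> e = f)"

text \<open>
  \<open>M u v\<close> holds the arcs of the matching for the edge \<open>uv\<close> that are directed from \<open>u\<close> to \<open>v\<close>;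
  \<open>M v u\<close> is the same matching read from \<open>v\<close> to \<open>u\<close>.
\<close>

definition cover ::
    "'a pair_pre_digraph \<Rightarrow> ('a \<Rightarrow> nat set) \<Rightarrow> ('a \<times> nat) pair_pre_digraph \<Rightarrow> bool" where
  "cover G L H \<longleftrightarrow>
     pair_graph H \<and>
     pverts H = (SIGMA u:pverts G. L u) \<and>
     (\<exists>M. (\<forall>(u, v) \<in> parcs G.
             matching_between ({u} \<times> L u) ({v} \<times> L v) (M u v) \<and> M v u = (M u v)\<inverse>) \<and>
          parcs H = (\<Union>(u, v) \<in> parcs G. M u v))"

definition transversal ::
    "'a pair_pre_digraph \<Rightarrow> ('a \<Rightarrow> nat set) \<Rightarrow> ('a \<times> nat) pair_pre_digraph \<Rightarrow> ('a \<times> nat) set \<Rightarrow> bool"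
  where
  "transversal G L H T \<longleftrightarrow>
     T \<subseteq> pverts H \<and> (\<forall>u \<in> pverts G. card (T \<inter> ({u} \<times> L u)) = 1)"

text \<open>The vertices of \<open>T\<close> strictly to the left of \<open>x\<close> that are \<open>H\<close>-adjacent to \<open>y\<close>.\<close>

definition left_neighbours ::
    "'b pair_pre_digraph \<Rightarrow> 'b set \<Rightarrow> 'b rel \<Rightarrow> 'b \<Rightarrow> 'b \<Rightarrow> 'b set" where
  "left_neighbours H T r x y = {z \<in> T. (z, x) \<in> r \<and> z \<noteq> x \<and> (y, z) \<in> parcs H}"

definition DP_BA_coloring ::
    "'a pair_pre_digraph \<Rightarrow> ('a \<Rightarrow> nat set) \<Rightarrow> ('a \<times> nat) pair_pre_digraph \<Rightarrow> ('a \<times> nat) set \<Rightarrow> bool"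
  where
  "DP_BA_coloring G L H T \<longleftrightarrow>
     transversal G L H T \<and>
     (\<exists>r. linear_order_on T r \<and>
        (\<forall>(v, c) \<in> T.
           (c = 1 \<longrightarrow> left_neighbours H T r (v, c) (v, c) = {}) \<and>
           (c \<noteq> 1 \<longrightarrow>
              card (left_neighbours H T r (v, c) (v, c)) \<le> 1 \<and>
              (\<forall>w \<in> left_neighbours H T r (v, c) (v, c).
                 card (left_neighbours H T r (v, c) w) \<le> 1))))"

definition DP_BA_colorable :: "nat \<Rightarrow> 'a pair_pre_digraph \<Rightarrow> bool" where
  "DP_BA_colorable k G \<longleftrightarrow>
     (\<forall>L H. k_assignment k G L \<longrightarrow> cover G L H \<longrightarrow> (\<exists>T. DP_BA_coloring G L H T))"

end

theory Submission
  imports Defs "HOL-Analysis.Jordan_Curve"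
begin

text \<open>
  A colouring is built from left to right, so the chosen vertices of the cover induce disjoint paths
  with at most one vertex of colour 1 each. If \<open>U\<close> is a minimal set of vertices that cannot be
  coloured, a colouring of \<open>U - S\<close> extends greedily along a suitable ordering of \<open>S\<close>: a vertex with
  at most two coloured neighbours gets a conflict-free colour, and a vertex with three coloured
  neighbours, at most one of them outside \<open>S\<close>, can be appended to a path inside \<open>S\<close>. This excludes
  many configurations of vertices of degree 3, 4, 5 and 6 in \<open>U\<close>, for instance paths of three
  vertices of degree 3, and pairs of triangles with degrees 3, 4, 4 joined by an edge between
  vertices of degree 4.

  An end block of \<open>U\<close> is 2-connected, and adding ears one at a time, with the theta curve lemma,
  yields its facial cycles together with Euler's formula. With the charges \<open>deg v - 4\<close> and
  \<open>length f - 4\<close> of total \<open>-8\<close>, the missing 4- and 8-cycles leave enough room around the triangles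
  and the vertices of degree 3: every vertex and face ends with nonnegative charge, up
  to a deficit of less than 8 at the cut vertex \<open>X\<close> of the block and on the faces at \<open>X\<close>.
\<close>

section \<open>Regions of theta curves\<close>

text \<open>The cover enters only through counting: a coloured neighbour of \<open>u\<close> blocks
  at most one colour of \<open>u\<close>, whatever the matchings are. Reducibility thus becomes a
  statement about degrees and orderings, the assumption \<open>irreducible\<close>. The obstacle is
  the planar side. A minimal uncolourable set need not be 2-connected, so its faces need not be
  bounded by cycles; an end block has cyclic faces, but its cut vertex may have degree 2 inside the
  block. Gluing two short faces into a 4- or 8-cycle presupposes that they do not share two
  consecutive edges. The digon clause carried through the ear construction says that such sharing
  happens only at a vertex of degree 2, hence only at \<open>X\<close>; the faces at such an
  \<open>X\<close> are \<open>bad\<close>, and crude bounds suffice for them. Faces are sets of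
  directed edges, each directed edge lying in exactly one face, so an ear splits a face without any
  appeal to geometric orientation. Charges are scaled by 12 because shares such as 5/12, 1/3 and 1/4
  occur.\<close>

lemma theta_set_identity:
  assumes "I2 \<inter> I1 = {}" "I2 \<union> I1 \<union> (A - {a,b}) = I0"
    and "I2 \<inter> (A \<union> B) = {}" "I1 \<inter> (A \<union> C) = {}" "I0 \<inter> (B \<union> C) = {}"
    and "C - {a,b} \<subseteq> - (A \<union> B \<union> I2)" "{a,b} \<subseteq> A" "{a,b} \<subseteq> B" "{a,b} \<subseteq> C"
  shows "- (A \<union> B \<union> I2) = I1 \<union> - (B \<union> C \<union> I0) \<union> (C - {a,b})"
  using assms by auto

lemma theta_inside_or_outside:
  fixes c1 :: "real \<Rightarrow> complex"
  assumes "arc c1" "pathstart c1 = a" "pathfinish c1 = b"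
    and "arc c2" "pathstart c2 = a" "pathfinish c2 = b"
    and "path_image c1 \<inter> path_image c2 = {a,b}"
  defines "J \<equiv> path_image c1 \<union> path_image c2"
  shows "open (inside J)" "connected (inside J)" "inside J \<noteq> {}"
    "open (outside J)" "connected (outside J)" "outside J \<noteq> {}"
    "frontier (inside J) = J" "frontier (outside J) = J"
    "\<not> bounded (outside J)" "bounded (inside J)"
proof -
  define g where "g = c1 +++ reversepath c2"
  have ab: "a \<noteq> b"
    using assms arc_distinct_ends by metis
  have "simple_path g"
    unfolding g_def using assms ab
    by (subst simple_path_join_loop_eq) (auto simp: arc_reversepath)
  moreover have "path_image g = J" "pathfinish g = pathstart g"
    unfolding g_def J_def using assms by (auto simp: path_image_join)
  ultimately show "open (inside J)" "connected (inside J)" "inside J \<noteq> {}"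
    "open (outside J)" "connected (outside J)" "outside J \<noteq> {}"
    "frontier (inside J) = J" "frontier (outside J) = J"
    "\<not> bounded (outside J)" "bounded (inside J)"
    using Jordan_inside_outside[of g] by auto
qed

text \<open>If neither old arc were enclosed, a point inside the old curve and a point outside all
  three curves would be separated neither by the curve of \<open>c1\<close>, \<open>c\<close> nor by
  that of \<open>c2\<close>, \<open>c\<close>. These two curves meet in the connected arc
  \<open>c\<close>, so by Janiszewski's theorem their union does not separate the points either,
  although the old curve does.\<close>

lemma theta_outside_split:
  fixes c :: "real \<Rightarrow> complex"
  assumes c1: "arc c1" "pathstart c1 = a" "pathfinish c1 = b"
    and c2: "arc c2" "pathstart c2 = a" "pathfinish c2 = b"
    and c: "arc c" "pathstart c = a" "pathfinish c = b"
    and i12: "path_image c1 \<inter> path_image c2 = {a,b}"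
    and i1: "path_image c1 \<inter> path_image c = {a,b}"
    and i2: "path_image c2 \<inter> path_image c = {a,b}"
    and out: "path_image c - {a,b} \<subseteq> outside (path_image c1 \<union> path_image c2)"
  shows "path_image c1 - {a,b} \<subseteq> inside (path_image c2 \<union> path_image c) \<or>
         path_image c2 - {a,b} \<subseteq> inside (path_image c1 \<union> path_image c)"
proof (rule ccontr)
  let ?A = "path_image c1" and ?B = "path_image c2" and ?C = "path_image c"
  assume neg: "\<not> ?thesis"
  note AB = theta_inside_or_outside[OF c1 c2 i12]
  note AC = theta_inside_or_outside[OF c1 c i1]
  note BC = theta_inside_or_outside[OF c2 c i2]
  have ab: "a \<noteq> b"
    using c1 arc_distinct_ends by metis
  have abs: "a \<in> ?A" "b \<in> ?A" "a \<in> ?B" "b \<in> ?B"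
    using i12 by auto
  have CI: "?C \<inter> inside (?A \<union> ?B) = {}"
    using out abs inside_no_overlap[of "?A \<union> ?B"] inside_Int_outside[of "?A \<union> ?B"] by blast
  \<comment> \<open>A connected set that meets a region and misses its boundary lies in the region.
    Taking closures would then put \<open>c2\<close> inside the curve of \<open>c1\<close> and
    \<open>c\<close>, which is a negated alternative.\<close>
  have I_AC: "inside (?A \<union> ?B) \<inter> inside (?A \<union> ?C) = {}"
  proof (rule ccontr)
    assume ne: "\<not> ?thesis"
    have "inside (?A \<union> ?B) \<inter> (?A \<union> ?C) = {}"
      using CI inside_no_overlap[of "?A \<union> ?B"] by blast
    then have "inside (?A \<union> ?B) \<subseteq> inside (?A \<union> ?C)"
      using connected_Int_frontier[OF AB(2), of "inside (?A \<union> ?C)"] ne AC(7) by auto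
    then have "closure (inside (?A \<union> ?B)) \<subseteq> closure (inside (?A \<union> ?C))"
      by (rule closure_mono)
    then have "?B \<subseteq> inside (?A \<union> ?C) \<union> (?A \<union> ?C)"
      using AB(7) AC(7) by (auto simp: closure_Un_frontier)
    then have "?B - {a,b} \<subseteq> inside (?A \<union> ?C)"
      using i12 i2 by blast
    with neg show False by blast
  qed
  have I_BC: "inside (?A \<union> ?B) \<inter> inside (?B \<union> ?C) = {}"
  proof (rule ccontr)
    assume ne: "\<not> ?thesis"
    have "inside (?A \<union> ?B) \<inter> (?B \<union> ?C) = {}"
      using CI inside_no_overlap[of "?A \<union> ?B"] by blast
    then have "inside (?A \<union> ?B) \<subseteq> inside (?B \<union> ?C)"
      using connected_Int_frontier[OF AB(2), of "inside (?B \<union> ?C)"] ne BC(7) by auto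
    then have "closure (inside (?A \<union> ?B)) \<subseteq> closure (inside (?B \<union> ?C))"
      by (rule closure_mono)
    then have "?A \<subseteq> inside (?B \<union> ?C) \<union> (?B \<union> ?C)"
      using AB(7) BC(7) by (auto simp: closure_Un_frontier)
    then have "?A - {a,b} \<subseteq> inside (?B \<union> ?C)"
      using i12 i1 by blast
    with neg show False by blast
  qed
  obtain p where p: "p \<in> inside (?A \<union> ?B)"
    using AB(3) by blast
  have "bounded (inside (?A \<union> ?B) \<union> inside (?A \<union> ?C) \<union> inside (?B \<union> ?C) \<union> ?A \<union> ?B \<union> ?C)"
    using AB(10) AC(10) BC(10) c1 c2 c by (simp add: bounded_arc_image)
  then obtain q where q: "q \<notin> inside (?A \<union> ?B) \<union> inside (?A \<union> ?C) \<union> inside (?B \<union> ?C) \<union> ?A \<union> ?B \<union> ?C"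
    using not_bounded_UNIV by (metis UNIV_eq_I)
  have pn: "p \<notin> ?A \<union> ?B \<union> ?C"
    using p CI inside_no_overlap[of "?A \<union> ?B"] by blast
  have "connected_component (- ((?A \<union> ?C) \<union> (?B \<union> ?C))) p q"
  proof (rule Janiszewski)
    show "compact (?A \<union> ?C)" "closed (?B \<union> ?C)"
      using c1 c2 c by (auto simp: compact_Un compact_arc_image closed_Un closed_arc_image)
    have "(?A \<union> ?C) \<inter> (?B \<union> ?C) = ?C"
      using i12 i1 by blast
    then show "connected ((?A \<union> ?C) \<inter> (?B \<union> ?C))"
      using c by (simp add: connected_arc_image)
    have "p \<in> outside (?A \<union> ?C)" "q \<in> outside (?A \<union> ?C)"
      using p pn q I_AC by (auto simp: outside_inside)
    moreover have "outside (?A \<union> ?C) \<subseteq> - (?A \<union> ?C)"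
      using outside_no_overlap by blast
    ultimately show "connected_component (- (?A \<union> ?C)) p q"
      using AC(5) by (auto simp: connected_component_def)
    have "p \<in> outside (?B \<union> ?C)" "q \<in> outside (?B \<union> ?C)"
      using p pn q I_BC by (auto simp: outside_inside)
    moreover have "outside (?B \<union> ?C) \<subseteq> - (?B \<union> ?C)"
      using outside_no_overlap by blast
    ultimately show "connected_component (- (?B \<union> ?C)) p q"
      using BC(5) by (auto simp: connected_component_def)
  qed
  then have "connected_component (- (?A \<union> ?B)) p q"
    by (rule connected_component_of_subset) auto
  then have "q \<in> connected_component_set (- (?A \<union> ?B)) p" by simp
  moreover have "bounded (connected_component_set (- (?A \<union> ?B)) p)"
    using p by (simp add: inside_def)
  moreover have "connected_component_set (- (?A \<union> ?B)) q = connected_component_set (- (?A \<union> ?B)) p"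
    using calculation connected_component_eq by blast
  ultimately have "q \<in> inside (?A \<union> ?B)"
    using q by (simp add: inside_def)
  with q show False by blast
qed

lemma theta_split:
  fixes c :: "real \<Rightarrow> complex"
  assumes c1: "arc c1" "pathstart c1 = a" "pathfinish c1 = b"
    and c2: "arc c2" "pathstart c2 = a" "pathfinish c2 = b"
    and c: "arc c" "pathstart c = a" "pathfinish c = b"
    and i12: "path_image c1 \<inter> path_image c2 = {a,b}"
    and i1: "path_image c1 \<inter> path_image c = {a,b}"
    and i2: "path_image c2 \<inter> path_image c = {a,b}"
    and R: "R = inside (path_image c1 \<union> path_image c2) \<or> R = outside (path_image c1 \<union> path_image c2)"
    and cR: "path_image c - {a,b} \<subseteq> R"
  obtains R1 R2 where
    "R1 = inside (path_image c1 \<union> path_image c) \<or> R1 = outside (path_image c1 \<union> path_image c)"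
    "R2 = inside (path_image c2 \<union> path_image c) \<or> R2 = outside (path_image c2 \<union> path_image c)"
    "R1 \<inter> R2 = {}" "R = R1 \<union> R2 \<union> (path_image c - {a,b})"
  using R
proof
  let ?A = "path_image c1" and ?B = "path_image c2" and ?C = "path_image c"
  have ab: "a \<noteq> b"
    using c1 arc_distinct_ends by metis
  have abs: "{a,b} \<subseteq> ?A" "{a,b} \<subseteq> ?B" "{a,b} \<subseteq> ?C"
    using i12 i1 by auto
  note s = arc_imp_simple_path
  have mid: "p \<noteq> {} " if "arc g" "pathstart g = a" "pathfinish g = b" "p = path_image g - {a,b}" for g p
    using nonempty_simple_path_endless[of g] that s by blast
  {
    assume Ri: "R = inside (?A \<union> ?B)"
    have "?C \<inter> inside (?A \<union> ?B) \<noteq> {}"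
      using mid[OF c refl] cR Ri by blast
    then show thesis
      using split_inside_simple_closed_curve[OF s[OF c1(1)] c1(2,3) s[OF c2(1)] c2(2,3) s[OF c(1)] c(2,3) ab i12 i1 i2]
        that[of "inside (?A \<union> ?C)" "inside (?B \<union> ?C)"] Ri by metis
  }
  {
    assume Ro: "R = outside (?A \<union> ?B)"
    \<comment> \<open>The outside case is the inside case for other arcs: the enclosed old arc is a
      chord of the curve formed by the other two, and complements then give the two regions along
      \<open>c\<close>.\<close>
    from theta_outside_split[OF c1 c2 c i12 i1 i2] cR Ro
    consider "?A - {a,b} \<subseteq> inside (?B \<union> ?C)" | "?B - {a,b} \<subseteq> inside (?A \<union> ?C)" by blast
    then show thesis
    proof cases
      case 1
      then have ne: "?A \<inter> inside (?B \<union> ?C) \<noteq> {}"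
        using mid[OF c1 refl] by blast
      have e: "inside (?B \<union> ?A) \<inter> inside (?C \<union> ?A) = {} \<and>
         inside (?B \<union> ?A) \<union> inside (?C \<union> ?A) \<union> (?A - {a,b}) = inside (?B \<union> ?C)"
        using split_inside_simple_closed_curve[OF s[OF c2(1)] c2(2,3) s[OF c(1)] c(2,3) s[OF c1(1)] c1(2,3) ab i2 _ _ ne]
          i12 i1 by (metis Int_commute)
      show thesis
      proof (rule that[of "inside (?A \<union> ?C)" "outside (?B \<union> ?C)"])
        show "inside (?A \<union> ?C) \<inter> outside (?B \<union> ?C) = {}"
          using e by (auto simp: outside_inside Un_commute)
        show "R = inside (?A \<union> ?C) \<union> outside (?B \<union> ?C) \<union> (?C - {a,b})"
          using theta_set_identity[of "inside (?A \<union> ?B)" "inside (?A \<union> ?C)" ?A a b "inside (?B \<union> ?C)" ?B ?C]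
            e Ro cR abs inside_no_overlap[of "?A \<union> ?C"] inside_no_overlap[of "?A \<union> ?B"]
            inside_no_overlap[of "?B \<union> ?C"]
          unfolding outside_inside Un_commute[of ?B ?A] Un_commute[of ?C ?A] by simp
      qed auto
    next
      case 2
      then have ne: "?B \<inter> inside (?A \<union> ?C) \<noteq> {}"
        using mid[OF c2 refl] by blast
      have e: "inside (?A \<union> ?B) \<inter> inside (?C \<union> ?B) = {} \<and>
         inside (?A \<union> ?B) \<union> inside (?C \<union> ?B) \<union> (?B - {a,b}) = inside (?A \<union> ?C)"
        using split_inside_simple_closed_curve[OF s[OF c1(1)] c1(2,3) s[OF c(1)] c(2,3) s[OF c2(1)] c2(2,3) ab i1 _ _ ne]
          i12 i2 by (metis Int_commute)
      show thesis
      proof (rule that[of "outside (?A \<union> ?C)" "inside (?B \<union> ?C)"])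
        show "outside (?A \<union> ?C) \<inter> inside (?B \<union> ?C) = {}"
          using e by (auto simp: outside_inside Un_commute)
        show "R = outside (?A \<union> ?C) \<union> inside (?B \<union> ?C) \<union> (?C - {a,b})"
          using theta_set_identity[of "inside (?A \<union> ?B)" "inside (?B \<union> ?C)" ?B a b "inside (?A \<union> ?C)" ?A ?C]
            e Ro cR abs inside_no_overlap[of "?A \<union> ?C"] inside_no_overlap[of "?A \<union> ?B"]
            inside_no_overlap[of "?B \<union> ?C"]
          unfolding outside_inside Un_commute[of ?B ?A] Un_commute[of ?C ?B] by (simp add: Un_ac)
      qed auto
    qed
  }
qed

section \<open>Darts of paths and cycles\<close>

fun path_darts :: "'a list \<Rightarrow> ('a \<times> 'a) set" where
  "path_darts (x # y # zs) = insert (x, y) (path_darts (y # zs))"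
| "path_darts _ = {}"

text \<open>A cycle is kept as a set of darts: rotating the list does not change it, while reversing
  the list gives the converse set. Faces are thus oriented cycles without a base point.\<close>

definition cycle_darts :: "'a list \<Rightarrow> ('a \<times> 'a) set" where
  "cycle_darts xs = path_darts (xs @ take 1 xs)"

definition dart_verts :: "('a \<times> 'a) set \<Rightarrow> 'a set" where
  "dart_verts S = fst ` S \<union> snd ` S"

lemma dart_verts_simps [simp]:
  "dart_verts {} = {}" "dart_verts (insert (x, y) S) = {x, y} \<union> dart_verts S"
  "dart_verts (S \<union> T) = dart_verts S \<union> dart_verts T" "dart_verts (S\<inverse>) = dart_verts S"
  by (force simp: dart_verts_def)+

lemma dart_vertsI: "(u, v) \<in> S \<Longrightarrow> u \<in> dart_verts S" "(u, v) \<in> S \<Longrightarrow> v \<in> dart_verts S"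
  by (force simp: dart_verts_def)+

lemma dart_verts_mono: "S \<subseteq> T \<Longrightarrow> dart_verts S \<subseteq> dart_verts T"
  by (auto simp: dart_verts_def)

lemma path_darts_append: "path_darts (xs @ a # ys) = path_darts (xs @ [a]) \<union> path_darts (a # ys)"
  by (induction xs rule: path_darts.induct) auto

lemma path_darts_snoc: "path_darts (xs @ [a, b]) = insert (a, b) (path_darts (xs @ [a]))"
  using path_darts_append[of xs a "[b]"] by auto

lemma path_darts_rev: "path_darts (rev xs) = (path_darts xs)\<inverse>"
proof (induction xs rule: path_darts.induct)
  case (1 x y zs)
  have "path_darts (rev (x # y # zs)) = insert (y, x) (path_darts (rev (y # zs)))"
    using path_darts_snoc[of "rev zs" y x] by simp
  with 1 show ?case by auto
qed auto

lemma finite_path_darts [simp]: "finite (path_darts xs)"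
  by (induction xs rule: path_darts.induct) auto

lemma path_darts_verts: "path_darts xs \<subseteq> set xs \<times> set xs"
  by (induction xs rule: path_darts.induct) auto

lemma dart_verts_path: "length xs \<ge> 2 \<Longrightarrow> dart_verts (path_darts xs) = set xs"
proof (induction xs rule: path_darts.induct)
  case (1 x y zs)
  then show ?case by (cases zs) auto
qed auto

lemma card_path_darts: "distinct xs \<Longrightarrow> card (path_darts xs) = length xs - 1"
proof (induction xs rule: path_darts.induct)
  case (1 x y zs)
  have "(x, y) \<notin> path_darts (y # zs)"
    using path_darts_verts[of "y # zs"] 1 by auto
  with 1 show ?case by auto
qed auto

lemma path_darts_asym: "distinct xs \<Longrightarrow> path_darts xs \<inter> (path_darts xs)\<inverse> = {}"
proof (induction xs rule: path_darts.induct)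
  case (1 x y zs)
  then show ?case
    using path_darts_verts[of "y # zs"] by auto
qed auto

lemma path_darts_irrefl: "distinct xs \<Longrightarrow> (x, x) \<notin> path_darts xs"
  using path_darts_asym[of xs] by auto

lemma path_darts_inj_on_fst: "distinct xs \<Longrightarrow> inj_on fst (path_darts xs)"
proof (induction xs rule: path_darts.induct)
  case (1 x y zs)
  then show ?case
    using path_darts_verts[of "y # zs"] by (auto simp: inj_on_def)
qed auto

lemma inj_on_fst_converse: "inj_on fst (S\<inverse>) \<Longrightarrow> inj_on snd S"
  unfolding inj_on_def by (metis converse.intros fst_conv prod.collapse snd_conv)

lemma path_darts_inj_on_snd: "distinct xs \<Longrightarrow> inj_on snd (path_darts xs)"
proof -
  assume "distinct xs"
  then have "inj_on fst (path_darts (rev xs))"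
    by (intro path_darts_inj_on_fst) simp
  then show ?thesis
    unfolding path_darts_rev by (rule inj_on_fst_converse)
qed

lemma path_darts_hd_last:
  assumes "distinct xs" "(u, v) \<in> path_darts xs"
  shows "v \<noteq> hd xs" "u \<noteq> last xs"
  using assms
proof (induction xs rule: path_darts.induct)
  case (1 x y zs)
  { case 1 then show ?case using "1.prems" path_darts_verts[of "y # zs"] by auto }
  { case 2 then show ?case using "1.IH"(2) by auto }
qed auto

lemma cycle_darts_split:
  "cycle_darts (a # p @ b # q) = path_darts (a # p @ [b]) \<union> path_darts (b # q @ [a])"
  using path_darts_append[of "a # p" b "q @ [a]"] by (simp add: cycle_darts_def)

lemma cycle_darts_rotate: "cycle_darts (xs @ ys) = cycle_darts (ys @ xs)"
proof (cases xs)
  case (Cons a p)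
  show ?thesis
  proof (cases ys)
    case (Cons b q)
    then show ?thesis
      using \<open>xs = a # p\<close> cycle_darts_split[of a p b q] cycle_darts_split[of b q a p] by auto
  qed simp
qed simp

lemma set_cycle_darts: "length xs \<ge> 2 \<Longrightarrow> dart_verts (cycle_darts xs) = set xs"
  unfolding cycle_darts_def by (subst dart_verts_path) (cases xs; auto)+

lemma finite_cycle_darts [simp]: "finite (cycle_darts xs)"
  by (simp add: cycle_darts_def)

lemma cycle_darts_rev: "cycle_darts (rev xs) = (cycle_darts xs)\<inverse>"
proof (cases xs rule: rev_cases)
  case (snoc ys a)
  have "cycle_darts (rev xs) = path_darts (a # rev ys @ [a])"
    using snoc by (simp add: cycle_darts_def)
  also have "a # rev ys @ [a] = rev (a # ys @ [a])" by simp
  also have "path_darts (rev (a # ys @ [a])) = (path_darts (a # ys @ [a]))\<inverse>"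
    by (rule path_darts_rev)
  also have "path_darts (a # ys @ [a]) = cycle_darts (a # ys)"
    by (simp add: cycle_darts_def)
  also have "\<dots> = cycle_darts xs"
    using snoc cycle_darts_rotate[of "[a]" ys] by simp
  finally show ?thesis .
qed (simp add: cycle_darts_def)

lemma cycle_rotate_to:
  assumes "a \<in> set xs"
  obtains r where "cycle_darts (a # r) = cycle_darts xs" "length (a # r) = length xs"
    "set (a # r) = set xs" "distinct xs \<Longrightarrow> distinct (a # r)"
proof -
  obtain p q where "xs = p @ a # q"
    using assms by (auto simp: in_set_conv_decomp)
  then show ?thesis
    using that[of "q @ p"] cycle_darts_rotate[of p "a # q"] by auto
qed

lemma cycle_rotate_to2:
  assumes "a \<in> set xs" "b \<in> set xs" "a \<noteq> b" "distinct xs"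
  obtains p q where "cycle_darts (a # p @ b # q) = cycle_darts xs"
    "length (a # p @ b # q) = length xs" "distinct (a # p @ b # q)"
    "set (a # p @ b # q) = set xs"
proof -
  obtain r where r: "cycle_darts (a # r) = cycle_darts xs" "length (a # r) = length xs"
    "set (a # r) = set xs" "distinct (a # r)"
    using cycle_rotate_to[OF assms(1)] assms(4) by metis
  then have "b \<in> set r" using assms by auto
  then obtain p q where "r = p @ b # q"
    by (auto simp: in_set_conv_decomp)
  then show ?thesis using r that by blast
qed

lemma card_cycle_darts:
  assumes "distinct xs" "length xs \<ge> 2"
  shows "card (cycle_darts xs) = length xs"
proof -
  obtain a ys where xs: "xs = a # ys" "ys \<noteq> []"
    using assms(2) by (cases xs) (auto simp: Suc_le_eq)
  then obtain zs b where ys: "ys = zs @ [b]" by (cases ys rule: rev_cases) auto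
  have "cycle_darts xs = insert (b, a) (path_darts xs)"
    unfolding xs ys cycle_darts_def using path_darts_snoc[of "a # zs" b a] by simp
  moreover have "(b, a) \<notin> path_darts xs"
    using path_darts_hd_last(1)[OF assms(1), of b a] xs by auto
  ultimately show ?thesis using card_path_darts[OF assms(1)] assms(2) by simp
qed

lemma cycle_darts_eq_insert: "cycle_darts (a # p @ [b]) = insert (b, a) (path_darts (a # p @ [b]))"
  unfolding cycle_darts_def using path_darts_snoc[of "a # p" b a] by simp

lemma cycle_darts_inj_on:
  assumes "distinct xs"
  shows "inj_on fst (cycle_darts xs)" "inj_on snd (cycle_darts xs)"
proof -
  have fst: "inj_on fst (cycle_darts xs)" if "distinct xs" for xs :: "'a list"
  proof (cases "length xs \<ge> 2")
    case True
    then obtain a p b where xs: "xs = a # p @ [b]"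
      by (cases xs; cases "tl xs" rule: rev_cases) auto
    show ?thesis
      using path_darts_inj_on_fst[OF that] path_darts_hd_last(2)[OF that] unfolding xs cycle_darts_eq_insert
      by (fastforce simp: inj_on_def)
  next
    case False
    then have "length xs = 0 \<or> length xs = 1" by linarith
    then show ?thesis by (auto simp: cycle_darts_def length_Suc_conv)
  qed
  show "inj_on fst (cycle_darts xs)" using fst assms .
  have "inj_on fst (cycle_darts (rev xs))" using fst assms by simp
  then show "inj_on snd (cycle_darts xs)"
    unfolding cycle_darts_rev by (rule inj_on_fst_converse)
qed

lemma cycle_darts_asym:
  assumes "distinct xs" "length xs \<ge> 3"
  shows "cycle_darts xs \<inter> (cycle_darts xs)\<inverse> = {}"
proof -
  obtain a p b where xs: "xs = a # p @ [b]"
    using assms(2) by (cases xs; cases "tl xs" rule: rev_cases) auto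
  then obtain c q where p: "p = c # q" using assms(2) by (cases p) auto
  have "(a, b) \<notin> path_darts xs"
    using assms(1) path_darts_verts[of "c # q @ [b]"] unfolding xs p by auto
  moreover have "a \<noteq> b" using assms(1) unfolding xs by auto
  ultimately show ?thesis
    using path_darts_asym[OF assms(1)] path_darts_hd_last(1)[OF assms(1)] unfolding xs cycle_darts_eq_insert by auto
qed

lemma cycle_darts_next:
  assumes "length xs \<ge> 2" "v \<in> set xs"
  obtains u w where "(u, v) \<in> cycle_darts xs" "(v, w) \<in> cycle_darts xs"
proof -
  obtain r where r: "cycle_darts (v # r) = cycle_darts xs" "length (v # r) = length xs"
    using cycle_rotate_to[OF assms(2)] by metis
  then obtain w r' where "r = w # r'" using assms by (cases r) auto
  moreover obtain s u where "r = s @ [u]" using calculation by (metis append_butlast_last_id list.discI)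
  ultimately have "(v, w) \<in> cycle_darts (v # r)" "(u, v) \<in> cycle_darts (v # r)"
    using cycle_darts_eq_insert[of v s u] by (auto simp: cycle_darts_def)
  then show ?thesis using that r by metis
qed

section \<open>Faces of drawings without cut vertices\<close>

locale drawn_graph =
  fixes V :: "'a set" and D :: "('a \<times> 'a) set"
    and pos :: "'a \<Rightarrow> complex" and crv :: "'a \<times> 'a \<Rightarrow> real \<Rightarrow> complex"
  assumes finite_V: "finite V"
    and D_sub: "D \<subseteq> V \<times> V"
    and D_sym: "(u, v) \<in> D \<Longrightarrow> (v, u) \<in> D"
    and D_irrefl: "(u, u) \<notin> D"
    and inj_pos: "inj_on pos V"
    and crv_arc: "(u, v) \<in> D \<Longrightarrow> arc (crv (u, v))"
    and crv_start: "(u, v) \<in> D \<Longrightarrow> pathstart (crv (u, v)) = pos u"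
    and crv_finish: "(u, v) \<in> D \<Longrightarrow> pathfinish (crv (u, v)) = pos v"
    and crv_rev: "(u, v) \<in> D \<Longrightarrow> crv (v, u) = reversepath (crv (u, v))"
    and crv_verts: "(u, v) \<in> D \<Longrightarrow> path_image (crv (u, v)) \<inter> pos ` V = {pos u, pos v}"
    and crv_cross: "\<lbrakk>(u, v) \<in> D; (x, y) \<in> D; {u, v} \<noteq> {x, y}\<rbrakk> \<Longrightarrow>
        path_image (crv (u, v)) \<inter> path_image (crv (x, y)) \<subseteq> pos ` ({u, v} \<inter> {x, y})"
begin

definition im :: "('a \<times> 'a) set \<Rightarrow> complex set" where
  "im S = (\<Union>d\<in>S. path_image (crv d))"

lemma finite_D: "finite D"
  using finite_subset[OF D_sub] finite_V by blast

lemma im_Un [simp]: "im (S \<union> T) = im S \<union> im T"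
  by (auto simp: im_def)

lemma im_mono: "S \<subseteq> T \<Longrightarrow> im S \<subseteq> im T"
  by (auto simp: im_def)

lemma im_converse [simp]: "S \<subseteq> D \<Longrightarrow> im (S\<inverse>) = im S"
proof -
  have 1: "im (T\<inverse>) \<subseteq> im T" if "T \<subseteq> D" for T
  proof
    fix x assume "x \<in> im (T\<inverse>)"
    then obtain u v where "(u, v) \<in> T" "x \<in> path_image (crv (v, u))"
      by (auto simp: im_def)
    then show "x \<in> im T"
      using crv_rev[of u v] that unfolding im_def by (force simp: path_image_reversepath)
  qed
  assume "S \<subseteq> D"
  then have "S\<inverse> \<subseteq> D" using D_sym by auto
  with 1[of S] 1[of "S\<inverse>"] \<open>S \<subseteq> D\<close> show ?thesis by auto
qed

lemma pos_in_im_iff: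
  assumes "S \<subseteq> D" "v \<in> V"
  shows "pos v \<in> im S \<longleftrightarrow> v \<in> dart_verts S"
proof
  assume "pos v \<in> im S"
  then obtain a b where ab: "(a, b) \<in> S" "pos v \<in> path_image (crv (a, b))"
    by (auto simp: im_def)
  then have "pos v \<in> {pos a, pos b}"
    using crv_verts[of a b] assms by auto
  moreover have "a \<in> V" "b \<in> V"
    using ab assms D_sub by auto
  ultimately have "v = a \<or> v = b"
    using inj_pos assms(2) by (auto simp: inj_on_def)
  then show "v \<in> dart_verts S"
    using ab dart_vertsI by metis
next
  assume "v \<in> dart_verts S"
  then obtain a b where ab: "(a, b) \<in> S" "v = a \<or> v = b"
    by (auto simp: dart_verts_def)
  then have "pos v \<in> path_image (crv (a, b))"
    using crv_verts[of a b] assms by blast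
  then show "pos v \<in> im S"
    using ab by (auto simp: im_def)
qed

text \<open>The two disjointness assumptions together say that no undirected edge is shared, as
  opposite darts trace the same curve; curves of different edges meet only in common ends.\<close>

lemma im_Int:
  assumes "S \<subseteq> D" "T \<subseteq> D" "S \<inter> T = {}" "S \<inter> T\<inverse> = {}"
  shows "im S \<inter> im T = pos ` (dart_verts S \<inter> dart_verts T)"
proof
  show "im S \<inter> im T \<subseteq> pos ` (dart_verts S \<inter> dart_verts T)"
  proof
    fix z assume "z \<in> im S \<inter> im T"
    then obtain u v x y where *: "(u, v) \<in> S" "(x, y) \<in> T"
      "z \<in> path_image (crv (u, v))" "z \<in> path_image (crv (x, y))"
      by (auto simp: im_def)
    then have "{u, v} \<noteq> {x, y}"
      using assms by (auto simp: doubleton_eq_iff)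
    then have "z \<in> pos ` ({u, v} \<inter> {x, y})"
      using crv_cross[of u v x y] * assms by blast
    moreover have "{u, v} \<inter> {x, y} \<subseteq> dart_verts S \<inter> dart_verts T"
      using * by (auto dest: dart_vertsI)
    ultimately show "z \<in> pos ` (dart_verts S \<inter> dart_verts T)" by blast
  qed
  have "dart_verts S \<subseteq> V"
    using assms(1) D_sub by (auto simp: dart_verts_def)
  then show "pos ` (dart_verts S \<inter> dart_verts T) \<subseteq> im S \<inter> im T"
    using pos_in_im_iff assms by (auto simp: subset_iff)
qed

lemma arc_of_path:
  assumes "distinct xs" "length xs \<ge> 2" "path_darts xs \<subseteq> D"
  shows "\<exists>g. arc g \<and> pathstart g = pos (hd xs) \<and> pathfinish g = pos (last xs) \<and>
    path_image g = im (path_darts xs)"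
  using assms
proof (induction xs rule: path_darts.induct)
  case (1 x y zs)
  have xy: "(x, y) \<in> D" using 1 by auto
  show ?case
  proof (cases zs)
    case Nil
    then show ?thesis
      using crv_arc[OF xy] crv_start[OF xy] crv_finish[OF xy] by (intro exI[of _ "crv (x, y)"]) (simp add: im_def)
  next
    case (Cons z ws)
    then obtain g where g: "arc g" "pathstart g = pos y" "pathfinish g = pos (last zs)"
      "path_image g = im (path_darts (y # zs))"
      using 1 by auto
    have dv: "dart_verts (path_darts (y # zs)) = set (y # zs)"
      by (rule dart_verts_path) (simp add: Cons)
    have "(x, y) \<notin> path_darts (y # zs)" "(y, x) \<notin> path_darts (y # zs)"
      using path_darts_verts[of "y # zs"] 1 by auto
    then have "im {(x, y)} \<inter> im (path_darts (y # zs)) = pos ` (dart_verts {(x, y)} \<inter> set (y # zs))"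
      unfolding dv[symmetric] by (intro im_Int) (use 1 in auto)
    also have "dart_verts {(x, y)} \<inter> set (y # zs) = {y}"
      using 1 by auto
    finally have "path_image (crv (x, y)) \<inter> path_image g \<subseteq> {pos y}"
      unfolding g(4) by (simp add: im_def)
    then have "arc (crv (x, y) +++ g)"
      using g crv_arc[OF xy] crv_finish[OF xy] by (intro arc_join) auto
    moreover have "path_image (crv (x, y) +++ g) = im (path_darts (x # y # zs))"
      using g crv_finish[OF xy] by (simp add: path_image_join im_def)
    ultimately show ?thesis
      using g crv_start[OF xy] Cons by (intro exI[of _ "crv (x, y) +++ g"]) auto
  qed
qed auto

lemma cycle_arcs:
  assumes "distinct (a # p @ b # q)" "cycle_darts (a # p @ b # q) \<subseteq> D" "p \<noteq> [] \<or> q \<noteq> []"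
  obtains c1 c2 where "arc c1" "pathstart c1 = pos a" "pathfinish c1 = pos b"
    "arc c2" "pathstart c2 = pos a" "pathfinish c2 = pos b"
    "path_image c1 = im (path_darts (a # p @ [b]))" "path_image c2 = im (path_darts (b # q @ [a]))"
    "path_image c1 \<inter> path_image c2 = {pos a, pos b}"
    "path_image c1 \<union> path_image c2 = im (cycle_darts (a # p @ b # q))"
proof -
  have sub: "path_darts (a # p @ [b]) \<subseteq> D" "path_darts (b # q @ [a]) \<subseteq> D"
    using assms(2) unfolding cycle_darts_split by auto
  obtain c1 where c1: "arc c1" "pathstart c1 = pos a" "pathfinish c1 = pos b"
    "path_image c1 = im (path_darts (a # p @ [b]))"
    using arc_of_path[of "a # p @ [b]"] assms sub by auto
  obtain c2 where c2: "arc c2" "pathstart c2 = pos b" "pathfinish c2 = pos a"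
    "path_image c2 = im (path_darts (b # q @ [a]))"
    using arc_of_path[of "b # q @ [a]"] assms sub by auto
  have dv: "dart_verts (path_darts (a # p @ [b])) = set (a # p @ [b])"
     "dart_verts (path_darts (b # q @ [a])) = set (b # q @ [a])"
    by (intro dart_verts_path; simp)+
  have ends: "u = a \<or> u = b" if "u \<in> set (a # p @ [b])" "u \<in> set (b # q @ [a])" for u
    using that assms(1) by auto
  have no: "(a, b) \<notin> path_darts (b # q @ [a])" "(b, a) \<notin> path_darts (a # p @ [b])"
    using path_darts_hd_last(1)[of "b # q @ [a]" a b] path_darts_hd_last(1)[of "a # p @ [b]" b a] assms(1) by auto
  \<comment> \<open>The only way for the two arcs to share an edge is that both consist of the edge
    between \<open>a\<close> and \<open>b\<close>, and then the cycle would have just two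
    vertices.\<close>
  have both: False if "(a, b) \<in> path_darts (a # p @ [b])" "(b, a) \<in> path_darts (b # q @ [a])"
  proof -
    have "p = []"
      using that(1) assms(1) path_darts_verts[of "p @ [b]"] by (cases p) auto
    moreover have "q = []"
      using that(2) assms(1) path_darts_verts[of "q @ [a]"] by (cases q) auto
    ultimately show False using assms(3) by simp
  qed
  have loops: "(u, u) \<notin> path_darts (a # p @ [b])" for u
    using path_darts_irrefl[of "a # p @ [b]"] assms(1) by auto
  have disj: "path_darts (a # p @ [b]) \<inter> path_darts (b # q @ [a]) = {}"
     "path_darts (a # p @ [b]) \<inter> (path_darts (b # q @ [a]))\<inverse> = {}"
  proof -
    have False if "(u, v) \<in> path_darts (a # p @ [b])" "(u, v) \<in> path_darts (b # q @ [a]) \<or> (v, u) \<in> path_darts (b # q @ [a])" for u v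
    proof -
      have "u \<in> set (a # p @ [b])" "v \<in> set (a # p @ [b])"
        using path_darts_verts[of "a # p @ [b]"] that(1) by blast+
      moreover have "u \<in> set (b # q @ [a])" "v \<in> set (b # q @ [a])"
        using path_darts_verts[of "b # q @ [a]"] that(2) by blast+
      ultimately have "(u = a \<or> u = b) \<and> (v = a \<or> v = b)"
        using ends by blast
      moreover have "u \<noteq> v" using that(1) loops by auto
      ultimately show False using that no both by auto
    qed
    then show "path_darts (a # p @ [b]) \<inter> path_darts (b # q @ [a]) = {}"
     "path_darts (a # p @ [b]) \<inter> (path_darts (b # q @ [a]))\<inverse> = {}"
      by (safe, simp_all, blast+)
  qed
  have "im (path_darts (a # p @ [b])) \<inter> im (path_darts (b # q @ [a])) = pos ` (set (a # p @ [b]) \<inter> set (b # q @ [a]))"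
    unfolding dv[symmetric] by (intro im_Int sub disj)
  also have "set (a # p @ [b]) \<inter> set (b # q @ [a]) = {a, b}"
    using assms(1) by auto
  finally have int: "path_image c1 \<inter> path_image c2 = {pos a, pos b}"
    using c1 c2 by simp
  show ?thesis
    using that[of c1 "reversepath c2"] c1 c2 int
    by (simp add: arc_reversepath cycle_darts_split)
qed

lemma cycle_region:
  assumes "distinct xs" "length xs \<ge> 3" "cycle_darts xs \<subseteq> D"
    and R: "R = inside (im (cycle_darts xs)) \<or> R = outside (im (cycle_darts xs))"
  shows "open R" "connected R" "frontier R = im (cycle_darts xs)"
proof -
  obtain a b q where xs: "xs = a # [] @ b # q"
    using assms(2) by (cases xs; cases "tl xs") auto
  then have "q \<noteq> []" using assms(2) by auto
  then obtain c1 c2 where c: "arc c1" "pathstart c1 = pos a" "pathfinish c1 = pos b"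
    "arc c2" "pathstart c2 = pos a" "pathfinish c2 = pos b"
    "path_image c1 \<inter> path_image c2 = {pos a, pos b}"
    "path_image c1 \<union> path_image c2 = im (cycle_darts xs)"
    using cycle_arcs[of a "[]" b q] assms xs by metis
  show "open R" "connected R" "frontier R = im (cycle_darts xs)"
    using theta_inside_or_outside[OF c(1-7)] R unfolding c(8) by auto
qed

text \<open>Combinatorial half: each dart lies in exactly one facial cycle, Euler's formula counts
  every edge as two darts, and two faces running along both sides of a path \<open>a\<close>,
  \<open>b\<close>, \<open>c\<close> force \<open>b\<close> to have degree 2. Topological half:
  \<open>R\<close> picks for each face one side of its boundary curve, and these regions partition
  the complement of the drawing; this locates the next ear.\<close>

definition faced :: "('a \<times> 'a) set \<Rightarrow> ('a \<times> 'a) set set \<Rightarrow> (('a \<times> 'a) set \<Rightarrow> complex set) \<Rightarrow> bool" where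
  "faced E F R \<longleftrightarrow> E \<subseteq> D \<and> E\<inverse> = E \<and> finite F \<and>
     (\<forall>S\<in>F. \<exists>xs. distinct xs \<and> 3 \<le> length xs \<and> S = cycle_darts xs) \<and>
     \<Union>F = E \<and> (\<forall>S\<in>F. \<forall>T\<in>F. S \<noteq> T \<longrightarrow> S \<inter> T = {}) \<and>
     2 * card F + 2 * card (dart_verts E) = card E + 4 \<and>
     (\<forall>S\<in>F. \<forall>T\<in>F. \<forall>a b c. (a, b) \<in> S \<and> (b, c) \<in> S \<and> (c, b) \<in> T \<and> (b, a) \<in> T \<longrightarrow> E `` {b} = {a, c}) \<and>
     (\<forall>S\<in>F. R S = inside (im S) \<or> R S = outside (im S)) \<and>
     (\<forall>S\<in>F. \<forall>T\<in>F. S \<noteq> T \<longrightarrow> R S \<inter> R T = {}) \<and>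
     (\<forall>S\<in>F. R S \<inter> im E = {}) \<and>
     UNIV = im E \<union> (\<Union>S\<in>F. R S)"

lemma faced_cycle:
  assumes xs: "distinct xs" "length xs \<ge> 3" "cycle_darts xs \<subseteq> D"
  shows "\<exists>F R. faced (cycle_darts xs \<union> (cycle_darts xs)\<inverse>) F R"
proof -
  let ?C = "cycle_darts xs"
  let ?E = "?C \<union> ?C\<inverse>"
  have asym: "?C \<inter> ?C\<inverse> = {}"
    using cycle_darts_asym[OF xs(1,2)] .
  have ne: "?C \<noteq> {}"
    using card_cycle_darts[OF xs(1)] xs(2) by auto
  have neq: "?C \<noteq> ?C\<inverse>"
    using asym ne by auto
  \<comment> \<open>Which orientation of the cycle receives the inside is arbitrary: nothing relates
    the direction of a face to the side on which its region lies.\<close>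
  define R where "R = (\<lambda>S. if S = ?C then inside (im ?C) else outside (im ?C))"
  have imE: "im ?E = im ?C"
    using xs(3) by simp
  have cardE: "card ?E = 2 * length xs"
    using asym card_cycle_darts[OF xs(1)] xs(2) by (simp add: card_Un_disjoint)
  have vE: "card (dart_verts ?E) = length xs"
    using set_cycle_darts[of xs] xs distinct_card by auto
  have inj: "inj_on fst ?C" "inj_on snd ?C"
    using cycle_darts_inj_on[OF xs(1)] .
  have digon: "?E `` {b} = {a, c}" if "(a, b) \<in> S" "(b, c) \<in> S" "S = ?C \<or> S = ?C\<inverse>" for a b c S
  proof -
    have f: "w = w'" if "(v, w) \<in> ?C" "(v, w') \<in> ?C" for v w w'
      using inj_onD[OF inj(1) _ that] by simp
    have s: "w = w'" if "(w, v) \<in> ?C" "(w', v) \<in> ?C" for v w w'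
      using inj_onD[OF inj(2) _ that] by simp
    from that(3) show ?thesis
    proof
      assume "S = ?C"
      then have "(a, b) \<in> ?C" "(b, c) \<in> ?C" using that by auto
      then show ?thesis by (auto dest: f s)
    next
      assume "S = ?C\<inverse>"
      then have "(b, a) \<in> ?C" "(c, b) \<in> ?C" using that by auto
      then show ?thesis by (auto dest: f s)
    qed
  qed
  have "faced ?E {?C, ?C\<inverse>} R"
    unfolding faced_def
  proof (intro conjI)
    show "?E \<subseteq> D" using xs(3) D_sym by auto
    show "\<forall>S\<in>{?C, ?C\<inverse>}. \<exists>xs. distinct xs \<and> 3 \<le> length xs \<and> S = cycle_darts xs"
      using xs cycle_darts_rev[of xs] by (metis distinct_rev insertE length_rev singletonD)
    show "\<forall>S\<in>{?C, ?C\<inverse>}. R S = inside (im S) \<or> R S = outside (im S)"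
      using neq xs(3) by (auto simp: R_def)
    show "UNIV = im ?E \<union> \<Union> (R ` {?C, ?C\<inverse>})"
      using neq unfolding imE by (auto simp: R_def outside_inside)
    show "\<forall>S\<in>{?C, ?C\<inverse>}. R S \<inter> im ?E = {}"
      using inside_no_overlap[of "im ?C"] outside_no_overlap[of "im ?C"] unfolding imE by (auto simp: R_def)
    show "\<forall>S\<in>{?C, ?C\<inverse>}. \<forall>T\<in>{?C, ?C\<inverse>}. S \<noteq> T \<longrightarrow> R S \<inter> R T = {}"
      using inside_Int_outside[of "im ?C"] neq unfolding R_def by (simp add: Int_commute)
    show "\<forall>S\<in>{?C, ?C\<inverse>}. \<forall>T\<in>{?C, ?C\<inverse>}. \<forall>a b c. (a, b) \<in> S \<and> (b, c) \<in> S \<and> (c, b) \<in> T \<and> (b, a) \<in> T \<longrightarrow> ?E `` {b} = {a, c}"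
      using digon by blast
    show "2 * card {?C, ?C\<inverse>} + 2 * card (dart_verts ?E) = card ?E + 4"
      using neq vE cardE by simp
  qed (use asym in auto)
  then show ?thesis by blast
qed

end

text \<open>At an end \<open>y\<close> of the ear both new faces turn from the old face
  \<open>S\<close> into the ear, so if they shared both edges at \<open>y\<close>, then
  \<open>S\<close> would contain opposite darts. Two uncut faces cannot share both edges either:
  \<open>y\<close> would have had degree 2 before, although \<open>S\<close> passes through
  \<open>y\<close> along darts of its own.\<close>

lemma ear_no_new_digon:
  assumes disj: "\<forall>S\<in>F. \<forall>T\<in>F. S \<noteq> T \<longrightarrow> S \<inter> T = {}" and UF: "\<Union>F = E" and Esym: "E\<inverse> = E"
    and S: "S \<in> F" "S = P1 \<union> P2" and asymS: "S \<inter> S\<inverse> = {}"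
    and PE: "P \<inter> E = {}" and asymP: "P \<inter> P\<inverse> = {}"
    and no1: "\<And>x. (x, y) \<notin> P1" and no2: "\<And>x. (y, x) \<notin> P2" and noP: "\<And>x. (x, y) \<notin> P"
    and yS: "(s, y) \<in> S" "(y, t) \<in> S"
    and old: "\<forall>S\<in>F. \<forall>T\<in>F. \<forall>a b c. (a, b) \<in> S \<and> (b, c) \<in> S \<and> (c, b) \<in> T \<and> (b, a) \<in> T \<longrightarrow> E `` {b} = {a, c}"
    and U: "U \<in> F - {S} \<union> {P1 \<union> P\<inverse>, P2 \<union> P}" and T: "T \<in> F - {S} \<union> {P1 \<union> P\<inverse>, P2 \<union> P}"
    and d: "(x, y) \<in> U" "(y, z) \<in> U" "(z, y) \<in> T" "(y, x) \<in> T"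
  shows False
proof -
  have subE: "P1 \<subseteq> E" "P2 \<subseteq> E" using S UF by auto
  have P'E: "P\<inverse> \<inter> E = {}" using PE Esym by auto
  have oldE: "W \<in> F - {S} \<Longrightarrow> W \<subseteq> E" for W using UF by auto
  have noP': "\<And>x. (y, x) \<notin> P\<inverse>" using noP by auto
  consider (1) "U \<in> F - {S}" | (2) "U = P1 \<union> P\<inverse>" | (3) "U = P2 \<union> P" using U by auto
  then show False
  proof cases
    case 2
    then have x: "(x, y) \<in> P\<inverse>" and z: "(y, z) \<in> P1" using d no1 noP' by auto
    have "T = P2 \<union> P"
      using T d(4) x oldE PE subE asymP by auto
    then have "(z, y) \<in> P2" using d noP by auto
    then show False using z S asymS by auto
  next
    case 3
    then have x: "(x, y) \<in> P2" and z: "(y, z) \<in> P" using d no2 noP by auto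
    have "T = P1 \<union> P\<inverse>"
      using T d(3) z oldE P'E subE asymP by auto
    then have "(y, x) \<in> P1" using d noP' by auto
    then show False using x S asymS by auto
  next
    case 1
    then have "(x, y) \<in> E" "(y, z) \<in> E" using d oldE by auto
    then have xz: "(y, x) \<notin> P" "(z, y) \<notin> P\<inverse>" using PE P'E Esym by auto
    have "T \<in> F - {S}"
      using T d no1 no2 noP noP' xz by auto
    then have "E `` {y} = {x, z}" using old 1 d by blast
    moreover have "(y, s) \<in> E" "(y, t) \<in> E" using yS S UF Esym by auto
    moreover have "s \<noteq> t" using yS asymS by auto
    ultimately have "s = x \<or> s = z" by auto
    moreover have "U \<inter> S = {}" "T \<inter> S = {}" using disj 1 \<open>T \<in> F - {S}\<close> S by auto
    ultimately show False using d yS by auto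
  qed
qed

context drawn_graph
begin

text \<open>The interior of the ear is connected and misses the drawn part, so it lies in the region
  of a single face. Both ends lie in the closure of that region, hence on its boundary cycle, and
  the theta lemma splits the region.\<close>

lemma faced_ear:
  assumes fc: "faced E F R" and es: "distinct (a # m @ [b])" "path_darts (a # m @ [b]) \<subseteq> D"
    and ab: "a \<in> dart_verts E" "b \<in> dart_verts E" and m: "set m \<inter> dart_verts E = {}"
    and PE: "path_darts (a # m @ [b]) \<inter> E = {}"
  defines "P \<equiv> path_darts (a # m @ [b])"
  shows "\<exists>F' R'. faced (E \<union> (P \<union> P\<inverse>)) F' R'"
proof -
  have ED: "E \<subseteq> D" and Esym: "E\<inverse> = E" and finF: "finite F"
    and cyc: "\<And>S. S \<in> F \<Longrightarrow> \<exists>xs. distinct xs \<and> 3 \<le> length xs \<and> S = cycle_darts xs"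
    and UF: "\<Union>F = E" and disj: "\<forall>S\<in>F. \<forall>T\<in>F. S \<noteq> T \<longrightarrow> S \<inter> T = {}"
    and cnt: "2 * card F + 2 * card (dart_verts E) = card E + 4"
    and dig: "\<forall>S\<in>F. \<forall>T\<in>F. \<forall>a b c. (a, b) \<in> S \<and> (b, c) \<in> S \<and> (c, b) \<in> T \<and> (b, a) \<in> T \<longrightarrow> E `` {b} = {a, c}"
    and R: "\<And>S. S \<in> F \<Longrightarrow> R S = inside (im S) \<or> R S = outside (im S)"
    and Rdisj: "\<And>S T. S \<in> F \<Longrightarrow> T \<in> F \<Longrightarrow> S \<noteq> T \<Longrightarrow> R S \<inter> R T = {}"
    and RE: "\<And>S. S \<in> F \<Longrightarrow> R S \<inter> im E = {}"
    and cover: "UNIV = im E \<union> (\<Union>S\<in>F. R S)"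
    using fc unfolding faced_def by auto
  have PD: "P \<subseteq> D" and PE: "P \<inter> E = {}" and P'E: "P \<inter> E\<inverse> = {}"
    using es PE Esym unfolding P_def by auto
  have dvP: "dart_verts P = set (a # m @ [b])"
    unfolding P_def by (rule dart_verts_path) simp
  have asymP: "P \<inter> P\<inverse> = {}"
    unfolding P_def using path_darts_asym[OF es(1)] .
  have anb: "a \<noteq> b" using es by auto
  have EV: "dart_verts E \<subseteq> V" using ED D_sub by (auto simp: dart_verts_def)
  obtain c where c: "arc c" "pathstart c = pos a" "pathfinish c = pos b" "path_image c = im P"
    using arc_of_path[OF es(1) _ es(2)] unfolding P_def by auto
  have PiE: "im P \<inter> im E = {pos a, pos b}"
    using im_Int[OF PD ED PE P'E] dvP ab m by auto
  define K where "K = im P - {pos a, pos b}"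
  have K: "connected K" "K \<noteq> {}" "K = c ` {0<..<1}"
    using connected_simple_path_endless[of c] nonempty_simple_path_endless[of c]
      simple_path_endless[of c] c arc_imp_simple_path[OF c(1)] unfolding K_def by auto
  have KE: "K \<inter> im E = {}" using PiE unfolding K_def by auto
  obtain S where S: "S \<in> F" "K \<inter> R S \<noteq> {}"
    using K KE cover by blast
  obtain xs where xs: "distinct xs" "3 \<le> length xs" "S = cycle_darts xs"
    using cyc[OF S(1)] by auto
  have SE: "S \<subseteq> E" using S UF by auto
  have reg: "open (R S)" "connected (R S)" "frontier (R S) = im S"
    using cycle_region[OF xs(1,2), of "R S"] R[OF S(1)] SE ED unfolding xs(3) by auto
  have KR: "K \<subseteq> R S"
    using connected_Int_frontier[OF K(1) S(2)] KE im_mono[OF SE] reg(3) by blast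
  have "c ` closure {0<..<1} \<subseteq> closure K"
  proof (rule image_closure_subset)
    show "continuous_on (closure {0<..<1}) c"
      using arc_imp_path[OF c(1)] unfolding path_def by simp
    show "c ` {0<..<1} \<subseteq> closure K"
      unfolding K(3)[symmetric] by (rule closure_subset)
  qed simp
  then have "im P \<subseteq> closure (R S)"
    using closure_mono[OF KR] c(4) unfolding path_image_def by simp
  moreover have "pos a \<in> im P" "pos b \<in> im P" using PiE by auto
  ultimately have "pos a \<in> R S \<union> im S" "pos b \<in> R S \<union> im S"
    using reg(3) by (auto simp: closure_Un_frontier)
  moreover have "pos a \<in> im E" "pos b \<in> im E" using PiE by auto
  ultimately have "pos a \<in> im S" "pos b \<in> im S"
    using RE[OF S(1)] by auto
  then have "a \<in> dart_verts S" "b \<in> dart_verts S"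
    using pos_in_im_iff[of S] SE ED EV ab by blast+
  then have "a \<in> set xs" "b \<in> set xs"
    using set_cycle_darts[of xs] xs by auto
  then obtain p q where pq: "cycle_darts (a # p @ b # q) = S"
    "length (a # p @ b # q) = length xs" "distinct (a # p @ b # q)"
    using cycle_rotate_to2[OF _ _ anb xs(1)] xs(3) by metis
  have pq_ne: "p \<noteq> [] \<or> q \<noteq> []" using pq xs by auto
  define P1 P2 where "P1 = path_darts (a # p @ [b])" and "P2 = path_darts (b # q @ [a])"
  have SP: "S = P1 \<union> P2" using pq(1) unfolding cycle_darts_split P1_def P2_def by simp
  have P12: "P1 \<subseteq> E" "P2 \<subseteq> E" using SP SE by auto
  have "cycle_darts (a # p @ b # q) \<subseteq> D" using pq SE ED by auto
  then obtain c1 c2 where c1: "arc c1" "pathstart c1 = pos a" "pathfinish c1 = pos b"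
    and c2: "arc c2" "pathstart c2 = pos a" "pathfinish c2 = pos b"
    and ic: "path_image c1 = im P1" "path_image c2 = im P2" "path_image c1 \<inter> path_image c2 = {pos a, pos b}"
      "path_image c1 \<union> path_image c2 = im S"
    using cycle_arcs[OF pq(3) _ pq_ne] pq(1) unfolding P1_def P2_def by metis
  have ends: "{pos a, pos b} \<subseteq> im P1" "{pos a, pos b} \<subseteq> im P2" using ic by auto
  have i1: "path_image c1 \<inter> path_image c = {pos a, pos b}"
    and i2: "path_image c2 \<inter> path_image c = {pos a, pos b}"
  proof -
    have "im Q \<inter> im P = {pos a, pos b}" if "Q \<subseteq> E" "{pos a, pos b} \<subseteq> im Q" for Q
    proof -
      have "im Q \<inter> im P \<subseteq> im P \<inter> im E" using im_mono[OF that(1)] by blast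
      moreover have "{pos a, pos b} \<subseteq> im P" using PiE by auto
      ultimately show ?thesis using that(2) unfolding PiE by auto
    qed
    from this[OF P12(1) ends(1)] this[OF P12(2) ends(2)]
    show "path_image c1 \<inter> path_image c = {pos a, pos b}" "path_image c2 \<inter> path_image c = {pos a, pos b}"
      unfolding ic(1,2) c(4) by simp_all
  qed
  have hR: "R S = inside (path_image c1 \<union> path_image c2) \<or> R S = outside (path_image c1 \<union> path_image c2)"
    using R[OF S(1)] unfolding ic(4) .
  have hc: "path_image c - {pos a, pos b} \<subseteq> R S"
    using KR unfolding K_def c(4) .
  obtain R1 R2 where R1: "R1 = inside (im P1 \<union> im P) \<or> R1 = outside (im P1 \<union> im P)"
    and R2: "R2 = inside (im P2 \<union> im P) \<or> R2 = outside (im P2 \<union> im P)"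
    and R12: "R1 \<inter> R2 = {}" "R S = R1 \<union> R2 \<union> K"
    by (rule theta_split[OF c1 c2 c(1-3) ic(3) i1 i2 hR hc])
      (simp only: ic(1,2) c(4) K_def)
  \<comment> \<open>The ear is traversed backwards in the face that keeps the part from
    \<open>a\<close> to \<open>b\<close> and forwards in the other one, so each of its darts again
    lies in exactly one face.\<close>
  define S1 S2 where "S1 = P1 \<union> P\<inverse>" and "S2 = P2 \<union> P"
  have revP: "path_darts (b # rev m @ [a]) = P\<inverse>"
    using path_darts_rev[of "a # m @ [b]"] unfolding P_def by simp
  have S1c: "S1 = cycle_darts (a # p @ b # rev m)" and S2c: "S2 = cycle_darts (a # m @ b # q)"
    unfolding cycle_darts_split S1_def S2_def revP P1_def P2_def P_def by auto
  have setpq: "set p \<subseteq> dart_verts E" "set q \<subseteq> dart_verts E"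
    using set_cycle_darts[of "a # p @ b # q"] pq dart_verts_mono[OF SE] by auto
  have dist1: "distinct (a # p @ b # rev m)" and dist2: "distinct (a # m @ b # q)"
    using es(1) pq(3) setpq m by auto
  have len1: "3 \<le> length (a # p @ b # rev m)"
  proof -
    have False if "p = []" "m = []"
      using that PE P12 unfolding P_def P1_def by auto
    then show ?thesis by (cases p; cases m) auto
  qed
  have len2: "3 \<le> length (a # m @ b # q)"
  proof -
    have False if "q = []" "m = []"
      using that P'E P12 unfolding P_def P2_def by auto
    then show ?thesis by (cases q; cases m) auto
  qed
  have Pne: "P \<noteq> {}" using dvP by auto
  have imS1: "im S1 = im P1 \<union> im P" and imS2: "im S2 = im P2 \<union> im P"
    unfolding S1_def S2_def using PD by auto
  have S1n: "S1 \<notin> F" "S2 \<notin> F"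
    using Pne PE P'E UF unfolding S1_def S2_def by auto
  have S12: "S1 \<inter> S2 = {}"
  proof -
    have "P1 \<inter> P2 = {}"
    proof -
      have "card (P1 \<union> P2) = card P1 + card P2"
        using card_cycle_darts[OF pq(3)] pq(1) pq(3) SP card_path_darts[of "a # p @ [b]"] card_path_darts[of "b # q @ [a]"]
        unfolding P1_def P2_def by auto
      then show ?thesis
        using card_Un_Int[of P1 P2] unfolding P1_def P2_def by simp
    qed
    then show ?thesis
      using PE P'E P12 asymP unfolding S1_def S2_def by auto
  qed
  have S1S2: "S1 \<noteq> S2" using S12 Pne unfolding S1_def by auto
  define F' where "F' = F - {S} \<union> {S1, S2}"
  define R' where "R' = R(S1 := R1, S2 := R2)"
  have R'old: "R' T = R T" if "T \<in> F - {S}" for T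
    using that S1n unfolding R'_def by auto
  have R'new: "R' S1 = R1" "R' S2 = R2"
    using S1S2 unfolding R'_def by auto
  let ?E' = "E \<union> (P \<union> P\<inverse>)"
  have imE': "im ?E' = im E \<union> im P" using PD by simp
  have "faced ?E' F' R'"
    unfolding faced_def
  proof (intro conjI)
    show "?E' \<subseteq> D" using ED PD D_sym by auto
    show "?E'\<inverse> = ?E'" using Esym by auto
    show "finite F'" using finF unfolding F'_def by simp
    show "\<forall>S\<in>F'. \<exists>xs. distinct xs \<and> 3 \<le> length xs \<and> S = cycle_darts xs"
      using cyc S1c S2c dist1 dist2 len1 len2 unfolding F'_def by blast
    show "\<Union>F' = ?E'"
    proof -
      have "\<Union>F = \<Union>(F - {S}) \<union> S" using S(1) by auto
      then show ?thesis using UF SP unfolding F'_def S1_def S2_def by auto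
    qed
    show "\<forall>S\<in>F'. \<forall>T\<in>F'. S \<noteq> T \<longrightarrow> S \<inter> T = {}"
    proof -
      have "T \<inter> S1 = {}" "T \<inter> S2 = {}" if "T \<in> F - {S}" for T
      proof -
        have "T \<inter> S = {}" "T \<subseteq> E" using disj that S(1) UF by auto
        then show "T \<inter> S1 = {}" "T \<inter> S2 = {}"
          using PE P'E SP unfolding S1_def S2_def by auto
      qed
      then show ?thesis using disj S12 unfolding F'_def by (auto simp: Int_commute)
    qed
    \<comment> \<open>The ear adds one face, \<open>length m\<close> vertices and
      \<open>length m + 1\<close> edges of two darts each: both sides grow by
      \<open>2 * length m + 2\<close>.\<close>
    show "2 * card F' + 2 * card (dart_verts ?E') = card ?E' + 4"
    proof -
      have "card F' = card (F - {S}) + 2"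
        unfolding F'_def using finF S1n S1S2 by (subst card_Un_disjoint) auto
      moreover have "card F = card (F - {S}) + 1"
        using S(1) finF by (metis Suc_eq_plus1 card.remove)
      moreover have "dart_verts ?E' = dart_verts E \<union> set m"
        using dvP ab by auto
      moreover have "card (dart_verts E \<union> set m) = card (dart_verts E) + length m"
        using m es(1) finite_subset[OF EV finite_V] by (subst card_Un_disjoint) (auto simp: distinct_card)
      moreover have "card ?E' = card E + card (P \<union> P\<inverse>)"
        using PE P'E finite_subset[OF ED finite_D] unfolding P_def by (intro card_Un_disjoint) auto
      moreover have "card (P \<union> P\<inverse>) = 2 * card P"
        using asymP unfolding P_def by (subst card_Un_disjoint) auto
      moreover have "card P = length m + 1"
        unfolding P_def using card_path_darts[OF es(1)] by simp
      ultimately show ?thesis using cnt by simp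
    qed
    show "\<forall>S\<in>F'. R' S = inside (im S) \<or> R' S = outside (im S)"
      using R R1 R2 R'old R'new unfolding F'_def imS1[symmetric] imS2[symmetric] by auto
    have sub: "R1 \<subseteq> R S" "R2 \<subseteq> R S" using R12 by auto
    show "\<forall>S\<in>F'. \<forall>T\<in>F'. S \<noteq> T \<longrightarrow> R' S \<inter> R' T = {}"
    proof -
      have "R' T \<inter> R1 = {}" "R' T \<inter> R2 = {}" if "T \<in> F - {S}" for T
        using Rdisj[of T S] that S(1) sub R'old[OF that] by auto
      then show ?thesis
        using Rdisj R'old R'new R12 unfolding F'_def by (auto simp: Int_commute)
    qed
    show "\<forall>S\<in>F'. R' S \<inter> im ?E' = {}"
    proof -
      have "R1 \<inter> im P = {}" "R2 \<inter> im P = {}"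
        using R1 R2 inside_no_overlap outside_no_overlap by blast+
      moreover have "R1 \<inter> im E = {}" "R2 \<inter> im E = {}" using sub RE[OF S(1)] by auto
      moreover have "R T \<inter> im P = {}" if "T \<in> F - {S}" for T
      proof -
        have "im P \<subseteq> K \<union> im E" using PiE unfolding K_def by auto
        then show ?thesis using RE[of T] Rdisj[of T S] that S(1) KR by auto
      qed
      ultimately have "R' T \<inter> (im E \<union> im P) = {}" if "T \<in> F - {S} \<or> T = S1 \<or> T = S2" for T
        using that RE[of T] R'old[of T] R'new by (metis DiffD1 Int_Un_distrib Un_empty_right)
      then show ?thesis unfolding F'_def imE' by blast
    qed
    show "UNIV = im ?E' \<union> (\<Union>S\<in>F'. R' S)"
    proof -
      have 1: "(\<Union>S\<in>F. R S) = (\<Union>S\<in>F - {S}. R S) \<union> R S" using S(1) by auto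
      have 2: "(\<Union>T\<in>F'. R' T) = (\<Union>T\<in>F - {S}. R T) \<union> R1 \<union> R2"
        using R'old R'new unfolding F'_def by auto
      have "K \<subseteq> im P" unfolding K_def by auto
      then show ?thesis unfolding imE' 2 using cover unfolding 1 R12(2) by auto
    qed
    show "\<forall>S\<in>F'. \<forall>T\<in>F'. \<forall>a b c. (a, b) \<in> S \<and> (b, c) \<in> S \<and> (c, b) \<in> T \<and> (b, a) \<in> T \<longrightarrow> ?E' `` {b} = {a, c}"
    proof (intro ballI allI impI, elim conjE)
      fix U T x y z
      assume UT: "U \<in> F'" "T \<in> F'" and d: "(x, y) \<in> U" "(y, z) \<in> U" "(z, y) \<in> T" "(y, x) \<in> T"
      have asymS: "S \<inter> S\<inverse> = {}" using cycle_darts_asym[OF xs(1,2)] xs(3) by simp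
      have Pf: "v = v'" if "(u, v) \<in> P" "(u, v') \<in> P" for u v v'
        using inj_onD[OF path_darts_inj_on_fst[OF es(1)] _ that[unfolded P_def]] by simp
      have Ps: "v = v'" if "(v, u) \<in> P" "(v', u) \<in> P" for u v v'
        using inj_onD[OF path_darts_inj_on_snd[OF es(1)] _ that[unfolded P_def]] by simp
      have Phl: "(u, a) \<notin> P" "(b, u) \<notin> P" for u
        using path_darts_hd_last[OF es(1)] unfolding P_def by auto
      have P1hl: "(u, a) \<notin> P1" "(b, u) \<notin> P1" for u
        using path_darts_hd_last[of "a # p @ [b]"] pq(3) unfolding P1_def by auto
      have P2hl: "(u, b) \<notin> P2" "(a, u) \<notin> P2" for u
        using path_darts_hd_last[of "b # q @ [a]"] pq(3) unfolding P2_def by auto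
      \<comment> \<open>Interior vertices of the ear have degree 2, its ends admit no shared pair of
        edges, and at all other vertices the darts are as before, though possibly in another
        face.\<close>
      consider (m) "y \<in> set m" | (a) "y = a" | (b) "y = b" | (o) "y \<notin> set (a # m @ [b])" by auto
      then show "?E' `` {y} = {x, z}"
      proof cases
        case m
        then have yE: "(u, y) \<notin> E" "(y, u) \<notin> E" for u
          using \<open>set m \<inter> dart_verts E = {}\<close> dart_vertsI by fastforce+
        have oldE: "W \<in> F \<Longrightarrow> W \<subseteq> E" for W using UF by auto
        have "U = S1 \<or> U = S2" using UT(1) d(1) yE oldE unfolding F'_def by blast
        then have "(x, y) \<in> P \<and> (y, z) \<in> P \<or> (y, x) \<in> P \<and> (z, y) \<in> P"
          using d yE P12 unfolding S1_def S2_def by auto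
        then show ?thesis using yE by (auto dest: Pf Ps)
      next
        case a
        obtain s t where "(s, y) \<in> S" "(y, t) \<in> S"
          using cycle_darts_next[of xs a] xs \<open>a \<in> set xs\<close> a by (metis One_nat_def Suc_1 Suc_leD eval_nat_numeral(3))
        then have False
          using ear_no_new_digon[OF disj UF Esym S(1) SP asymS PE asymP, of y s t U T x z]
            Phl P1hl P2hl dig d UT unfolding F'_def S1_def S2_def a by blast
        then show ?thesis ..
      next
        case b
        obtain s t where "(s, y) \<in> S" "(y, t) \<in> S"
          using cycle_darts_next[of xs b] xs \<open>b \<in> set xs\<close> b by (metis One_nat_def Suc_1 Suc_leD eval_nat_numeral(3))
        \<comment> \<open>The vertex \<open>b\<close> is the start of the reversed ear, so
          \<open>P1\<close> and \<open>P2\<close> change roles, as do \<open>P\<close> and its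
          converse.\<close>
        moreover have "S = P2 \<union> P1" "P\<inverse> \<inter> E = {}" "P\<inverse> \<inter> (P\<inverse>)\<inverse> = {}" using SP P'E asymP by auto
        moreover have "F' = F - {S} \<union> {P2 \<union> (P\<inverse>)\<inverse>, P1 \<union> P\<inverse>}" unfolding F'_def S1_def S2_def by auto
        ultimately have False
          using ear_no_new_digon[OF disj UF Esym S(1), of P2 P1 "P\<inverse>" y s t U T x z] asymS
            Phl P1hl P2hl dig d UT unfolding b by simp
        then show ?thesis ..
      next
        case o
        then have yP: "(u, y) \<notin> P" "(y, u) \<notin> P" for u
          using dvP dart_vertsI by fast+
        have lift: "\<exists>W0\<in>F. (v, y) \<in> W0 \<and> (y, w) \<in> W0" if "W \<in> F'" "(v, y) \<in> W" "(y, w) \<in> W" for v w W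
        proof (cases "W \<in> F")
          case True
          then show ?thesis using that by blast
        next
          case False
          then have "W = S1 \<or> W = S2" using that unfolding F'_def by auto
          then have "(v, y) \<in> S" "(y, w) \<in> S" using that yP SP unfolding S1_def S2_def by auto
          then show ?thesis using S(1) by blast
        qed
        have "E `` {y} = {x, z}"
          using lift[OF UT(1) d(1,2)] lift[OF UT(2) d(3,4)] dig by blast
        then show ?thesis using yP by auto
      qed
    qed
  qed
  then show ?thesis by blast
qed

end

section \<open>Growing a drawing by ears when there is no cut vertex\<close>

lemma rtrancl_imp_path:
  assumes "(u, v) \<in> A\<^sup>*"
  shows "\<exists>xs. xs \<noteq> [] \<and> distinct xs \<and> hd xs = u \<and> last xs = v \<and> path_darts xs \<subseteq> A"
  using assms
proof (induction rule: converse_rtrancl_induct)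
  case base
  then show ?case by (intro exI[of _ "[v]"]) auto
next
  case (step u w)
  then obtain xs where xs: "xs \<noteq> []" "distinct xs" "hd xs = w" "last xs = v" "path_darts xs \<subseteq> A" by auto
  show ?case
  proof (cases "u \<in> set xs")
    case True
    then obtain ys zs where "xs = ys @ u # zs" by (auto simp: in_set_conv_decomp)
    then show ?thesis
      using xs path_darts_append[of ys u zs] by (intro exI[of _ "u # zs"]) auto
  next
    case False
    then show ?thesis
      using xs step by (intro exI[of _ "u # xs"]) (cases xs; auto)
  qed
qed

lemma path_first_hit:
  assumes "(u, v) \<in> A\<^sup>*" "u \<notin> W" "v \<in> W"
  obtains m b where "distinct (u # m @ [b])" "path_darts (u # m @ [b]) \<subseteq> A" "set (u # m) \<inter> W = {}" "b \<in> W"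
proof -
  obtain xs where xs: "xs \<noteq> []" "distinct xs" "hd xs = u" "last xs = v" "path_darts xs \<subseteq> A"
    using rtrancl_imp_path[OF assms(1)] by blast
  then have "\<exists>x\<in>set xs. x \<in> W" using assms(3) last_in_set by blast
  then obtain ys b zs where s: "xs = ys @ b # zs" "b \<in> W" "\<forall>y\<in>set ys. y \<notin> W"
    using split_list_first_prop[of xs "\<lambda>x. x \<in> W"] by blast
  then obtain m where "ys = u # m"
    using xs(3) assms(2) by (cases ys) auto
  then show ?thesis
    using that[of m b] s xs(2,5) path_darts_append[of ys b zs] by auto
qed

definition no_cut_vertex :: "'a set \<Rightarrow> ('a \<times> 'a) set \<Rightarrow> bool" where
  "no_cut_vertex V D \<longleftrightarrow>
     (\<forall>x. \<forall>u\<in>V - {x}. \<forall>v\<in>V - {x}. (u, v) \<in> (D \<inter> (V - {x}) \<times> (V - {x}))\<^sup>*)"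

lemma no_cut_vertexD:
  "no_cut_vertex V D \<Longrightarrow> u \<in> V - {x} \<Longrightarrow> v \<in> V - {x} \<Longrightarrow> (u, v) \<in> (D \<inter> (V - {x}) \<times> (V - {x}))\<^sup>*"
  by (simp add: no_cut_vertex_def)

lemma card_ge_3_ex_other:
  assumes "card V \<ge> 3"
  shows "\<exists>t\<in>V. t \<noteq> u \<and> t \<noteq> v"
proof (rule ccontr)
  assume "\<not> ?thesis"
  then have "V \<subseteq> {u, v}" by auto
  then have "card V \<le> card {u, v}" by (intro card_mono) auto
  also have "\<dots> \<le> 2" by (simp add: card_insert_if)
  finally show False using assms by simp
qed

lemma edge_avoiding:
  assumes "card V \<ge> 3"
    and conn: "no_cut_vertex V D"
    and "u \<in> V" "u \<noteq> x"
  shows "\<exists>w. (u, w) \<in> D \<and> w \<noteq> x"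
proof -
  obtain t where t: "t \<in> V" "t \<noteq> u" "t \<noteq> x" using card_ge_3_ex_other[OF assms(1)] by blast
  have "(u, t) \<in> (D \<inter> (V - {x}) \<times> (V - {x}))\<^sup>*" using no_cut_vertexD[OF conn] assms t by simp
  then obtain w where "(u, w) \<in> D \<inter> (V - {x}) \<times> (V - {x})"
    using t(2) by (metis converse_rtranclE)
  then show ?thesis by blast
qed

context drawn_graph
begin

text \<open>A subgraph with known faces and as many darts as possible is everything: since no vertex
  separates, a missing edge at one of its vertices would continue to an ear ending at another of its
  vertices.\<close>

theorem ex_faces:
  assumes V3: "card V \<ge> 3"
    and conn: "no_cut_vertex V D"
  shows "\<exists>F. finite F \<and> (\<forall>S\<in>F. \<exists>xs. distinct xs \<and> 3 \<le> length xs \<and> S = cycle_darts xs) \<and>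
     \<Union>F = D \<and> (\<forall>S\<in>F. \<forall>T\<in>F. S \<noteq> T \<longrightarrow> S \<inter> T = {}) \<and>
     2 * card F + 2 * card V = card D + 4 \<and>
     (\<forall>S\<in>F. \<forall>T\<in>F. \<forall>a b c. (a, b) \<in> S \<and> (b, c) \<in> S \<and> (c, b) \<in> T \<and> (b, a) \<in> T \<longrightarrow> D `` {b} = {a, c})"
proof -
  note third = card_ge_3_ex_other[OF V3]
  note nbr = edge_avoiding[OF V3 conn]
  obtain y where y: "y \<in> V" using third by blast
  obtain z1 where z1: "(y, z1) \<in> D" using third[of y y] nbr[OF y] by metis
  then have "y \<noteq> z1" using D_irrefl by auto
  then obtain z2 where z2: "(y, z2) \<in> D" "z2 \<noteq> z1" using nbr[OF y] by blast
  have "(z1, z2) \<in> (D \<inter> (V - {y}) \<times> (V - {y}))\<^sup>*"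
    using z1 z2 D_sub D_irrefl by (intro no_cut_vertexD[OF conn]) auto
  then obtain m b where m: "distinct (z1 # m @ [b])" "path_darts (z1 # m @ [b]) \<subseteq> D \<inter> (V - {y}) \<times> (V - {y})" "b = z2"
    using path_first_hit[of z1 z2 "D \<inter> (V - {y}) \<times> (V - {y})" "{z2}"] z2(2) by (metis singletonD singletonI)
  have "y \<notin> set (z1 # m @ [b])"
  proof
    assume "y \<in> set (z1 # m @ [b])"
    then have "y \<in> dart_verts (path_darts (z1 # m @ [b]))" using dart_verts_path[of "z1 # m @ [b]"] by simp
    then show False using m(2) by (auto simp: dart_verts_def)
  qed
  then have cyc: "distinct (y # z1 # m @ [b])" using m(1) by simp
  have "cycle_darts (y # z1 # m @ [b]) \<subseteq> D"
    unfolding cycle_darts_eq_insert[of y "z1 # m" b, simplified] using z1 z2 m D_sym by auto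
  then obtain F0 R0 where F0: "faced (cycle_darts (y # z1 # m @ [b]) \<union> (cycle_darts (y # z1 # m @ [b]))\<inverse>) F0 R0"
    using faced_cycle[OF cyc] by auto
  let ?E0 = "cycle_darts (y # z1 # m @ [b]) \<union> (cycle_darts (y # z1 # m @ [b]))\<inverse>"
  have "\<exists>E. (\<exists>F R. faced E F R) \<and> (\<forall>E'. (\<exists>F R. faced E' F R) \<longrightarrow> card E' \<le> card E)"
  proof (rule ex_has_greatest_nat[of _ ?E0 card "Suc (card D)"])
    show "\<forall>E. (\<exists>F R. faced E F R) \<longrightarrow> card E < Suc (card D)"
      using finite_D by (auto simp: faced_def less_Suc_eq_le card_mono)
  qed (use F0 in blast)
  then obtain E F R where fc: "faced E F R" and mx: "\<And>E' F' R'. faced E' F' R' \<Longrightarrow> card E' \<le> card E"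
    by blast
  have ED: "E \<subseteq> D" and Esym: "E\<inverse> = E" using fc by (auto simp: faced_def)
  have finE: "finite E" using finite_subset[OF ED finite_D] .
  have "(z1, y) \<in> ?E0" by (auto simp: cycle_darts_def)
  then have "card ?E0 > 0" by (intro card_gt_0_iff[THEN iffD2]) auto
  then have "E \<noteq> {}" using mx[OF F0] by auto
  then obtain e1 e2 where e: "(e1, e2) \<in> E" by auto
  then have e12: "e1 \<noteq> e2" using ED D_irrefl by auto
  let ?W = "dart_verts E"
  have W2: "\<exists>w\<in>?W. w \<noteq> x" for x using e e12 dart_vertsI by metis
  have WV: "?W \<subseteq> V" using ED D_sub by (auto simp: dart_verts_def)
  have noear: False if "distinct (a # m @ [b])" "path_darts (a # m @ [b]) \<subseteq> D"
    "a \<in> ?W" "b \<in> ?W" "set m \<inter> ?W = {}" "path_darts (a # m @ [b]) \<inter> E = {}" for a m b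
  proof -
    let ?P = "path_darts (a # m @ [b])"
    note h = that
    obtain F' R' where "faced (E \<union> (?P \<union> ?P\<inverse>)) F' R'"
      using faced_ear[OF fc h] by blast
    then have "card (E \<union> (?P \<union> ?P\<inverse>)) \<le> card E" by (rule mx)
    moreover have "card (E \<union> (?P \<union> ?P\<inverse>)) \<ge> card (E \<union> ?P)"
      using finE by (intro card_mono) auto
    moreover have "card (E \<union> ?P) = card E + card ?P"
      using finE that(6) by (intro card_Un_disjoint) auto
    ultimately show False using card_path_darts[OF that(1)] by simp
  qed
  have closed: "(x, y) \<in> E" if "(x, y) \<in> D" "x \<in> ?W" for x y
  proof (rule ccontr)
    assume n: "(x, y) \<notin> E"
    have xy: "x \<noteq> y" using that D_irrefl by auto
    show False
    proof (cases "y \<in> ?W")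
      case True
      then show False using noear[of x "[]" y] that n xy by auto
    next
      case False
      obtain w where w: "w \<in> ?W" "w \<noteq> x" using W2 by blast
      have "(y, w) \<in> (D \<inter> (V - {x}) \<times> (V - {x}))\<^sup>*"
        using that D_sub WV w xy by (intro no_cut_vertexD[OF conn]) auto
      then obtain m b where m: "distinct (y # m @ [b])" "path_darts (y # m @ [b]) \<subseteq> D \<inter> (V - {x}) \<times> (V - {x})"
        "set (y # m) \<inter> ?W = {}" "b \<in> ?W"
        using path_first_hit[OF _ False w(1)] by metis
      have xn: "x \<notin> set (y # m @ [b])"
      proof
        assume "x \<in> set (y # m @ [b])"
        then have "x \<in> dart_verts (path_darts (y # m @ [b]))" using dart_verts_path[of "y # m @ [b]"] by simp
        then show False using m(2) by (auto simp: dart_verts_def)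
      qed
      have "path_darts (x # (y # m) @ [b]) \<inter> E = {}"
      proof (rule ccontr)
        assume "\<not> ?thesis"
        then obtain s t where st: "(s, t) \<in> path_darts (x # (y # m) @ [b])" "(s, t) \<in> E" by auto
        then have "s \<in> ?W" "t \<in> ?W" using dart_vertsI by metis+
        moreover have "(s, t) \<noteq> (x, y)" using n st by auto
        ultimately have "(s, t) \<in> path_darts (y # m @ [b])" "s = b"
          using st(1) path_darts_verts[of "y # m @ [b]"] m(3) by auto
        then show False using path_darts_hd_last(2)[OF m(1)] by auto
      qed
      then show False
        using noear[of x "y # m" b] m xn that by auto
    qed
  qed
  have all: "v \<in> ?W" if "v \<in> V" for v
  proof (rule ccontr)
    assume v: "v \<notin> ?W"
    \<comment> \<open>Deleting a third vertex \<open>t\<close> is just a way to get a path from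
      \<open>v\<close> to \<open>e1\<close>, since \<open>conn\<close> provides paths in the graph
      minus a vertex.\<close>
    obtain t where t: "t \<in> V" "t \<noteq> v" "t \<noteq> e1" using third by blast
    have "(v, e1) \<in> (D \<inter> (V - {t}) \<times> (V - {t}))\<^sup>*"
      using that t e dart_vertsI[OF e] WV by (intro no_cut_vertexD[OF conn]) auto
    then obtain m b where m: "path_darts (v # m @ [b]) \<subseteq> D \<inter> (V - {t}) \<times> (V - {t})"
        "set (v # m) \<inter> ?W = {}" "b \<in> ?W"
      using path_first_hit[OF _ v, of e1] dart_vertsI(1)[OF e] by metis
    obtain s w where sw: "v # m = s @ [w]" by (cases "v # m" rule: rev_cases) auto
    then have "path_darts (v # m @ [b]) = path_darts (s @ [w, b])" by (metis append_Cons append_assoc append_Nil)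
    then have "(w, b) \<in> D" using m(1) path_darts_snoc[of s w b] by auto
    then have "(b, w) \<in> E" using closed D_sym m(3) by blast
    then show False using dart_vertsI(2) m(2) sw by (metis Int_iff empty_iff in_set_conv_decomp)
  qed
  have "E = D"
    using ED closed all D_sub by auto
  moreover have "?W = V" using all WV by auto
  ultimately show ?thesis using fc unfolding faced_def by (intro exI[of _ F]) auto
qed

end

section \<open>Extending colourings\<close>

locale cover_relation =
  fixes D :: "('a \<times> 'a) set" and K :: "(('a \<times> nat) \<times> ('a \<times> nat)) set"
  assumes K_sym: "(x, y) \<in> K \<Longrightarrow> (y, x) \<in> K"
    and K_D: "((u, a), (v, b)) \<in> K \<Longrightarrow> (u, v) \<in> D"
    and K_match: "((u, a), (v, b)) \<in> K \<Longrightarrow> ((u, a'), (v, b)) \<in> K \<Longrightarrow> a = a'"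
    and D_loop: "(u, u) \<notin> D"
begin

definition nb :: "('a \<times> nat) list \<Rightarrow> 'a \<times> nat \<Rightarrow> ('a \<times> nat) set" where
  "nb l x = {z \<in> set l. (x, z) \<in> K}"

definition appendable :: "('a \<times> nat) list \<Rightarrow> 'a \<times> nat \<Rightarrow> bool" where
  "appendable l x \<longleftrightarrow> snd x \<in> {1..3} \<and> fst x \<notin> fst ` set l \<and>
     (snd x = 1 \<longrightarrow> nb l x = {}) \<and>
     (snd x \<noteq> 1 \<longrightarrow> card (nb l x) \<le> 1 \<and> (\<forall>w \<in> nb l x. card (nb l w) \<le> 1))"

text \<open>The list is the colouring read from left to right. Testing only the new last vertex
  suffices because all conditions on a vertex refer to what lies to its left.\<close>

inductive good :: "('a \<times> nat) list \<Rightarrow> bool" where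
  "good []"
| "good l \<Longrightarrow> appendable l x \<Longrightarrow> good (l @ [x])"

definition colorable :: "'a set \<Rightarrow> bool" where
  "colorable U \<longleftrightarrow> (\<exists>l. good l \<and> fst ` set l = U)"

lemma good_distinct: "good l \<Longrightarrow> distinct (map fst l)"
  by (induction rule: good.induct) (auto simp: appendable_def)

lemma good_inj: "good l \<Longrightarrow> (u, a) \<in> set l \<Longrightarrow> (u, b) \<in> set l \<Longrightarrow> a = b"
  using good_distinct[of l] by (metis eq_key_imp_eq_value)

lemma good_split: "good l \<Longrightarrow> l = p @ x # s \<Longrightarrow> appendable p x"
proof (induction arbitrary: s rule: good.induct)
  case (2 l y)
  show ?case
  proof (cases s rule: rev_cases)
    case Nil
    then show ?thesis using 2 by auto
  next
    case (snoc s' z)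
    then show ?thesis using 2 by auto
  qed
qed simp

lemma nb_append: "nb (l @ [y]) x = nb l x \<union> (if (x, y) \<in> K then {y} else {})"
  by (auto simp: nb_def)

lemma finite_nb [simp]: "finite (nb l x)"
  by (simp add: nb_def)

text \<open>A coloured neighbour carries one colour, and the matching joins this colour to at most
  one of the three colours of \<open>u\<close>.\<close>

lemma conflicts_le:
  assumes "good l" "finite (D `` {u})"
  shows "card (nb l (u, 1)) + card (nb l (u, 2)) + card (nb l (u, 3)) \<le> card (D `` {u} \<inter> fst ` set l)"
proof -
  let ?N = "nb l (u, 1) \<union> nb l (u, 2) \<union> nb l (u, 3)"
  have "inj_on fst ?N"
    using good_inj[OF assms(1)] by (auto simp: inj_on_def nb_def)
  then have "card ?N = card (fst ` ?N)" by (simp add: card_image)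
  also have "\<dots> \<le> card (D `` {u} \<inter> fst ` set l)"
    using assms(2) K_D by (intro card_mono) (force simp: nb_def)+
  finally have le: "card ?N \<le> card (D `` {u} \<inter> fst ` set l)" .
  have dis: "nb l (u, a) \<inter> nb l (u, b) = {}" if "a \<noteq> b" for a b
    using that K_match by (auto simp: nb_def)
  have "card ?N = card (nb l (u, 1)) + card (nb l (u, 2)) + card (nb l (u, 3))"
    using dis[of 1 2] dis[of 1 3] dis[of 2 3] by (subst card_Un_disjoint; auto simp: card_Un_disjoint Int_Un_distrib2)
  then show ?thesis using le by simp
qed

text \<open>
  A vertex with at most two coloured neighbours gets a colour without conflicts. A vertex of \<open>J\<close>
  with three coloured neighbours, at most one of them outside \<open>set us\<close>, can if necessary take one
  of the colours 2, 3 and become adjacent to exactly one vertex of \<open>set us\<close>; the load condition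
  guarantees that this vertex is still the end of a path.
\<close>

lemma colorable_extend:
  assumes us: "distinct us" "set us \<subseteq> U" and fin: "finite U"
    and base: "colorable (U - set us)"
    and step: "\<And>ps u rs. us = ps @ u # rs \<Longrightarrow> card (D `` {u} \<inter> U - set rs) \<le> 2 \<or>
       u \<in> J \<and> card (D `` {u} \<inter> U - set rs) \<le> 3 \<and> card (D `` {u} \<inter> U - set us) \<le> 1"
    and load: "\<And>ps w rs. us = ps @ w # rs \<Longrightarrow>
       (if w \<in> J then 1 else 0) + card {u \<in> set rs \<inter> J. (w, u) \<in> D} \<le> 2"
    and finD: "\<And>u. finite (D `` {u})"
  shows "colorable U"
proof -
  \<comment> \<open>Invariant: the present conflicts of a coloured vertex \<open>w\<close> of
    \<open>us\<close> and the vertices of \<open>J\<close> next to \<open>w\<close> that are still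
    to come number at most 2 in total. So whenever one of the latter is appended to
    \<open>w\<close>, there is at most one vertex next to \<open>w\<close> so far.\<close>
  have "\<exists>l. good l \<and> fst ` set l = U - set rs \<and>
     (\<forall>w c. w \<in> set ps \<longrightarrow> (w, c) \<in> set l \<longrightarrow> card (nb l (w, c)) + card {u \<in> set rs \<inter> J. (w, u) \<in> D} \<le> 2)"
    if "us = ps @ rs" for ps rs
    using that
  proof (induction ps arbitrary: rs rule: rev_induct)
    case Nil
    then show ?case using base by (auto simp: colorable_def)
  next
    case (snoc u ps)
    then have usd: "us = ps @ u # rs" by simp
    obtain l where l: "good l" "fst ` set l = U - set (u # rs)"
      and inv: "\<And>w c. w \<in> set ps \<Longrightarrow> (w, c) \<in> set l \<Longrightarrow>
        card (nb l (w, c)) + card {v \<in> set (u # rs) \<inter> J. (w, v) \<in> D} \<le> 2"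
      using snoc.IH[OF usd] by blast
    have u: "u \<in> U" "u \<notin> set rs" "u \<notin> set ps" using usd us by auto
    let ?c = "card (D `` {u} \<inter> U - set rs)"
    have "D `` {u} \<inter> fst ` set l = D `` {u} \<inter> U - set rs" using l(2) D_loop by auto
    then have cnt: "card (nb l (u, 1)) + card (nb l (u, 2)) + card (nb l (u, 3)) \<le> ?c"
      using conflicts_le[OF l(1) finD] by metis
    have "\<exists>c\<in>{1..3}. appendable l (u, c) \<and> (nb l (u, c) = {} \<or>
       u \<in> J \<and> (\<exists>w. nb l (u, c) = {w} \<and> fst w \<in> set ps))"
    proof (cases "\<exists>c\<in>{1..3}. nb l (u, c) = {}")
      case True
      then obtain c where "c \<in> {1..3}" "nb l (u, c) = {}" by blast
      moreover from this have "appendable l (u, c)" using l(2) by (auto simp: appendable_def)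
      ultimately show ?thesis by blast
    next
      case False
      then have pos: "card (nb l (u, c)) \<ge> 1" if "c \<in> {1..3}" for c
        using that by (simp add: Suc_le_eq card_gt_0_iff)
      then have pos': "card (nb l (u, 1)) \<ge> 1" "card (nb l (u, 2)) \<ge> 1" "card (nb l (u, 3)) \<ge> 1"
        by simp_all
      then have "?c \<ge> 3" using cnt by linarith
      then have J: "u \<in> J" "?c \<le> 3" "card (D `` {u} \<inter> U - set us) \<le> 1"
        using step[OF usd] by auto
      then have "card (nb l (u, 2)) = 1" "card (nb l (u, 3)) = 1"
        using cnt pos' by linarith+
      then obtain w2 w3 where w: "nb l (u, 2) = {w2}" "nb l (u, 3) = {w3}"
        by (metis card_1_singletonE)
      have wl: "w2 \<in> set l" "w3 \<in> set l" "((u, 2), w2) \<in> K" "((u, 3), w3) \<in> K"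
        using w by (auto simp: nb_def)
      then have wD: "(u, fst w2) \<in> D" "(u, fst w3) \<in> D"
        using K_D by (metis prod.collapse)+
      \<comment> \<open>Two colours of \<open>u\<close> are never matched to the same colour of a
        neighbour, and a coloured vertex has one colour only; hence the two conflicts sit over
        different vertices, of which at most one is outside \<open>set us\<close>.\<close>
      have "w2 \<noteq> w3"
        using wl K_match[of u 2 "fst w2" "snd w2" 3] by auto
      then have "fst w2 \<noteq> fst w3"
        using good_inj[OF l(1)] wl by (metis prod.collapse)
      moreover have inU: "fst w2 \<in> U - set (u # rs)" "fst w3 \<in> U - set (u # rs)"
        using wl l(2) by auto
      ultimately have "fst w2 \<in> set us \<or> fst w3 \<in> set us"
      proof -
        have "card {fst w2, fst w3} \<le> card (D `` {u} \<inter> U - set us)" if "fst w2 \<notin> set us" "fst w3 \<notin> set us"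
          using that wD inU finD by (intro card_mono) auto
        then show ?thesis using J(3) \<open>fst w2 \<noteq> fst w3\<close> by fastforce
      qed
      then obtain c w where cw: "c \<in> {2, 3}" "nb l (u, c) = {w}" "fst w \<in> set us" "fst w \<in> U - set (u # rs)"
        using w inU by blast
      then have wps: "fst w \<in> set ps" using usd by auto
      have "w \<in> set l" "((u, c), w) \<in> K" using cw(2) by (auto simp: nb_def)
      then have "(fst w, u) \<in> D" using K_sym K_D by (metis prod.collapse)
      then have "card {v \<in> set (u # rs) \<inter> J. (fst w, v) \<in> D} > 0"
        using J(1) by (subst card_gt_0_iff) auto
      then have "card (nb l w) \<le> 1"
        using inv[OF wps, of "snd w"] \<open>w \<in> set l\<close> unfolding prod.collapse by linarith
      then have "appendable l (u, c)"
        using cw l(2) by (auto simp: appendable_def)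
      then show ?thesis using cw wps J(1) by (intro bexI[of _ c]) auto
    qed
    then obtain c where c: "c \<in> {1..3}" "appendable l (u, c)"
      and cc: "nb l (u, c) = {} \<or> u \<in> J \<and> (\<exists>w. nb l (u, c) = {w} \<and> fst w \<in> set ps)" by blast
    let ?l = "l @ [(u, c)]"
    have g: "good ?l" using l(1) c(2) by (rule good.intros)
    have "fst ` set ?l = U - set rs" using l(2) u by auto
    moreover have "card (nb ?l (w, b)) + card {v \<in> set rs \<inter> J. (w, v) \<in> D} \<le> 2"
      if w: "w \<in> set (ps @ [u])" "(w, b) \<in> set ?l" for w b
    proof (cases "w = u")
      case True
      then have "b = c" using good_inj[OF g, of u b c] w by auto
      have "((u, c), (u, c)) \<notin> K" using K_D D_loop by blast
      then have "nb ?l (u, c) = nb l (u, c)" by (simp add: nb_append)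
      then have "card (nb ?l (u, c)) \<le> (if u \<in> J then 1 else 0)" using cc by auto
      then show ?thesis using load[OF usd] True \<open>b = c\<close> by auto
    next
      case False
      then have w': "w \<in> set ps" "(w, b) \<in> set l" using w by auto
      show ?thesis
      proof (cases "((w, b), (u, c)) \<in> K")
        case True
        then have "(w, b) \<in> nb l (u, c)" using w' K_sym by (auto simp: nb_def)
        then have J: "u \<in> J" using cc by auto
        have "(w, u) \<in> D" using True K_D by blast
        then have "{v \<in> set (u # rs) \<inter> J. (w, v) \<in> D} = insert u {v \<in> set rs \<inter> J. (w, v) \<in> D}"
          using J by auto
        then have "card {v \<in> set (u # rs) \<inter> J. (w, v) \<in> D} = Suc (card {v \<in> set rs \<inter> J. (w, v) \<in> D})"
          using u by simp
        moreover have "card (nb ?l (w, b)) \<le> Suc (card (nb l (w, b)))"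
          using True by (simp add: nb_append card_insert_if)
        ultimately show ?thesis using inv[OF w'] by simp
      next
        case False
        then have "nb ?l (w, b) = nb l (w, b)" by (simp add: nb_append)
        moreover have "card {v \<in> set rs \<inter> J. (w, v) \<in> D} \<le> card {v \<in> set (u # rs) \<inter> J. (w, v) \<in> D}"
          by (intro card_mono) auto
        ultimately show ?thesis using inv[OF w'] by simp
      qed
    qed
    ultimately show ?case using g by blast
  qed
  from this[of us "[]"] show ?thesis by (auto simp: colorable_def)
qed

end

text \<open>Translates positions in a list into the order demanded of a colouring. By the second
  fact the elements strictly to the left of \<open>x\<close> form the prefix before it, which is
  where \<open>appendable\<close> was tested.\<close>

lemma linear_order_on_list:
  assumes "distinct l"
  defines "r \<equiv> {(l ! i, l ! j) | i j. i \<le> j \<and> j < length l}"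
  shows "linear_order_on (set l) r"
    and "l = p @ x # s \<Longrightarrow> {z \<in> set l. (z, x) \<in> r \<and> z \<noteq> x} = set p"
proof -
  have eq: "i = j" if "l ! i = l ! j" "i < length l" "j < length l" for i j
    using that assms(1) nth_eq_iff_index_eq by blast
  show "linear_order_on (set l) r"
    unfolding order_on_defs
  proof (intro conjI)
    show "refl_on (set l) r"
      by (rule refl_onI) (force simp: r_def in_set_conv_nth)
    show "r \<subseteq> set l \<times> set l" by (auto simp: r_def)
    show "trans r"
    proof (rule transI)
      fix a b c assume "(a, b) \<in> r" "(b, c) \<in> r"
      then obtain i j k m where ij: "a = l ! i" "b = l ! j" "i \<le> j" "j < length l"
        "b = l ! k" "c = l ! m" "k \<le> m" "m < length l" by (auto simp: r_def)
      then have "j = k" using eq[of j k] by auto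
      then have "i \<le> m" using ij by simp
      then show "(a, c) \<in> r" unfolding r_def using ij by blast
    qed
    show "antisym r"
    proof (rule antisymI)
      fix a b assume "(a, b) \<in> r" "(b, a) \<in> r"
      then obtain i j k m where ij: "a = l ! i" "b = l ! j" "i \<le> j" "j < length l"
        "b = l ! k" "a = l ! m" "k \<le> m" "m < length l" unfolding r_def by blast
      then have "j = k" "i = m" using eq[of j k] eq[of i m] by auto
      then show "a = b" using ij by auto
    qed
    show "total_on (set l) r" unfolding total_on_def r_def
      by (auto simp: in_set_conv_nth) (metis nat_le_linear)
  qed
  assume l: "l = p @ x # s"
  have x: "l ! length p = x" "length p < length l" using l by auto
  show "{z \<in> set l. (z, x) \<in> r \<and> z \<noteq> x} = set p"
  proof (intro equalityI subsetI)
    fix z assume "z \<in> {z \<in> set l. (z, x) \<in> r \<and> z \<noteq> x}"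
    then obtain i j where ij: "z = l ! i" "x = l ! j" "i \<le> j" "j < length l" "z \<noteq> x" by (auto simp: r_def)
    then have "j = length p" using eq[of j "length p"] x by auto
    then have "i < length p" using ij by (cases "i = j") auto
    then show "z \<in> set p" using ij(1) l by (auto simp: nth_append)
  next
    fix z assume "z \<in> set p"
    then obtain i where i: "i < length p" "z = p ! i" by (auto simp: in_set_conv_nth)
    then have "z = l ! i" using l by (auto simp: nth_append)
    then have "(z, x) \<in> r" unfolding r_def using i x less_imp_le by blast
    moreover have "z \<noteq> x" using assms(1) l \<open>z \<in> set p\<close> by auto
    ultimately show "z \<in> {z \<in> set l. (z, x) \<in> r \<and> z \<noteq> x}" using l \<open>z \<in> set p\<close> by auto
  qed
qed

section \<open>Reducible configurations\<close>

lemma card_ge_list: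
  assumes "distinct xs" "set xs \<subseteq> S" "finite S"
  shows "length xs \<le> card S"
  using card_mono[OF assms(3,2)] distinct_card[OF assms(1)] by simp

lemma card_le_list: "S \<subseteq> set xs \<Longrightarrow> card S \<le> length xs"
  using card_mono[of "set xs" S] card_length[of xs] by simp

text \<open>All that remains of minimality is \<open>irreducible\<close>: an ordering
  \<open>us\<close> with these degree and load conditions would extend a colouring of the other
  vertices to all of \<open>U\<close>. Colours and covers no longer occur.\<close>

locale irreducible_graph =
  fixes U :: "'a set" and D :: "('a \<times> 'a) set"
  assumes finite_U: "finite U"
    and D_sub: "D \<subseteq> U \<times> U"
    and D_sym: "(u, v) \<in> D \<Longrightarrow> (v, u) \<in> D"
    and D_irrefl: "(u, u) \<notin> D"
    and no4: "(a, b) \<in> D \<Longrightarrow> (b, c) \<in> D \<Longrightarrow> (c, d) \<in> D \<Longrightarrow> (d, a) \<in> D \<Longrightarrow> a = c \<or> b = d"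
    and no8: "distinct xs \<Longrightarrow> length xs = 8 \<Longrightarrow> \<not> cycle_darts xs \<subseteq> D"
    and irreducible: "distinct us \<Longrightarrow> us \<noteq> [] \<Longrightarrow> set us \<subseteq> U \<Longrightarrow>
      (\<And>ps u rs. us = ps @ u # rs \<Longrightarrow> card (D `` {u} - set rs) \<le> 2 \<or>
         u \<in> J \<and> card (D `` {u} - set rs) \<le> 3 \<and> card (D `` {u} - set us) \<le> 1) \<Longrightarrow>
      (\<And>ps w rs. us = ps @ w # rs \<Longrightarrow> (if w \<in> J then 1 else 0) + card {u \<in> set rs \<inter> J. (w, u) \<in> D} \<le> 2) \<Longrightarrow>
      False"
begin

definition deg :: "'a \<Rightarrow> nat" where "deg u = card (D `` {u})"

lemma finite_D: "finite D"
  using finite_subset[OF D_sub] finite_U by blast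

lemma finite_nbrs [simp]: "finite (D `` {u})"
  using finite_D by (simp add: finite_Image)

lemma edge_U: "(u, v) \<in> D \<Longrightarrow> u \<in> U" "(u, v) \<in> D \<Longrightarrow> v \<in> U"
  using D_sub by auto

lemma edge_neq: "(u, v) \<in> D \<Longrightarrow> u \<noteq> v"
  using D_irrefl by auto

lemma card_rest: "card (D `` {u} - R) + card (D `` {u} \<inter> R) = deg u"
  unfolding deg_def
  by (metis Diff_Int2 Int_commute add.commute card_Int_Diff finite_nbrs)

lemma rest_le:
  assumes "distinct xs" "set xs \<subseteq> D `` {u}" "set xs \<subseteq> R" "deg u \<le> k + length xs"
  shows "card (D `` {u} - R) \<le> k"
proof -
  have "length xs \<le> card (D `` {u} \<inter> R)"
    using assms by (intro card_ge_list) auto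
  then show ?thesis using card_rest[of u R] assms(4) by linarith
qed

text \<open>The ordering condition, run from the end: \<open>rs\<close> are the vertices coloured
  after \<open>u\<close>, so its coloured neighbours are those outside \<open>set rs\<close>. The
  full configuration \<open>S\<close> stays fixed while the list grows at the front, and a
  configuration is checked one vertex at a time, the last coloured vertex first.\<close>

primrec extends :: "'a set \<Rightarrow> 'a set \<Rightarrow> 'a list \<Rightarrow> bool" where
  "extends S J [] = True"
| "extends S J (u # rs) \<longleftrightarrow>
     (card (D `` {u} - set rs) \<le> 2 \<or> u \<in> J \<and> card (D `` {u} - set rs) \<le> 3 \<and> card (D `` {u} - S) \<le> 1) \<and>
     (if u \<in> J then 1 else 0) + card {v \<in> set rs \<inter> J. (u, v) \<in> D} \<le> 2 \<and> extends S J rs"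

lemma extends_append: "extends S J (ps @ rs) \<Longrightarrow> extends S J rs"
  by (induction ps) auto

lemma not_extends:
  assumes "extends (set us) J us" "distinct us" "us \<noteq> []" "set us \<subseteq> U"
  shows False
proof (rule irreducible[OF assms(2-4)])
  fix ps u rs assume "us = ps @ u # rs"
  then have "extends (set us) J (u # rs)" using assms(1) extends_append by metis
  then show "card (D `` {u} - set rs) \<le> 2 \<or>
         u \<in> J \<and> card (D `` {u} - set rs) \<le> 3 \<and> card (D `` {u} - set us) \<le> 1"
    "(if u \<in> J then 1 else 0) + card {v \<in> set rs \<inter> J. (u, v) \<in> D} \<le> 2"
    by auto
qed

lemma load_le: "{v \<in> set rs \<inter> J. (u, v) \<in> D} \<subseteq> set ys \<Longrightarrow> length ys + (if u \<in> J then 1 else 0) \<le> 2 \<Longrightarrow>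
    (if u \<in> J then 1 else 0) + card {v \<in> set rs \<inter> J. (u, v) \<in> D} \<le> 2"
  using card_le_list[of "{v \<in> set rs \<inter> J. (u, v) \<in> D}" ys] by linarith

text \<open>The lists are certificates: \<open>xs\<close> names neighbours coloured later and
  \<open>ys\<close> covers the later neighbours that may join a path; in
  \<open>extends_join\<close>, \<open>zs\<close> names neighbours within the configuration.\<close>

lemma extends_free:
  assumes "extends S J rs" "distinct xs" "set xs \<subseteq> D `` {u}" "set xs \<subseteq> set rs" "deg u \<le> 2 + length xs"
    and "{v \<in> set rs \<inter> J. (u, v) \<in> D} \<subseteq> set ys" "length ys \<le> 2" "u \<notin> J"
  shows "extends S J (u # rs)"
  using rest_le[OF assms(2-5)] load_le[OF assms(6)] assms(1,7,8) by simp

lemma extends_join: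
  assumes "extends S J rs" "distinct xs" "set xs \<subseteq> D `` {u}" "set xs \<subseteq> set rs" "deg u \<le> 3 + length xs"
    and "distinct zs" "set zs \<subseteq> D `` {u}" "set zs \<subseteq> S" "deg u \<le> 1 + length zs"
    and "{v \<in> set rs \<inter> J. (u, v) \<in> D} \<subseteq> set ys" "length ys \<le> 1" "u \<in> J"
  shows "extends S J (u # rs)"
  using rest_le[OF assms(2-5)] rest_le[OF assms(6-9)] load_le[OF assms(10)] assms(1,11,12) by simp

lemma deg_ge3: "u \<in> U \<Longrightarrow> deg u \<ge> 3"
proof (rule ccontr)
  assume "u \<in> U" "\<not> deg u \<ge> 3"
  then show False
    using not_extends[of "[u]" "{}"] by (simp add: deg_def)
qed

text \<open>The outer vertices are coloured while \<open>b\<close> is still uncoloured, so each has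
  a free colour; \<open>b\<close> can then join the path of one of them.\<close>

lemma no_3_path:
  assumes "deg a = 3" "deg b = 3" "deg c = 3" "(a, b) \<in> D" "(b, c) \<in> D" "a \<noteq> c"
  shows False
proof -
  note n = assms edge_neq[OF assms(4)] edge_neq[OF assms(5)] D_sym[OF assms(4)] D_sym[OF assms(5)]
  let ?e = "extends (set [a, c, b]) {b}"
  have "?e []" by simp
  then have "?e [b]"
    by (rule extends_join[where xs = "[]" and zs = "[a, c]" and ys = "[]"]) (use n in auto)
  then have "?e [c, b]"
    by (rule extends_free[where xs = "[b]" and ys = "[b]"]) (use n in auto)
  then have "?e [a, c, b]"
    by (rule extends_free[where xs = "[b]" and ys = "[b]"]) (use n in auto)
  then show False
    by (rule not_extends) (use n edge_U in auto)
qed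

lemma no_334:
  assumes "deg a = 3" "deg b = 3" "deg z = 4" "(a, b) \<in> D" "(b, z) \<in> D" "(z, a) \<in> D"
  shows False
proof -
  note n = assms edge_neq[OF assms(4)] edge_neq[OF assms(5)] edge_neq[OF assms(6)]
    D_sym[OF assms(4)] D_sym[OF assms(5)] D_sym[OF assms(6)]
  let ?e = "extends (set [z, a, b]) {b}"
  have "?e []" by simp
  then have "?e [b]"
    by (rule extends_join[where xs = "[]" and zs = "[a, z]" and ys = "[]"]) (use n in auto)
  then have "?e [a, b]"
    by (rule extends_free[where xs = "[b]" and ys = "[b]"]) (use n in auto)
  then have "?e [z, a, b]"
    by (rule extends_free[where xs = "[a, b]" and ys = "[b]"]) (use n in auto)
  then show False
    by (rule not_extends) (use n edge_U in auto)
qed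

definition tri344 :: "'a \<Rightarrow> 'a \<Rightarrow> 'a \<Rightarrow> bool" where
  "tri344 v x y \<longleftrightarrow> deg v = 3 \<and> deg x = 4 \<and> deg y = 4 \<and> (v, x) \<in> D \<and> (x, y) \<in> D \<and> (y, v) \<in> D"

lemma tri344_sym: "tri344 v x y \<Longrightarrow> tri344 v y x"
  unfolding tri344_def using D_sym by blast

lemma tri344_facts:
  assumes "tri344 v x y"
  shows "deg v = 3" "deg x = 4" "deg y = 4" "(v, x) \<in> D" "(x, v) \<in> D" "(x, y) \<in> D" "(y, x) \<in> D" "(y, v) \<in> D" "(v, y) \<in> D"
    "v \<noteq> x" "x \<noteq> v" "x \<noteq> y" "y \<noteq> x" "y \<noteq> v" "v \<noteq> y" "v \<in> U" "x \<in> U" "y \<in> U"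
  using assms D_sym edge_neq edge_U unfolding tri344_def by blast+

text \<open>Colouring \<open>x\<close> and \<open>w\<close> first leaves \<open>y\<close> and then
  \<open>v\<close> as vertices that may join a path; \<open>y\<close> can afford both its own
  conflict and that of \<open>v\<close>. Consequently a triangle with degrees 3, 4, 4 has no other
  vertex of degree 3 next to its vertices of degree 4, which keeps several such triangles
  apart.\<close>

lemma tri344_other_3:
  assumes t: "tri344 v x y" and w: "deg w = 3" "(y, w) \<in> D" "w \<noteq> v"
  shows False
proof -
  have "w \<noteq> x" "w \<noteq> y" using w tri344_facts[OF t] by auto
  note n = tri344_facts[OF t] w D_sym[OF w(2)] edge_U[OF w(2)] this
  let ?e = "extends (set [x, w, y, v]) {y, v}"
  have "?e []" by simp
  then have "?e [v]"
    by (rule extends_join[where xs = "[]" and zs = "[x, y]" and ys = "[]"]) (use n in auto)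
  then have "?e [y, v]"
    by (rule extends_join[where xs = "[v]" and zs = "[x, w, v]" and ys = "[v]"]) (use n in auto)
  then have "?e [w, y, v]"
    by (rule extends_free[where xs = "[y]" and ys = "[y, v]"]) (use n in auto)
  then have "?e [x, w, y, v]"
    by (rule extends_free[where xs = "[y, v]" and ys = "[y, v]"]) (use n in auto)
  then show False
    by (rule not_extends) (use n in auto)
qed

lemma tri344_distinct:
  assumes t: "tri344 v x y" and t': "tri344 v' x' y'" and vv': "v \<noteq> v'"
  shows "distinct [x, x', y, y', v, v']" "(v, x') \<notin> D" "(v, y') \<notin> D" "(v', x) \<notin> D" "(v', y) \<notin> D"
    "(x', v) \<notin> D" "(y', v) \<notin> D" "(x, v') \<notin> D" "(y, v') \<notin> D"
proof -
  note n = tri344_facts[OF t] and n' = tri344_facts[OF t']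
  show a: "(x', v) \<notin> D" "(y', v) \<notin> D" "(x, v') \<notin> D" "(y, v') \<notin> D"
    using tri344_other_3[OF t'] tri344_other_3[OF tri344_sym[OF t']]
      tri344_other_3[OF t] tri344_other_3[OF tri344_sym[OF t]] n n' vv' by blast+
  then show "(v, x') \<notin> D" "(v, y') \<notin> D" "(v', x) \<notin> D" "(v', y) \<notin> D"
    using D_sym by blast+
  have "x \<noteq> x'" "x \<noteq> y'" "y \<noteq> x'" "y \<noteq> y'"
    using a n n' by auto
  then show "distinct [x, x', y, y', v, v']"
    using n n' vv' by auto
qed

lemma tri344_adjacent:
  assumes t: "tri344 v x y" and t': "tri344 v' x' y'" and vv': "v \<noteq> v'" and yy': "(y, y') \<in> D"
  shows False
proof -
  note d = tri344_distinct[OF t t' vv']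
  \<comment> \<open>Non-adjacencies matter because the load of a vertex counts every joining vertex
    next to it.\<close>
  have xy': "(x, y') \<notin> D"
    using no4[of v x y' y] tri344_facts[OF t] D_sym[OF yy'] d by auto
  note n = tri344_facts[OF t] tri344_facts[OF t'] yy' D_sym[OF yy'] d xy'
  let ?J = "{y', v, v'}"
  let ?e = "extends (set [x, x', y, y', v, v']) ?J"
  have "?e []" by simp
  then have "?e [v']"
    by (rule extends_join[where xs = "[]" and zs = "[x', y']" and ys = "[]"]) (use n in auto)
  then have "?e [v, v']"
    by (rule extends_join[where xs = "[]" and zs = "[x, y]" and ys = "[v']"]) (use n in auto)
  then have "?e [y', v, v']"
    by (rule extends_join[where xs = "[v']" and zs = "[x', y, v']" and ys = "[v']"]) (use n in auto)
  then have "?e [y, y', v, v']"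
    by (rule extends_free[where xs = "[y', v]" and ys = "[y', v]"]) (use n in auto)
  then have "?e [x', y, y', v, v']"
    by (rule extends_free[where xs = "[y', v']" and ys = "[y', v']"]) (use n in auto)
  then have "?e [x, x', y, y', v, v']"
    by (rule extends_free[where xs = "[y, v]" and ys = "[v]"]) (use n in auto)
  then show False
    by (rule not_extends) (use n in auto)
qed

text \<open>Here \<open>q\<close> is coloured after \<open>x\<close>, \<open>x'\<close> and before
  the four vertices that may join. The absence of 4-cycles keeps \<open>q\<close> away from
  \<open>v\<close> and \<open>v'\<close>, so only \<open>y\<close> and \<open>y'\<close> can burden
  it. On a face this forces the vertex between two such triangles to be big.\<close>

lemma tri344_common_4:
  assumes t: "tri344 v x y" and t': "tri344 v' x' y'" and vv': "v \<noteq> v'"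
    and q: "deg q = 4" "(y, q) \<in> D" "(q, y') \<in> D"
  shows False
proof -
  note d = tri344_distinct[OF t t' vv']
  have q1: "q \<noteq> x" "q \<noteq> x'" "q \<noteq> y" "q \<noteq> y'" "q \<noteq> v" "q \<noteq> v'"
    using tri344_adjacent[OF tri344_sym[OF t] t' vv'] tri344_adjacent[OF t tri344_sym[OF t'] vv'] q
      edge_neq tri344_facts[OF t] tri344_facts[OF t'] by auto
  have yy': "(y, y') \<notin> D" "(x, y') \<notin> D" "(x', y) \<notin> D"
    using tri344_adjacent[OF t t' vv'] tri344_adjacent[OF tri344_sym[OF t] t' vv']
      tri344_adjacent[OF t tri344_sym[OF t'] vv'] D_sym by blast+
  have qv: "(q, v) \<notin> D" "(q, v') \<notin> D"
    using no4[of q v x y] no4[of q v' x' y'] tri344_facts[OF t] tri344_facts[OF t'] q D_sym[OF q(2)] D_sym[OF q(3)] q1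
    by auto
  note n = tri344_facts[OF t] tri344_facts[OF t'] q D_sym[OF q(2)] D_sym[OF q(3)] d q1 yy' qv edge_U[OF q(2)]
  let ?J = "{y, y', v, v'}"
  let ?e = "extends (set [x, x', q, y, y', v, v']) ?J"
  have "?e []" by simp
  then have "?e [v']"
    by (rule extends_join[where xs = "[]" and zs = "[x', y']" and ys = "[]"]) (use n in auto)
  then have "?e [v, v']"
    by (rule extends_join[where xs = "[]" and zs = "[x, y]" and ys = "[v']"]) (use n in auto)
  then have "?e [y', v, v']"
    by (rule extends_join[where xs = "[v']" and zs = "[x', q, v']" and ys = "[v']"]) (use n in auto)
  then have "?e [y, y', v, v']"
    by (rule extends_join[where xs = "[v]" and zs = "[x, q, v]" and ys = "[v]"]) (use n in auto)
  then have "?e [q, y, y', v, v']"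
    by (rule extends_free[where xs = "[y, y']" and ys = "[y, y']"]) (use n in auto)
  then have "?e [x', q, y, y', v, v']"
    by (rule extends_free[where xs = "[y', v']" and ys = "[y', v']"]) (use n in auto)
  then have "?e [x, x', q, y, y', v, v']"
    by (rule extends_free[where xs = "[y, v]" and ys = "[y, v]"]) (use n in auto)
  then show False
    by (rule not_extends) (use n in auto)
qed

definition tri33 :: "'a \<Rightarrow> 'a \<Rightarrow> 'a \<Rightarrow> bool" where
  "tri33 z v w \<longleftrightarrow> deg v = 3 \<and> deg w = 3 \<and> (z, v) \<in> D \<and> (v, w) \<in> D \<and> (w, z) \<in> D"

lemma tri33_facts:
  assumes "tri33 z v w"
  shows "deg v = 3" "deg w = 3" "(z, v) \<in> D" "(v, z) \<in> D" "(v, w) \<in> D" "(w, v) \<in> D" "(w, z) \<in> D" "(z, w) \<in> D"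
    "z \<noteq> v" "v \<noteq> z" "v \<noteq> w" "w \<noteq> v" "w \<noteq> z" "z \<noteq> w" "z \<in> U" "v \<in> U" "w \<in> U"
  using assms D_sym edge_neq edge_U unfolding tri33_def by blast+

text \<open>When \<open>z\<close> is coloured first, four of its neighbours are still uncoloured, so
  degree 6 is just affordable. For the charges: a vertex of degree 5 or 6 has to pay 12 to one
  triangle at most.\<close>

lemma two_tri33:
  assumes t: "tri33 z v1 v2" and t': "tri33 z w1 w2" and d: "{v1, v2} \<inter> {w1, w2} = {}" and z: "deg z \<le> 6"
  shows False
proof -
  note n = tri33_facts[OF t] tri33_facts[OF t'] d z
  let ?J = "{v2, w2}"
  let ?e = "extends (set [z, v1, v2, w1, w2]) ?J"
  have "?e []" by simp
  then have "?e [w2]"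
    by (rule extends_join[where xs = "[]" and zs = "[w1, z]" and ys = "[]"]) (use n in auto)
  then have "?e [w1, w2]"
    by (rule extends_free[where xs = "[w2]" and ys = "[w2]"]) (use n in auto)
  then have "?e [v2, w1, w2]"
    by (rule extends_join[where xs = "[]" and zs = "[v1, z]" and ys = "[w2]"]) (use n in auto)
  then have "?e [v1, v2, w1, w2]"
    by (rule extends_free[where xs = "[v2]" and ys = "[v2, w2]"]) (use n in auto)
  then have "?e [z, v1, v2, w1, w2]"
    by (rule extends_free[where xs = "[v1, v2, w1, w2]" and ys = "[v2, w2]"]) (use n in auto)
  then show False
    by (rule not_extends) (use n in auto)
qed

text \<open>A vertex \<open>z\<close> of degree 5 that pays 12 to a triangle with two vertices of
  degree 3 has nothing left. This lemma and the next one ensure that a second triangle at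
  \<open>z\<close>, with one vertex of degree 3, finds another payer.\<close>

lemma tri33_tri345:
  assumes t: "tri33 z v1 v2" and z: "deg z = 5"
    and x: "deg x = 4" "deg v = 3" "(z, x) \<in> D" "(x, v) \<in> D" "(v, z) \<in> D" and d: "v \<noteq> v1" "v \<noteq> v2"
  shows False
proof -
  have "x \<noteq> v1" "x \<noteq> v2" using x tri33_facts[OF t] by auto
  note n = tri33_facts[OF t] z x D_sym[OF x(3)] D_sym[OF x(4)] D_sym[OF x(5)] edge_neq[OF x(3)] edge_neq[OF x(4)]
    edge_neq[OF x(5)] d this edge_U[OF x(4)]
  let ?J = "{v2, v}"
  let ?e = "extends (set [x, z, v1, v2, v]) ?J"
  have "?e []" by simp
  then have "?e [v]"
    by (rule extends_join[where xs = "[]" and zs = "[x, z]" and ys = "[]"]) (use n in auto)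
  then have "?e [v2, v]"
    by (rule extends_join[where xs = "[]" and zs = "[v1, z]" and ys = "[v]"]) (use n in auto)
  then have "?e [v1, v2, v]"
    by (rule extends_free[where xs = "[v2]" and ys = "[v2, v]"]) (use n in auto)
  then have "?e [z, v1, v2, v]"
    by (rule extends_free[where xs = "[v1, v2, v]" and ys = "[v2, v]"]) (use n in auto)
  then have "?e [x, z, v1, v2, v]"
    by (rule extends_free[where xs = "[z, v]" and ys = "[v2, v]"]) (use n in auto)
  then show False
    by (rule not_extends) (use n in auto)
qed

lemma tri33_tri33_tri355:
  assumes t: "tri33 z v1 v2" and t': "tri33 z' w1 w2" and z: "deg z = 5" "deg z' = 5"
    and v: "deg v = 3" "(z, v) \<in> D" "(v, z') \<in> D" "(z', z) \<in> D"
    and d: "v \<notin> {v1, v2, w1, w2}"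
  shows False
proof -
  note s = D_sym[OF v(2)] D_sym[OF v(3)] D_sym[OF v(4)] edge_neq[OF v(2)] edge_neq[OF v(3)] edge_neq[OF v(4)]
  note n = tri33_facts[OF t] tri33_facts[OF t']
  \<comment> \<open>Since \<open>v\<close> is the only common neighbour of \<open>z\<close> and
    \<open>z'\<close>, the two outer triangles are disjoint and each of \<open>z\<close>,
    \<open>z'\<close> is next to two joining vertices only.\<close>
  have a: "(z, w1) \<notin> D" "(z, w2) \<notin> D" "(z', v1) \<notin> D" "(z', v2) \<notin> D"
    using no4[of z w1 z' v] no4[of z w2 z' v] no4[of z' v1 z v] no4[of z' v2 z v] n v s d by auto
  then have "{v1, v2} \<inter> {w1, w2} = {}" using n by auto
  moreover have "(v, v2) \<notin> D" "(v, w2) \<notin> D"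
    using no_3_path[of v v2 v1] no_3_path[of v w2 w1] n d v by auto
  moreover have "z \<noteq> w1" "z \<noteq> w2" "z' \<noteq> v1" "z' \<noteq> v2" using n z by auto
  ultimately have m: "v1 \<noteq> w1" "v1 \<noteq> w2" "v2 \<noteq> w1" "v2 \<noteq> w2" "(v, v2) \<notin> D" "(v, w2) \<notin> D"
     "z \<noteq> w1" "z \<noteq> w2" "z' \<noteq> v1" "z' \<noteq> v2" by auto
  let ?J = "{v, v2, w2}"
  let ?e = "extends (set [z, z', v, v1, v2, w1, w2]) ?J"
  have "?e []" by simp
  then have "?e [w2]"
    by (rule extends_join[where xs = "[]" and zs = "[w1, z']" and ys = "[]"]) (use n z in auto)
  then have "?e [w1, w2]"
    by (rule extends_free[where xs = "[w2]" and ys = "[w2]"]) (use n d m in auto)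
  then have "?e [v2, w1, w2]"
    by (rule extends_join[where xs = "[]" and zs = "[v1, z]" and ys = "[w2]"]) (use n m in auto)
  then have "?e [v1, v2, w1, w2]"
    by (rule extends_free[where xs = "[v2]" and ys = "[v2, w2]"]) (use n m d in auto)
  then have "?e [v, v1, v2, w1, w2]"
    by (rule extends_join[where xs = "[]" and zs = "[z, z']" and ys = "[]"]) (use n m d v s in auto)
  then have "?e [z', v, v1, v2, w1, w2]"
    by (rule extends_free[where xs = "[v, w1, w2]" and ys = "[v, w2]"]) (use n m d v s a z in auto)
  then have "?e [z, z', v, v1, v2, w1, w2]"
    by (rule extends_free[where xs = "[z', v, v1, v2]" and ys = "[v, v2]"]) (use n m d v s a z in auto)
  then show False
    by (rule not_extends) (use n m d v s edge_U in auto)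
qed

end

section \<open>Plane end blocks\<close>

text \<open>
  The block \<open>B\<close> is attached to the rest of the graph at \<open>X\<close> only. The degree of \<open>X\<close> inside \<open>B\<close> can be
  as small as 2; therefore \<open>X\<close> never counts as a vertex of degree 3 or 4 below, but as a big one.
\<close>

locale plane_block = irreducible_graph U D for U :: "'a set" and D +
  fixes B :: "'a set" and X :: 'a and F :: "('a \<times> 'a) set set"
  assumes B_sub: "B \<subseteq> U" and X_B: "X \<in> B"
    and full: "v \<in> B \<Longrightarrow> v \<noteq> X \<Longrightarrow> (v, w) \<in> D \<Longrightarrow> w \<in> B"
    and finite_F: "finite F"
    and F_cycle: "S \<in> F \<Longrightarrow> \<exists>xs. distinct xs \<and> 3 \<le> length xs \<and> S = cycle_darts xs"
    and F_union: "\<Union>F = D \<inter> B \<times> B"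
    and F_disj: "S \<in> F \<Longrightarrow> T \<in> F \<Longrightarrow> S \<noteq> T \<Longrightarrow> S \<inter> T = {}"
    and euler: "2 * card F + 2 * card B = card (D \<inter> B \<times> B) + 4"
    and digon: "S \<in> F \<Longrightarrow> T \<in> F \<Longrightarrow> (a, b) \<in> S \<Longrightarrow> (b, c) \<in> S \<Longrightarrow> (c, b) \<in> T \<Longrightarrow> (b, a) \<in> T \<Longrightarrow>
      (D \<inter> B \<times> B) `` {b} = {a, c}"
    and X_deg: "card ((D \<inter> B \<times> B) `` {X}) \<ge> 2"
begin

abbreviation E :: "('a \<times> 'a) set" where "E \<equiv> D \<inter> B \<times> B"

definition degB :: "'a \<Rightarrow> nat" where "degB v = card (E `` {v})"

lemma finite_B: "finite B"
  using finite_subset[OF B_sub finite_U] .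

lemma finite_E: "finite E"
  using finite_D by simp

lemma nbrs_eq: "v \<in> B \<Longrightarrow> v \<noteq> X \<Longrightarrow> E `` {v} = D `` {v}"
  using full by auto

lemma degB_eq: "v \<in> B \<Longrightarrow> v \<noteq> X \<Longrightarrow> degB v = deg v"
  using nbrs_eq by (simp add: degB_def deg_def)

lemma degB_ge3: "v \<in> B \<Longrightarrow> v \<noteq> X \<Longrightarrow> degB v \<ge> 3"
  using degB_eq deg_ge3 B_sub by auto

lemma face_sub: "S \<in> F \<Longrightarrow> S \<subseteq> E"
  using F_union by auto

lemma faceD: "S \<in> F \<Longrightarrow> (u, v) \<in> S \<Longrightarrow> (u, v) \<in> D" "S \<in> F \<Longrightarrow> (u, v) \<in> S \<Longrightarrow> u \<in> B"
  "S \<in> F \<Longrightarrow> (u, v) \<in> S \<Longrightarrow> v \<in> B"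
  using face_sub by blast+

lemma face_D_rev: "S \<in> F \<Longrightarrow> (u, v) \<in> S \<Longrightarrow> (v, u) \<in> D"
  using faceD(1) D_sym by blast

lemma ex_face: "d \<in> E \<Longrightarrow> \<exists>S\<in>F. d \<in> S"
  using F_union by auto

lemma face_unique: "S \<in> F \<Longrightarrow> T \<in> F \<Longrightarrow> d \<in> S \<Longrightarrow> d \<in> T \<Longrightarrow> S = T"
  using F_disj by blast

lemma face_finite: "S \<in> F \<Longrightarrow> finite S"
  using finite_subset[OF face_sub finite_E] .

lemma face_card3: "S \<in> F \<Longrightarrow> card S \<ge> 3"
  using F_cycle card_cycle_darts by fastforce

lemma face_fst: "S \<in> F \<Longrightarrow> (u, v) \<in> S \<Longrightarrow> (u, w) \<in> S \<Longrightarrow> v = w"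
  using F_cycle cycle_darts_inj_on(1) by (metis inj_onD fst_conv snd_conv)

lemma face_snd: "S \<in> F \<Longrightarrow> (v, u) \<in> S \<Longrightarrow> (w, u) \<in> S \<Longrightarrow> v = w"
  using F_cycle cycle_darts_inj_on(2) by (metis inj_onD fst_conv snd_conv)

lemma face_asym: "S \<in> F \<Longrightarrow> (u, v) \<in> S \<Longrightarrow> (v, u) \<notin> S"
  using F_cycle cycle_darts_asym by blast

lemma face_list:
  assumes "S \<in> F" "(a, b) \<in> S"
  obtains r where "distinct (a # b # r)" "S = cycle_darts (a # b # r)" "card S = length (a # b # r)"
proof -
  obtain xs where xs: "distinct xs" "3 \<le> length xs" "S = cycle_darts xs"
    using F_cycle[OF assms(1)] by auto
  then have "a \<in> set xs"
    using set_cycle_darts[of xs] assms(2) dart_vertsI by fastforce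
  then obtain r where r: "cycle_darts (a # r) = S" "length (a # r) = length xs" "distinct (a # r)"
    using cycle_rotate_to xs by metis
  then obtain c r' where c: "r = c # r'" using xs(2) by (cases r) auto
  then have "(a, c) \<in> S" using r(1) by (auto simp: cycle_darts_def)
  then have "c = b" using face_fst assms by blast
  then show ?thesis
    using that[of r'] r c card_cycle_darts[of "a # r"] xs by auto
qed

lemma face_next:
  assumes "S \<in> F" "(a, b) \<in> S"
  shows "\<exists>c. (b, c) \<in> S \<and> c \<noteq> a" "\<exists>c. (c, a) \<in> S \<and> c \<noteq> b"
proof -
  obtain xs where xs: "distinct xs" "3 \<le> length xs" "S = cycle_darts xs"
    using F_cycle[OF assms(1)] by auto
  then have v: "a \<in> set xs" "b \<in> set xs"
    using set_cycle_darts[of xs] assms(2) dart_vertsI by fastforce+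
  have l: "2 \<le> length xs" using xs(2) by simp
  obtain c where "(b, c) \<in> S" using cycle_darts_next[OF l v(2)] xs(3) by metis
  then show "\<exists>c. (b, c) \<in> S \<and> c \<noteq> a" using face_asym[OF assms] by blast
  obtain c where "(c, a) \<in> S" using cycle_darts_next[OF l v(1)] xs(3) by metis
  then show "\<exists>c. (c, a) \<in> S \<and> c \<noteq> b" using face_asym[OF assms] by blast
qed

lemma face_vert: "S \<in> F \<Longrightarrow> v \<in> dart_verts S \<Longrightarrow> \<exists>a b. (a, v) \<in> S \<and> (v, b) \<in> S"
  using face_next by (fastforce simp: dart_verts_def)

lemma face_verts_B: "S \<in> F \<Longrightarrow> v \<in> dart_verts S \<Longrightarrow> v \<in> B"
  using face_vert faceD(2) by blast

lemma length_list_cases: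
  "length r = 1 \<Longrightarrow> \<exists>c. r = [c]" "length r = 3 \<Longrightarrow> \<exists>c d e. r = [c, d, e]"
  "length r = 4 \<Longrightarrow> \<exists>c d e f. r = [c, d, e, f]" "length r = 5 \<Longrightarrow> \<exists>c d e f g. r = [c, d, e, f, g]"
  by (auto simp: numeral_eq_Suc length_Suc_conv)

lemma face3:
  assumes "S \<in> F" "card S = 3" "(a, b) \<in> S"
  obtains c where "distinct [a, b, c]" "S = {(a, b), (b, c), (c, a)}"
proof -
  obtain r where r: "distinct (a # b # r)" "S = cycle_darts (a # b # r)" "card S = length (a # b # r)"
    using face_list[OF assms(1,3)] .
  then obtain c where "r = [c]" using length_list_cases(1)[of r] assms by auto
  then show ?thesis using r that[of c] by (auto simp: cycle_darts_def)
qed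

lemma face5:
  assumes "S \<in> F" "card S = 5" "(a, b) \<in> S"
  obtains c d e where "distinct [a, b, c, d, e]" "S = {(a, b), (b, c), (c, d), (d, e), (e, a)}"
proof -
  obtain r where r: "distinct (a # b # r)" "S = cycle_darts (a # b # r)" "card S = length (a # b # r)"
    using face_list[OF assms(1,3)] .
  then obtain c d e where "r = [c, d, e]" using length_list_cases(2)[of r] assms by auto
  then show ?thesis using r that[of c d e] by (auto simp: cycle_darts_def)
qed

lemma face6:
  assumes "S \<in> F" "card S = 6" "(a, b) \<in> S"
  obtains c d e f where "distinct [a, b, c, d, e, f]" "S = {(a, b), (b, c), (c, d), (d, e), (e, f), (f, a)}"
proof -
  obtain r where r: "distinct (a # b # r)" "S = cycle_darts (a # b # r)" "card S = length (a # b # r)"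
    using face_list[OF assms(1,3)] .
  then obtain c d e f where "r = [c, d, e, f]" using length_list_cases(3)[of r] assms by auto
  then show ?thesis using r that[of c d e f] by (auto simp: cycle_darts_def)
qed

lemma face7:
  assumes "S \<in> F" "card S = 7" "(a, b) \<in> S"
  obtains c d e f g where "distinct [a, b, c, d, e, f, g]"
    "S = {(a, b), (b, c), (c, d), (d, e), (e, f), (f, g), (g, a)}"
proof -
  obtain r where r: "distinct (a # b # r)" "S = cycle_darts (a # b # r)" "card S = length (a # b # r)"
    using face_list[OF assms(1,3)] .
  then obtain c d e f g where "r = [c, d, e, f, g]" using length_list_cases(4)[of r] assms by auto
  then show ?thesis using r that[of c d e f g] by (auto simp: cycle_darts_def)
qed

lemma face_not_4_8: "S \<in> F \<Longrightarrow> card S \<noteq> 4" "S \<in> F \<Longrightarrow> card S \<noteq> 8"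
proof -
  assume S: "S \<in> F"
  then obtain xs where xs: "distinct xs" "3 \<le> length xs" "S = cycle_darts xs"
    using F_cycle by blast
  then have len: "card S = length xs" using card_cycle_darts by fastforce
  have SD: "cycle_darts xs \<subseteq> D" using face_sub[OF S] xs by auto
  show "card S \<noteq> 8" using no8[OF xs(1)] SD len by auto
  show "card S \<noteq> 4"
  proof
    assume "card S = 4"
    then obtain a b c d where "xs = [a, b, c, d]"
      using len by (auto simp: numeral_eq_Suc length_Suc_conv)
    then show False using SD xs(1) no4[of a b c d] by (auto simp: cycle_darts_def)
  qed
qed

definition three :: "'a \<Rightarrow> bool" where "three v \<longleftrightarrow> v \<in> B \<and> v \<noteq> X \<and> deg v = 3"
definition four :: "'a \<Rightarrow> bool" where "four v \<longleftrightarrow> v \<in> B \<and> v \<noteq> X \<and> deg v = 4"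
definition big :: "'a \<Rightarrow> bool" where "big v \<longleftrightarrow> v \<in> B \<and> \<not> three v \<and> \<not> four v"
text \<open>Two faces share two consecutive edges only at a vertex of degree 2 of the block, that
  is, at \<open>X\<close>. The faces through such an \<open>X\<close> are the exceptions in all
  overlap arguments.\<close>

definition bad :: "('a \<times> 'a) set \<Rightarrow> bool" where "bad S \<longleftrightarrow> degB X = 2 \<and> X \<in> dart_verts S"

lemma digon_bad:
  assumes "S \<in> F" "T \<in> F" "(a, b) \<in> S" "(b, c) \<in> S" "(c, b) \<in> T" "(b, a) \<in> T"
  shows "b = X" "bad S" "bad T"
proof -
  have n: "E `` {b} = {a, c}" using digon[OF assms] .
  have b: "b \<in> B" using faceD assms by blast
  have "degB b \<le> 2" unfolding degB_def n by (simp add: card_insert_if)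
  then show bX: "b = X" using degB_ge3[OF b] by force
  then have "degB X = 2" using X_deg \<open>degB b \<le> 2\<close> unfolding degB_def by simp
  then show "bad S" "bad T" using bX assms dart_vertsI unfolding bad_def by metis+
qed

text \<open>Different third vertices give a 4-cycle. A common third vertex would make both
  \<open>u\<close> and \<open>v\<close> vertices of degree 2 in the block, but only \<open>X\<close>
  can be one.\<close>

lemma tri_tri:
  assumes S: "S \<in> F" "card S = 3" "(u, v) \<in> S" and T: "T \<in> F" "card T = 3" "(v, u) \<in> T"
  shows False
proof -
  obtain x where x: "S = {(u, v), (v, x), (x, u)}" "distinct [u, v, x]" using face3[OF S] by metis
  obtain y where y: "T = {(v, u), (u, y), (y, v)}" "distinct [v, u, y]" using face3[OF T] by metis
  show False
  proof (cases "x = y")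
    case True
    then have "v = X" "u = X"
      using digon_bad(1)[of S T u v x] digon_bad(1)[of S T x u v] S T x y by auto
    then show False using x by auto
  next
    case False
    have "(u, x) \<in> D" "(x, v) \<in> D" "(v, y) \<in> D" "(y, u) \<in> D"
      using x y faceD(1)[OF S(1)] faceD(1)[OF T(1)] D_sym by auto
    then show False using no4[of u x v y] False x by auto
  qed
qed

text \<open>Entering \<open>v\<close> from a neighbour and leaving along the same face is an
  injective map of the neighbours without fixed points. The digon clause excludes that it swaps two
  of them, so it is a 3-cycle: the rotation at \<open>v\<close>, obtained without geometry.\<close>

lemma three_faces:
  assumes v: "three v"
  obtains a b c S1 S2 S3 where "distinct [a, b, c]" "D `` {v} = {a, b, c}"
    "S1 \<in> F" "S2 \<in> F" "S3 \<in> F" "distinct [S1, S2, S3]"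
    "(a, v) \<in> S1" "(v, b) \<in> S1" "(b, v) \<in> S2" "(v, c) \<in> S2" "(c, v) \<in> S3" "(v, a) \<in> S3"
proof -
  have vB: "v \<in> B" "v \<noteq> X" "deg v = 3" using v by (auto simp: three_def)
  have nE: "(v, w) \<in> D \<Longrightarrow> (v, w) \<in> E \<and> (w, v) \<in> E" for w using full vB D_sym by auto
  have step: "\<exists>S w. S \<in> F \<and> (u, v) \<in> S \<and> (v, w) \<in> S \<and> w \<noteq> u \<and> (v, w) \<in> D" if "(v, u) \<in> D" for u
  proof -
    have "(u, v) \<in> E" using nE[OF that] by simp
    then obtain S where S: "S \<in> F" "(u, v) \<in> S" using ex_face by blast
    then show ?thesis using face_next(1)[OF S] faceD(1) by blast
  qed
  have diff: "S \<noteq> T" if "S \<in> F" "T \<in> F" "(u, v) \<in> S" "(u', v) \<in> T" "u \<noteq> u'" for S T u u'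
    using that face_snd by blast
  have inj: "w \<noteq> w'" if "S \<in> F" "T \<in> F" "(u, v) \<in> S" "(u', v) \<in> T" "u \<noteq> u'" "(v, w) \<in> S" "(v, w') \<in> T" for S T u u' w w'
    using that diff face_unique by metis
  have "D `` {v} \<noteq> {}" using vB(3) unfolding deg_def by auto
  then obtain a where "(v, a) \<in> D" by blast
  then obtain S1 b where 1: "S1 \<in> F" "(a, v) \<in> S1" "(v, b) \<in> S1" "b \<noteq> a" "(v, b) \<in> D" using step by blast
  then obtain S2 c where 2: "S2 \<in> F" "(b, v) \<in> S2" "(v, c) \<in> S2" "c \<noteq> b" "(v, c) \<in> D" using step by blast
  have ca: "c \<noteq> a"
  proof
    assume "c = a"
    then show False using digon_bad(1)[of S1 S2 a v b] 1 2 vB(2) by auto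
  qed
  then obtain S3 a' where 3: "S3 \<in> F" "(c, v) \<in> S3" "(v, a') \<in> S3" "a' \<noteq> c" "(v, a') \<in> D" using step 2 by blast
  have "{a, b, c} \<subseteq> D `` {v}" using 1 2 \<open>(v, a) \<in> D\<close> by auto
  moreover have "card {a, b, c} = 3" using 1 2 ca by auto
  ultimately have n: "D `` {v} = {a, b, c}" using vB(3) unfolding deg_def by (metis card_subset_eq finite_nbrs)
  then have "a' \<in> {a, b, c}" using 3 by auto
  moreover have "a' \<noteq> b" using inj[of S1 S3 a c b a'] 1 3 ca by auto
  ultimately have "a' = a" using 3 by auto
  then show ?thesis
    using that[of a b c S1 S2 S3] 1 2 3 ca n diff[of S1 S2 a b] diff[of S2 S3 b c] diff[of S1 S3 a c] by auto
qed

definition TF :: "'a \<Rightarrow> ('a \<times> 'a) set set" where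
  "TF v = {S \<in> F. card S = 3 \<and> v \<in> dart_verts S}"

lemma finite_TF [simp]: "finite (TF v)"
  using finite_F by (simp add: TF_def)

text \<open>Triangular faces share no edge, so those at \<open>v\<close> use disjoint pairs of
  neighbours.\<close>

lemma TF_count: "2 * card (TF v) \<le> degB v"
proof -
  define N where "N = (\<lambda>S. {w. (v, w) \<in> S \<or> (w, v) \<in> S})"
  have two: "card (N S) = 2 \<and> N S \<subseteq> E `` {v}" if "S \<in> TF v" for S
  proof -
    have S: "S \<in> F" using that by (auto simp: TF_def)
    have "v \<in> dart_verts S" using that by (simp add: TF_def)
    then obtain a b where ab: "(a, v) \<in> S" "(v, b) \<in> S" using face_vert[OF S] by blast
    then have "N S = {a, b}" unfolding N_def using face_fst[OF S] face_snd[OF S] by blast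
    moreover have "a \<noteq> b" using face_asym[OF S] ab by auto
    ultimately show ?thesis using ab face_D_rev[OF S] faceD[OF S] by auto
  qed
  have dis: "N S \<inter> N T = {}" if "S \<in> TF v" "T \<in> TF v" "S \<noteq> T" for S T
  proof (rule ccontr)
    assume "N S \<inter> N T \<noteq> {}"
    then obtain w where "(v, w) \<in> S \<or> (w, v) \<in> S" "(v, w) \<in> T \<or> (w, v) \<in> T" unfolding N_def by auto
    then show False
      using that F_disj[of S T] tri_tri[of S v w T] tri_tri[of S w v T] unfolding TF_def by auto
  qed
  have fin: "finite (N S)" if "S \<in> TF v" for S using two[OF that] by (metis card.infinite zero_neq_numeral)
  have "2 * card (TF v) = (\<Sum>S\<in>TF v. card (N S))" using two by simp
  also have "\<dots> = card (\<Union>S\<in>TF v. N S)"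
    using dis fin by (intro card_UN_disjoint[symmetric]) auto
  also have "\<dots> \<le> card (E `` {v})"
    using two finite_E by (intro card_mono) auto
  finally show ?thesis unfolding degB_def .
qed

end

section \<open>Overlapping short cycles\<close>

context irreducible_graph
begin

lemma no4': "(a, b) \<in> D \<Longrightarrow> (b, c) \<in> D \<Longrightarrow> (c, d) \<in> D \<Longrightarrow> a \<noteq> c \<Longrightarrow> b \<noteq> d \<Longrightarrow> (a, d) \<notin> D"
  using no4[of a b c d] D_sym by blast

definition cyc :: "'a list \<Rightarrow> bool" where
  "cyc xs \<longleftrightarrow> distinct xs \<and> cycle_darts xs \<subseteq> D"

lemma cyc_rotate: "cyc (x # xs) \<Longrightarrow> cyc (xs @ [x])"
  unfolding cyc_def using cycle_darts_rotate[of "[x]" xs] by auto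

lemma cyc_rev: "cyc xs \<Longrightarrow> cyc (rev xs)"
  unfolding cyc_def cycle_darts_rev using D_sym by auto

lemma no_cyc8: "cyc [a, b, c, d, e, f, g, h] \<Longrightarrow> False"
  using no8[of "[a, b, c, d, e, f, g, h]"] by (auto simp: cyc_def)

lemma cyc5:
  "cyc [a, b, c, d, e] \<longleftrightarrow> distinct [a, b, c, d, e] \<and> (a, b) \<in> D \<and> (b, c) \<in> D \<and> (c, d) \<in> D \<and> (d, e) \<in> D \<and> (e, a) \<in> D"
  by (auto simp: cyc_def cycle_darts_def)

lemma cyc6:
  "cyc [a, b, c, d, e, f] \<longleftrightarrow> distinct [a, b, c, d, e, f] \<and> (a, b) \<in> D \<and> (b, c) \<in> D \<and> (c, d) \<in> D \<and> (d, e) \<in> D \<and>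
     (e, f) \<in> D \<and> (f, a) \<in> D"
  by (auto simp: cyc_def cycle_darts_def)

lemma cyc7:
  "cyc [a, b, c, d, e, f, g] \<longleftrightarrow> distinct [a, b, c, d, e, f, g] \<and> (a, b) \<in> D \<and> (b, c) \<in> D \<and> (c, d) \<in> D \<and> (d, e) \<in> D \<and>
     (e, f) \<in> D \<and> (f, g) \<in> D \<and> (g, a) \<in> D"
  by (auto simp: cyc_def cycle_darts_def)

lemma cyc8:
  "cyc [a, b, c, d, e, f, g, h] \<longleftrightarrow> distinct [a, b, c, d, e, f, g, h] \<and> (a, b) \<in> D \<and> (b, c) \<in> D \<and> (c, d) \<in> D \<and>
     (d, e) \<in> D \<and> (e, f) \<in> D \<and> (f, g) \<in> D \<and> (g, h) \<in> D \<and> (h, a) \<in> D"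
  by (auto simp: cyc_def cycle_darts_def)

lemma cyc5_chord:
  assumes "cyc [a, b, c, d, e]"
  shows "(a, c) \<notin> D" "(c, a) \<notin> D"
proof -
  show "(a, c) \<notin> D" using assms no4'[of a e d c] D_sym unfolding cyc5 by auto
  then show "(c, a) \<notin> D" using D_sym by blast
qed

lemma cyc5_chords:
  assumes "cyc [a, b, c, d, e]"
  shows "(a, c) \<notin> D" "(b, d) \<notin> D" "(c, e) \<notin> D" "(d, a) \<notin> D" "(e, b) \<notin> D"
    "(c, a) \<notin> D" "(d, b) \<notin> D" "(e, c) \<notin> D" "(a, d) \<notin> D" "(b, e) \<notin> D"
proof -
  have r: "cyc [b, c, d, e, a]" using cyc_rotate[OF assms] by simp
  have r2: "cyc [c, d, e, a, b]" using cyc_rotate[OF r] by simp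
  have r3: "cyc [d, e, a, b, c]" using cyc_rotate[OF r2] by simp
  have r4: "cyc [e, a, b, c, d]" using cyc_rotate[OF r3] by simp
  show "(a, c) \<notin> D" "(b, d) \<notin> D" "(c, e) \<notin> D" "(d, a) \<notin> D" "(e, b) \<notin> D"
    "(c, a) \<notin> D" "(d, b) \<notin> D" "(e, c) \<notin> D" "(a, d) \<notin> D" "(b, e) \<notin> D"
    using cyc5_chord[OF assms] cyc5_chord[OF r] cyc5_chord[OF r2] cyc5_chord[OF r3] cyc5_chord[OF r4] by auto
qed

definition apex :: "'a \<Rightarrow> 'a \<Rightarrow> 'a \<Rightarrow> bool" where
  "apex x a b \<longleftrightarrow> (a, x) \<in> D \<and> (x, a) \<in> D \<and> (x, b) \<in> D \<and> (b, x) \<in> D \<and> x \<noteq> a \<and> x \<noteq> b"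

lemma apexI: "(a, x) \<in> D \<Longrightarrow> (x, b) \<in> D \<Longrightarrow> apex x a b"
  unfolding apex_def using D_sym edge_neq by blast

lemma apex_no4:
  assumes "(a, b) \<in> D" "(b, c) \<in> D" "a \<noteq> c" "(a, x) \<in> D" "(x, c) \<in> D"
  shows "x = b"
  using no4[of a b c x] assms D_sym by blast

lemma cyc5_apex:
  assumes "cyc [a, b, c, d, e]" "apex x a b"
  shows "x \<notin> {a, b, c, d, e}"
  using cyc5_chords[OF assms(1)] assms(2) unfolding apex_def by auto

text \<open>Replacing three sides of a pentagon by detours through triangles gives an 8-cycle. Up to
  rotation three sides are consecutive, or two adjacent ones and the side opposite to their common
  vertex.\<close>

lemma cyc5_three_apex:
  assumes p: "cyc [a, b, c, d, e]" and x: "apex x a b" and y: "apex y b c"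
  shows "apex z c d \<Longrightarrow> False" "apex z d e \<Longrightarrow> False"
proof -
  have r: "cyc [b, c, d, e, a]" using cyc_rotate[OF p] by simp
  have r2: "cyc [c, d, e, a, b]" using cyc_rotate[OF r] by simp
  have r3: "cyc [d, e, a, b, c]" using cyc_rotate[OF r2] by simp
  note n = cyc5_apex[OF p x] cyc5_apex[OF r y]
  note p' = p[unfolded cyc5] and x' = x[unfolded apex_def] and y' = y[unfolded apex_def]
  have xy: "x \<noteq> y" using apex_no4[of a b c x] p' x' y' by auto
  {
    assume z: "apex z c d"
    note z' = z[unfolded apex_def] and nz = cyc5_apex[OF r2 z]
    have "x \<noteq> z" using apex_no4[of a b c x] p' x' z' by auto
    moreover have "y \<noteq> z" using apex_no4[of b c d y] p' y' z' by auto
    ultimately show False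
      using no_cyc8[of a x b y c z d e] n nz xy p' x' y' z' unfolding cyc8 by auto
  }
  {
    assume z: "apex z d e"
    note z' = z[unfolded apex_def] and nz = cyc5_apex[OF r3 z]
    have "x \<noteq> z" using apex_no4[of b c d x] apex_no4[of d e a z] p' x' z' D_sym by auto
    moreover have "y \<noteq> z" using apex_no4[of b c d y] p' y' z' by auto
    ultimately show False
      using no_cyc8[of a x b y c d z e] n nz xy p' x' y' z' unfolding cyc8 by auto
  }
qed

lemma cyc6_apex:
  assumes p: "cyc [a, b, c, d, e, f]" and x: "apex x a b" and n: "x \<noteq> c" "x \<noteq> f"
  shows "x \<notin> {a, b, c, d, e, f}"
  using no4'[of a b c d] no4'[of b c d e] p x n unfolding cyc6 apex_def by auto

text \<open>Two detours make an 8-cycle out of a hexagon; two sides are at distance 1, 2 or 3. A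
  hexagon, unlike a pentagon, may have a chord cutting off a triangle, so the apexes are required to
  lie off the cycle.\<close>

lemma cyc6_two_apex:
  assumes p: "cyc [a, b, c, d, e, f]" and x: "apex x a b" "x \<notin> {a, b, c, d, e, f}"
    and y: "y \<notin> {a, b, c, d, e, f}"
  shows "apex y b c \<Longrightarrow> False" "apex y c d \<Longrightarrow> False" "apex y d e \<Longrightarrow> False"
proof -
  note p' = p[unfolded cyc6] and x' = x(1)[unfolded apex_def]
  {
    assume "apex y b c"
    note y' = this[unfolded apex_def]
    have "x \<noteq> y" using apex_no4[of a b c x] p' x' y' by auto
    then show False using no_cyc8[of a x b y c d e f] p' x x' y y' unfolding cyc8 by auto
  }
  {
    assume "apex y c d"
    note y' = this[unfolded apex_def]
    have "x \<noteq> y" using apex_no4[of a b c x] p' x' y' by auto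
    then show False using no_cyc8[of a x b c y d e f] p' x x' y y' unfolding cyc8 by auto
  }
  {
    assume "apex y d e"
    note y' = this[unfolded apex_def]
    have "x \<noteq> y" using apex_no4[of b c d x] p' x x' y' by auto
    then show False using no_cyc8[of a x b c d y e f] p' x x' y y' unfolding cyc8 by auto
  }
qed

lemma cyc7_apex:
  assumes p: "cyc [a, b, c, d, e, f, g]" and x: "apex x a b" and n: "x \<noteq> c" "x \<noteq> g"
  shows False
proof -
  note p' = p[unfolded cyc7] and x' = x[unfolded apex_def]
  have "x \<noteq> d" using no4'[of a b c d] p' x' by auto
  moreover have "x \<noteq> e" using no4'[of e f g a] p' x' by auto
  moreover have "x \<noteq> f" using no4'[of f g a b] p' x' by auto
  ultimately show False
    using no_cyc8[of a x b c d e f g] p' x' n unfolding cyc8 by auto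
qed

text \<open>The outer boundary has length 5 + 5 - 2 = 8, unless the pentagons also share an edge
  next to the common one.\<close>

lemma cyc5_cyc5:
  assumes p: "cyc [a, b, c, d, e]" and q: "cyc [b, a, p, q, r]" and n: "p \<noteq> e" "r \<noteq> c"
  shows False
proof -
  note p' = p[unfolded cyc5] and q' = q[unfolded cyc5]
  have "q \<noteq> d" using no4[of a e d p] p' q' n D_sym by auto
  then have "distinct [b, c, d, e, a, p, q, r]"
    using p' q' n cyc5_chords[OF p] cyc5_chords[OF q] by auto
  then show False
    using no_cyc8[of b c d e a p q r] p' q' unfolding cyc8 by auto
qed

text \<open>
  Around a vertex \<open>v\<close> with neighbours \<open>x, y, z\<close> lie a triangle, a pentagon and a hexagon. Their outer
  boundary is an 8-cycle, unless the pentagon passes through the vertex \<open>s\<close> opposite to \<open>v\<close>.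
\<close>

lemma cyc5_cyc6_triangle:
  assumes p: "cyc [v, z, p, q, x]" and h: "cyc [v, z, r, s, t, y]" and xy: "(x, y) \<in> D"
    and n: "p \<noteq> r" "t \<noteq> x"
  shows "deg s \<ge> 4"
proof -
  note p' = p[unfolded cyc5] and h' = h[unfolded cyc6]
  note ch = cyc5_chords[OF p]
  have s: "(y, x) \<in> D" "(v, x) \<in> D" "(y, v) \<in> D" "(x, q) \<in> D" "(x, v) \<in> D" "(y, t) \<in> D" "(t, s) \<in> D" "(s, r) \<in> D" "(r, z) \<in> D" "(z, v) \<in> D" "(q, p) \<in> D"
    "(p, z) \<in> D"
    using p' h' xy D_sym by auto
  have "x \<noteq> y" using edge_neq[OF xy] .
  have x1: "x \<noteq> z" "x \<noteq> r" "x \<noteq> s"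
    using p' ch h' s no4[of v y t x] \<open>x \<noteq> y\<close> D_sym n(2) by auto
  have y1: "y \<noteq> p" "y \<noteq> q"
    using ch s apex_no4[of v z p y] p' h' by auto
  have pt: "p \<noteq> t" "q \<noteq> t" "q \<noteq> s" "q \<noteq> r"
  proof -
    show "p \<noteq> t" using no4[of x y p q] p' h' s xy y1 x1 by auto
    show "q \<noteq> t" using no4[of v x q y] p' h' s y1 \<open>x \<noteq> y\<close> by auto
    show "q \<noteq> s" using no4[of x q t y] p' h' s xy n y1 x1 \<open>q \<noteq> t\<close> by auto
    show "q \<noteq> r" using ch h' by auto
  qed
  show ?thesis
  proof (cases "p = s")
    case True
    have "distinct [z, q, r, t]" using p' h' pt by auto
    moreover have "set [z, q, r, t] \<subseteq> D `` {s}" using True p' h' s by auto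
    ultimately show ?thesis using card_ge_list[of "[z, q, r, t]" "D `` {s}"] by (simp add: deg_def)
  next
    case False
    have "distinct [x, y, t, s, r, z, p, q]"
      using p' h' x1 y1 pt n False \<open>x \<noteq> y\<close> by auto
    then show ?thesis
      using no_cyc8[of x y t s r z p q] p' h' s xy unfolding cyc8 by auto
  qed
qed

end

section \<open>Discharging\<close>

context plane_block
begin

definition tr :: "'a \<times> 'a \<Rightarrow> bool" where
  "tr d \<longleftrightarrow> (\<exists>T\<in>F. card T = 3 \<and> (snd d, fst d) \<in> T)"
text \<open>The kinds of degree 3 vertices differ in who covers their deficit 12: in class A the
  triangle passes on 6 received from a big vertex, in class B the triangle has degrees 3, 4, 4 and
  can pass on nothing, and in class N all three faces are longer than triangles.\<close>

definition clsA :: "'a \<Rightarrow> bool" where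
  "clsA v \<longleftrightarrow> three v \<and> (\<exists>S\<in>TF v. \<exists>q\<in>dart_verts S. big q)"
definition clsB :: "'a \<Rightarrow> bool" where
  "clsB v \<longleftrightarrow> three v \<and> TF v \<noteq> {} \<and> \<not> clsA v"
definition clsN :: "'a \<Rightarrow> bool" where
  "clsN v \<longleftrightarrow> three v \<and> TF v = {}"
definition has5 :: "'a \<Rightarrow> bool" where
  "has5 v \<longleftrightarrow> (\<exists>S\<in>F. card S = 5 \<and> v \<in> dart_verts S)"
definition n3 :: "('a \<times> 'a) set \<Rightarrow> nat" where
  "n3 S = card {v \<in> dart_verts S. three v}"
definition engaged :: "'a \<Rightarrow> bool" where
  "engaged q \<longleftrightarrow> (\<exists>S\<in>TF q. n3 S = 2)"

text \<open>
  All charges are multiplied by 12. The function \<open>gv\<close> is what a big vertex sends to an incident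
  triangle, \<open>give\<close> what a face sends to an incident vertex of degree 3, and \<open>toll\<close> what a face sends
  to a triangle across a dart.
\<close>

definition gv :: "'a \<Rightarrow> ('a \<times> 'a) set \<Rightarrow> int" where
  "gv q S = (if n3 S = 2 then 12 else if q \<noteq> X \<and> deg q = 5 \<and> engaged q then 0 else 6)"
text \<open>A triangle lacks 12; when a big vertex pays 6 and no vertex of degree 3 claims anything,
  a toll of 2 per side suffices instead of 4. Long faces rely on this saving, see
  \<open>gap_saving\<close>.\<close>

definition generous :: "('a \<times> 'a) set \<Rightarrow> bool" where
  "generous S \<longleftrightarrow> n3 S = 0 \<and> (\<exists>q\<in>dart_verts S. big q \<and> gv q S = 6)"
definition give :: "('a \<times> 'a) set \<Rightarrow> 'a \<Rightarrow> int" where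
  "give S v = (if card S = 3 \<or> \<not> three v then 0
     else if card S = 5 then (if clsA v then 0 else 2)
     else if clsN v then (if has5 v then 5 else 4)
     else if clsA v then (if has5 v then 6 else 3)
     else (if has5 v then 10 else 6))"
definition toll :: "'a \<times> 'a \<Rightarrow> int" where
  "toll d = (if \<exists>T\<in>F. card T = 3 \<and> (snd d, fst d) \<in> T \<and> generous T then 2 else if tr d then 4 else 0)"

definition chv :: "'a \<Rightarrow> int" where
  "chv v = 12 * (int (degB v) - 4) + (\<Sum>S | S \<in> F \<and> v \<in> dart_verts S. give S v) + (if clsA v then 6 else 0)
     - (if big v then (\<Sum>S\<in>TF v. gv v S) else 0)"
definition load :: "('a \<times> 'a) set \<Rightarrow> int" where
  "load S = (\<Sum>d\<in>S. give S (fst d)) + (\<Sum>d\<in>S. toll d)"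
definition gain :: "('a \<times> 'a) set \<Rightarrow> int" where
  "gain S = (if card S = 3 then (\<Sum>d\<in>S. toll (snd d, fst d)) + (\<Sum>q | q \<in> dart_verts S \<and> big q. gv q S)
     - 6 * int (card {v \<in> dart_verts S. clsA v}) else 0)"
definition chf :: "('a \<times> 'a) set \<Rightarrow> int" where
  "chf S = 12 * (int (card S) - 4) - load S + gain S"

lemma give_nonneg: "give S v \<ge> 0" and toll_nonneg: "toll d \<ge> 0" and toll_le: "toll d \<le> 4"
  by (auto simp: give_def toll_def)

lemma toll_not_tr: "\<not> tr d \<Longrightarrow> toll d = 0"
  by (auto simp: toll_def tr_def)

lemma finite_dart_verts: "S \<in> F \<Longrightarrow> finite (dart_verts S)"
  using face_finite by (simp add: dart_verts_def)

lemma face_sum_fst: "S \<in> F \<Longrightarrow> (\<Sum>d\<in>S. g (fst d)) = (\<Sum>v\<in>dart_verts S. g v)"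
proof -
  assume S: "S \<in> F"
  have "fst ` S = dart_verts S"
    using face_vert[OF S] by (force simp: dart_verts_def)
  moreover have "inj_on fst S"
    using face_fst[OF S] by (auto simp: inj_on_def)
  ultimately show ?thesis by (metis sum.reindex_cong)
qed

text \<open>Each transfer occurs with opposite signs at its two ends, and Euler's formula gives 12 *
  (-8) for the initial charges. Only an inequality is claimed: a class A vertex is credited 6 once,
  while every triangle through it is debited.\<close>

lemma total_charge: "(\<Sum>v\<in>B. chv v) + (\<Sum>S\<in>F. chf S) \<le> - 96"
proof -
  have E1: "(\<Sum>v\<in>B. degB v) = card E"
  proof -
    have "E = Sigma B (\<lambda>v. E `` {v})" by auto
    then have "card E = (\<Sum>v\<in>B. card (E `` {v}))"
      using card_SigmaI[OF finite_B, of "\<lambda>v. E `` {v}"] finite_E by (simp add: finite_Image)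
    then show ?thesis by (simp add: degB_def)
  qed
  have E2: "(\<Sum>S\<in>F. card S) = card E"
  proof -
    have "card (\<Union>F) = (\<Sum>S\<in>F. card S)"
      using F_disj face_finite by (intro card_Union_disjoint) (auto simp: pairwise_def disjnt_def)
    then show ?thesis using F_union by simp
  qed
  have "(\<Sum>v\<in>B. 12 * (int (degB v) - 4)) + (\<Sum>S\<in>F. 12 * (int (card S) - 4)) =
      12 * (int (\<Sum>v\<in>B. degB v) - 4 * int (card B)) + 12 * (int (\<Sum>S\<in>F. card S) - 4 * int (card F))"
    by (simp add: sum_subtractf sum_distrib_left[symmetric])
  also have "\<dots> = - 96" unfolding E1 E2 using arg_cong[OF euler, of int] by simp
  finally have base: "(\<Sum>v\<in>B. 12 * (int (degB v) - 4)) + (\<Sum>S\<in>F. 12 * (int (card S) - 4)) = - 96" .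
  have G: "(\<Sum>v\<in>B. \<Sum>S | S \<in> F \<and> v \<in> dart_verts S. give S v) = (\<Sum>S\<in>F. \<Sum>d\<in>S. give S (fst d))"
  proof -
    have "(\<Sum>v\<in>B. \<Sum>S | S \<in> F \<and> v \<in> dart_verts S. give S v) = (\<Sum>S\<in>F. \<Sum>v | v \<in> B \<and> v \<in> dart_verts S. give S v)"
      by (rule sum.swap_restrict[OF finite_B finite_F])
    also have "\<dots> = (\<Sum>S\<in>F. \<Sum>d\<in>S. give S (fst d))"
    proof (rule sum.cong[OF refl])
      fix S assume S: "S \<in> F"
      have "{v. v \<in> B \<and> v \<in> dart_verts S} = dart_verts S" using face_verts_B[OF S] by auto
      then show "(\<Sum>v | v \<in> B \<and> v \<in> dart_verts S. give S v) = (\<Sum>d\<in>S. give S (fst d))"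
        using face_sum_fst[OF S, of "give S"] by simp
    qed
    finally show ?thesis .
  qed
  let ?T = "{S \<in> F. card S = 3}"
  have finT: "finite ?T" using finite_F by simp
  have K: "(\<Sum>S\<in>F. \<Sum>d\<in>S. toll d) = (\<Sum>S\<in>?T. \<Sum>d\<in>S. toll (snd d, fst d))"
  proof -
    have "(\<Sum>S\<in>F. \<Sum>d\<in>S. toll d) = (\<Sum>d\<in>E. toll d)"
      unfolding F_union[symmetric] using F_disj face_finite by (intro sum.Union_disjoint[symmetric, simplified]) auto
    also have "\<dots> = (\<Sum>d\<in>{d \<in> E. tr d}. toll d)"
      using finite_E toll_not_tr by (intro sum.mono_neutral_right) auto
    also have "{d \<in> E. tr d} = (\<lambda>d. (snd d, fst d)) ` \<Union>?T"
    proof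
      show "{d \<in> E. tr d} \<subseteq> (\<lambda>d. (snd d, fst d)) ` \<Union>?T" by (force simp: tr_def)
      show "(\<lambda>d. (snd d, fst d)) ` \<Union>?T \<subseteq> {d \<in> E. tr d}"
        using face_sub D_sym by (auto simp: tr_def) blast+
    qed
    also have "(\<Sum>d\<in>(\<lambda>d. (snd d, fst d)) ` \<Union>?T. toll d) = (\<Sum>d\<in>\<Union>?T. toll (snd d, fst d))"
      by (subst sum.reindex) (auto simp: inj_on_def)
    also have "\<dots> = (\<Sum>S\<in>?T. \<Sum>d\<in>S. toll (snd d, fst d))"
      using F_disj face_finite by (intro sum.Union_disjoint[simplified]) auto
    finally show ?thesis .
  qed
  have V: "(\<Sum>v\<in>B. if big v then (\<Sum>S\<in>TF v. gv v S) else 0) = (\<Sum>S\<in>?T. \<Sum>q | q \<in> dart_verts S \<and> big q. gv q S)"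
  proof -
    have "(\<Sum>v\<in>B. if big v then (\<Sum>S\<in>TF v. gv v S) else 0) = (\<Sum>v\<in>B. \<Sum>S | S \<in> ?T \<and> (v \<in> dart_verts S \<and> big v). gv v S)"
      by (intro sum.cong refl) (auto simp: TF_def intro!: sum.cong)
    also have "\<dots> = (\<Sum>S\<in>?T. \<Sum>v | v \<in> B \<and> (v \<in> dart_verts S \<and> big v). gv v S)"
      by (rule sum.swap_restrict[OF finite_B finT])
    also have "\<dots> = (\<Sum>S\<in>?T. \<Sum>q | q \<in> dart_verts S \<and> big q. gv q S)"
      using face_verts_B by (intro sum.cong refl) auto
    finally show ?thesis .
  qed
  have A: "(\<Sum>v\<in>B. if clsA v then 6 else 0) \<le> (\<Sum>S\<in>?T. 6 * int (card {v \<in> dart_verts S. clsA v}))"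
  proof -
    have "(\<Sum>v\<in>B. if clsA v then 6 else 0) = (\<Sum>v\<in>{v \<in> B. clsA v}. (6::int))"
      using finite_B by (simp add: sum.If_cases Collect_conj_eq)
    also have "\<dots> = 6 * int (card {v \<in> B. clsA v})" by simp
    also have "card {v \<in> B. clsA v} \<le> card (\<Union>S\<in>?T. {v \<in> dart_verts S. clsA v})"
      using finT finite_dart_verts by (intro card_mono) (auto simp: clsA_def TF_def)
    also have "\<dots> \<le> (\<Sum>S\<in>?T. card {v \<in> dart_verts S. clsA v})"
      by (rule card_UN_le[OF finT])
    finally show ?thesis by (simp add: sum_distrib_left[symmetric])
  qed
  have gainS: "(\<Sum>S\<in>F. gain S) = (\<Sum>S\<in>?T. (\<Sum>d\<in>S. toll (snd d, fst d))) + (\<Sum>S\<in>?T. \<Sum>q | q \<in> dart_verts S \<and> big q. gv q S)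
     - (\<Sum>S\<in>?T. 6 * int (card {v \<in> dart_verts S. clsA v}))"
  proof -
    have "(\<Sum>S\<in>F. gain S) = (\<Sum>S\<in>?T. gain S)"
      using finite_F by (intro sum.mono_neutral_right) (auto simp: gain_def)
    also have "\<dots> = (\<Sum>S\<in>?T. (\<Sum>d\<in>S. toll (snd d, fst d)) + (\<Sum>q | q \<in> dart_verts S \<and> big q. gv q S)
     - 6 * int (card {v \<in> dart_verts S. clsA v}))"
      by (intro sum.cong refl) (simp add: gain_def)
    finally show ?thesis by (simp add: sum.distrib sum_subtractf)
  qed
  have "(\<Sum>v\<in>B. chv v) = (\<Sum>v\<in>B. 12 * (int (degB v) - 4)) + (\<Sum>v\<in>B. \<Sum>S | S \<in> F \<and> v \<in> dart_verts S. give S v)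
      + (\<Sum>v\<in>B. if clsA v then 6 else 0) - (\<Sum>v\<in>B. if big v then (\<Sum>S\<in>TF v. gv v S) else 0)"
    unfolding chv_def by (simp only: sum.distrib sum_subtractf)
  moreover have "(\<Sum>S\<in>F. chf S) = (\<Sum>S\<in>F. 12 * (int (card S) - 4)) - (\<Sum>S\<in>F. \<Sum>d\<in>S. give S (fst d))
     - (\<Sum>S\<in>F. \<Sum>d\<in>S. toll d) + (\<Sum>S\<in>F. gain S)"
    unfolding chf_def load_def by (simp add: sum.distrib sum_subtractf)
  ultimately show ?thesis
    using base G K V A gainS by linarith
qed

section \<open>Final charges of the vertices\<close>

lemma chv_four: "four v \<Longrightarrow> chv v = 0"
proof -
  assume v: "four v"
  then have "\<not> three v" "\<not> big v" "\<not> clsA v" by (auto simp: four_def three_def big_def clsA_def)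
  moreover have "degB v = 4" using v degB_eq by (auto simp: four_def)
  ultimately show ?thesis by (simp add: chv_def give_def)
qed

lemma chv_X: "chv X \<ge> 12 * (int (degB X) - 4) - 12 * int (card (TF X))"
proof -
  have "\<not> three X" "\<not> clsA X" by (auto simp: three_def clsA_def)
  moreover have "(\<Sum>S\<in>TF X. gv X S) \<le> (\<Sum>S\<in>TF X. 12)"
    by (rule sum_mono) (simp add: gv_def)
  ultimately show ?thesis by (simp add: chv_def give_def)
qed

lemma tri_face_verts:
  assumes "S \<in> TF z"
  obtains a b where "distinct [z, a, b]" "S = {(z, a), (a, b), (b, z)}" "dart_verts S = {z, a, b}"
    "(z, a) \<in> D" "(a, b) \<in> D" "(b, z) \<in> D" "(a, z) \<in> D" "(b, a) \<in> D" "(z, b) \<in> D" "a \<in> B" "b \<in> B" "z \<in> B"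
proof -
  have S: "S \<in> F" "card S = 3" "z \<in> dart_verts S" using assms by (auto simp: TF_def)
  obtain a where "(z, a) \<in> S" using face_vert[OF S(1,3)] by blast
  then obtain b where b: "distinct [z, a, b]" "S = {(z, a), (a, b), (b, z)}"
    using face3[OF S(1,2)] by metis
  moreover have "dart_verts S = {z, a, b}" using b by auto
  moreover have m: "(z, a) \<in> S" "(a, b) \<in> S" "(b, z) \<in> S" using b by auto
  ultimately show ?thesis
    using that[of a b] faceD(1)[OF S(1) m(1)] faceD(1)[OF S(1) m(2)] faceD(1)[OF S(1) m(3)]
      face_D_rev[OF S(1) m(1)] face_D_rev[OF S(1) m(2)] face_D_rev[OF S(1) m(3)]
      faceD(2)[OF S(1) m(1)] faceD(2)[OF S(1) m(2)] faceD(2)[OF S(1) m(3)] by metis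
qed

lemma n3_2:
  assumes S: "S \<in> TF z" "n3 S = 2" and z: "\<not> three z"
  obtains a b where "tri33 z a b" "dart_verts S = {z, a, b}" "three a" "three b"
proof -
  obtain a b where ab: "distinct [z, a, b]" "dart_verts S = {z, a, b}"
    "(z, a) \<in> D" "(a, b) \<in> D" "(b, z) \<in> D"
    using tri_face_verts[OF S(1)] by metis
  have "{v \<in> dart_verts S. three v} = {v \<in> {a, b}. three v}" using ab z by auto
  then have "card {v \<in> {a, b}. three v} = 2" using S(2) by (simp add: n3_def)
  moreover have "card {a, b} = 2" using ab by auto
  ultimately have "{v \<in> {a, b}. three v} = {a, b}"
    by (metis (no_types, lifting) card_subset_eq finite.emptyI finite_insert mem_Collect_eq subsetI)
  then have "three a" "three b" by auto
  then show ?thesis using that[of a b] ab by (auto simp: tri33_def three_def)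
qed

lemma TF_disjoint_verts:
  assumes S: "S \<in> TF z" and T: "T \<in> TF z" and ne: "S \<noteq> T"
  shows "dart_verts S \<inter> dart_verts T = {z}"
proof -
  have mem: "S \<in> F" "card S = 3" "T \<in> F" "card T = 3" using S T by (auto simp: TF_def)
  obtain a b where ab: "distinct [z, a, b]" "S = {(z, a), (a, b), (b, z)}" "dart_verts S = {z, a, b}"
    using tri_face_verts[OF S] by metis
  obtain c d where cd: "distinct [z, c, d]" "T = {(z, c), (c, d), (d, z)}" "dart_verts T = {z, c, d}"
    using tri_face_verts[OF T] by metis
  have "a \<noteq> c" "b \<noteq> d" using F_disj[OF mem(1,3) ne] ab cd by auto
  moreover have "a \<noteq> d" using tri_tri[of S z a T] mem ab cd by auto
  moreover have "b \<noteq> c" using tri_tri[of S b z T] mem ab cd by auto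
  ultimately show ?thesis using ab cd by auto
qed

lemma n3_2_unique:
  assumes "z \<in> B" "z \<noteq> X" "\<not> three z" "deg z \<le> 6" "S \<in> TF z" "n3 S = 2" "T \<in> TF z" "n3 T = 2"
  shows "S = T"
proof (rule ccontr)
  assume ne: "S \<noteq> T"
  obtain a b where ab: "tri33 z a b" "dart_verts S = {z, a, b}" using n3_2[OF assms(5,6,3)] .
  obtain c d where cd: "tri33 z c d" "dart_verts T = {z, c, d}" using n3_2[OF assms(7,8,3)] .
  have "{a, b} \<inter> {c, d} = {}"
    using TF_disjoint_verts[OF assms(5,7) ne] ab cd tri33_facts[OF ab(1)] by auto
  then show False using two_tri33[OF ab(1) cd(1)] assms(4) by blast
qed

text \<open>Degree 5 has charge 12 and degree 6 has charge 24; in both cases at most one triangle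
  takes 12, and the others take 6 or, from an engaged vertex of degree 5, nothing. From degree 7 on,
  12 for every triangle is affordable since at most half of the degree many occur.\<close>

lemma chv_big:
  assumes v: "big v" "v \<noteq> X"
  shows "chv v \<ge> 0"
proof -
  have vB: "v \<in> B" "\<not> three v" "\<not> four v" using v by (auto simp: big_def)
  have dv: "degB v = deg v" using degB_eq vB v by auto
  have d5: "deg v \<ge> 5" using deg_ge3[of v] vB v B_sub by (auto simp: three_def four_def)
  have cnt: "2 * card (TF v) \<le> deg v" using TF_count[of v] dv by simp
  have ch: "chv v = 12 * (int (deg v) - 4) - (\<Sum>S\<in>TF v. gv v S)"
    using v vB dv by (simp add: chv_def give_def clsA_def)
  consider "deg v = 5" | "deg v = 6" | "deg v \<ge> 7" using d5 by linarith
  then show ?thesis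
  proof cases
    case 1
    show ?thesis
    proof (cases "engaged v")
      case True
      then obtain S where S: "S \<in> TF v" "n3 S = 2" by (auto simp: engaged_def)
      have "(\<Sum>T\<in>TF v. gv v T) = (\<Sum>T\<in>{S}. gv v T)"
      proof (rule sum.mono_neutral_right)
        show "\<forall>T\<in>TF v - {S}. gv v T = 0"
          using n3_2_unique[OF vB(1) v(2) vB(2) _ S] 1 True v by (auto simp: gv_def)
      qed (use S in auto)
      then show ?thesis using ch 1 S by (simp add: gv_def)
    next
      case False
      then have "(\<Sum>T\<in>TF v. gv v T) \<le> (\<Sum>T\<in>TF v. 6)"
        by (intro sum_mono) (auto simp: gv_def engaged_def)
      moreover have "int (card (TF v)) \<le> 2" using cnt 1 by linarith
      ultimately show ?thesis using ch 1 by simp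
    qed
  next
    case 2
    have "(\<Sum>T\<in>TF v. gv v T) \<le> 24"
    proof (cases "\<exists>S\<in>TF v. n3 S = 2")
      case True
      then obtain S where S: "S \<in> TF v" "n3 S = 2" by auto
      have "(\<Sum>T\<in>TF v. gv v T) = gv v S + (\<Sum>T\<in>TF v - {S}. gv v T)"
        using S by (simp add: sum.remove)
      also have "(\<Sum>T\<in>TF v - {S}. gv v T) \<le> (\<Sum>T\<in>TF v - {S}. 6)"
        using n3_2_unique[OF vB(1) v(2) vB(2) _ S] 2 by (intro sum_mono) (auto simp: gv_def)
      also have "(\<Sum>T\<in>TF v - {S}. 6::int) \<le> 12"
      proof -
        have "card (TF v - {S}) \<le> 2" using S cnt 2 by simp
        then show ?thesis by simp
      qed
      finally show ?thesis using S by (simp add: gv_def)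
    next
      case False
      then have "(\<Sum>T\<in>TF v. gv v T) \<le> (\<Sum>T\<in>TF v. 6)"
        by (intro sum_mono) (auto simp: gv_def)
      moreover have "int (card (TF v)) \<le> 3" using cnt 2 by linarith
      ultimately show ?thesis by simp
    qed
    then show ?thesis using ch 2 by simp
  next
    case 3
    have "(\<Sum>T\<in>TF v. gv v T) \<le> (\<Sum>T\<in>TF v. 12)"
      by (intro sum_mono) (auto simp: gv_def)
    moreover have "int (card (TF v)) \<le> int (deg v) - 4" using cnt 3 by linarith
    ultimately show ?thesis using ch by simp
  qed
qed

text \<open>The amounts in \<open>give\<close> are made so that the deficit 12 is covered with or
  without one pentagon: class N gets 4 + 4 + 4 or 2 + 5 + 5, class A gets 6 from its triangle and 3
  + 3 or 0 + 6, class B gets 6 + 6 or 2 + 10. Only a second pentagon breaks this.\<close>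

lemma chv_three:
  assumes v: "three v"
  shows "chv v \<ge> - 12"
    and "\<lbrakk>\<And>S T. S \<in> F \<Longrightarrow> T \<in> F \<Longrightarrow> S \<noteq> T \<Longrightarrow> card S = 5 \<Longrightarrow> card T = 5 \<Longrightarrow>
       v \<in> dart_verts S \<Longrightarrow> v \<in> dart_verts T \<Longrightarrow> False\<rbrakk> \<Longrightarrow> chv v \<ge> 0"
proof -
  obtain a b c S1 S2 S3 where abc: "distinct [a, b, c]" "D `` {v} = {a, b, c}"
    and S: "S1 \<in> F" "S2 \<in> F" "S3 \<in> F" "distinct [S1, S2, S3]"
    and d: "(a, v) \<in> S1" "(v, b) \<in> S1" "(b, v) \<in> S2" "(v, c) \<in> S2" "(c, v) \<in> S3" "(v, a) \<in> S3"
    using three_faces[OF v] .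
  have vS: "v \<in> dart_verts S1" "v \<in> dart_verts S2" "v \<in> dart_verts S3" using d dart_vertsI by metis+
  have faces: "{S. S \<in> F \<and> v \<in> dart_verts S} = {S1, S2, S3}"
  proof
    show "{S. S \<in> F \<and> v \<in> dart_verts S} \<subseteq> {S1, S2, S3}"
    proof
      fix S assume "S \<in> {S. S \<in> F \<and> v \<in> dart_verts S}"
      then obtain w where w: "S \<in> F" "(v, w) \<in> S" using face_vert by blast
      then have "w \<in> {a, b, c}" using faceD(1) abc(2) by auto
      then show "S \<in> {S1, S2, S3}" using w d S face_unique by blast
    qed
  qed (use S vS in auto)
  have "\<not> big v" using v by (auto simp: big_def)
  moreover have "degB v = 3" using v degB_eq by (auto simp: three_def)
  ultimately have ch: "chv v = - 12 + (give S1 v + give S2 v + give S3 v) + (if clsA v then 6 else 0)"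
    using S(4) by (simp add: chv_def faces)
  then show "chv v \<ge> - 12" using give_nonneg[of S1 v] give_nonneg[of S2 v] give_nonneg[of S3 v] by auto
  assume no5: "\<And>S T. S \<in> F \<Longrightarrow> T \<in> F \<Longrightarrow> S \<noteq> T \<Longrightarrow> card S = 5 \<Longrightarrow> card T = 5 \<Longrightarrow>
       v \<in> dart_verts S \<Longrightarrow> v \<in> dart_verts T \<Longrightarrow> False"
  have n5: "\<not> (card S1 = 5 \<and> card S2 = 5)" "\<not> (card S1 = 5 \<and> card S3 = 5)" "\<not> (card S2 = 5 \<and> card S3 = 5)"
    using no5[of S1 S2] no5[of S1 S3] no5[of S2 S3] S vS by auto
  have t3: "\<not> (card S1 = 3 \<and> card S2 = 3)" "\<not> (card S1 = 3 \<and> card S3 = 3)" "\<not> (card S2 = 3 \<and> card S3 = 3)"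
    using tri_tri[of S1 v b S2] tri_tri[of S3 v a S1] tri_tri[of S2 v c S3] S d by auto
  have h5: "has5 v \<longleftrightarrow> card S1 = 5 \<or> card S2 = 5 \<or> card S3 = 5"
    using faces S vS unfolding has5_def by (metis (mono_tags, lifting) insertE mem_Collect_eq singletonD)
  have "TF v = {S \<in> {S1, S2, S3}. card S = 3}"
    unfolding TF_def using faces by auto
  then have tf: "TF v \<noteq> {} \<longleftrightarrow> card S1 = 3 \<or> card S2 = 3 \<or> card S3 = 3" by auto
  have cls: "clsN v \<longleftrightarrow> TF v = {}" "clsA v \<Longrightarrow> TF v \<noteq> {}" using v by (auto simp: clsN_def clsA_def)
  show "chv v \<ge> 0"
  proof (cases "TF v = {}")
    case True
    then have "\<not> clsA v" "clsN v" "card S1 \<noteq> 3" "card S2 \<noteq> 3" "card S3 \<noteq> 3" using cls tf by auto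
    then show ?thesis
      using v n5 by (auto simp: ch give_def h5)
  next
    case False
    then have N: "\<not> clsN v" using cls by auto
    consider "card S1 = 3" "card S2 \<noteq> 3" "card S3 \<noteq> 3" | "card S2 = 3" "card S1 \<noteq> 3" "card S3 \<noteq> 3" |
       "card S3 = 3" "card S1 \<noteq> 3" "card S2 \<noteq> 3" using tf False t3 by blast
    then show ?thesis
      by cases (use v n5 N in \<open>auto simp: ch give_def h5\<close>)
  qed
qed

end

section \<open>Final charges of the triangles\<close>

context plane_block
begin

lemma TF_three_unique: "three v \<Longrightarrow> S \<in> TF v \<Longrightarrow> T \<in> TF v \<Longrightarrow> S = T"
proof (rule ccontr)
  assume v: "three v" and ST: "S \<in> TF v" "T \<in> TF v" and ne: "S \<noteq> T"
  have "card {S, T} \<le> card (TF v)" using ST by (intro card_mono) auto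
  then show False using TF_count[of v] v degB_eq[of v] ne by (auto simp: three_def)
qed

text \<open>If no big vertex of the triangle pays 6, each of them has degree 5 and serves another
  triangle with two vertices of degree 3; according to the degree of \<open>y\<close> this is one of
  two reducible configurations.\<close>

lemma tri_one_three:
  assumes v: "three v" and S: "S \<in> TF v" and dv: "dart_verts S = {v, x, y}"
    and xy: "distinct [v, x, y]" "(v, x) \<in> D" "(x, y) \<in> D" "(y, v) \<in> D"
    and B: "x \<in> B" "y \<in> B"
    and n: "\<not> three x" "\<not> three y" and bg: "big x"
  shows "(big x \<and> gv x S = 6) \<or> (big y \<and> gv y S = 6)"
proof (rule ccontr)
  assume neg: "\<not> ?thesis"
  have SF: "S \<in> F" "card S = 3" using S by (auto simp: TF_def)
  have "{u \<in> dart_verts S. three u} = {v}" using dv v n by auto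
  then have n3: "n3 S = 1" by (simp add: n3_def)
  have eng: "u \<noteq> X \<and> deg u = 5 \<and> (\<exists>a b. tri33 u a b \<and> v \<notin> {a, b})"
    if u: "u \<in> {x, y}" "big u" for u
  proof -
    have "gv u S \<noteq> 6" using neg u by auto
    then have e: "u \<noteq> X" "deg u = 5" "engaged u" using n3 by (auto simp: gv_def split: if_splits)
    then obtain T where T: "T \<in> TF u" "n3 T = 2" by (auto simp: engaged_def)
    have Su: "S \<in> TF u" using SF u dv by (auto simp: TF_def)
    have nu: "\<not> three u" using u n by auto
    obtain a b where ab: "tri33 u a b" "dart_verts T = {u, a, b}" using n3_2[OF T nu] by metis
    have "S \<noteq> T" using n3 T(2) by auto
    then have "dart_verts S \<inter> dart_verts T = {u}"
      using TF_disjoint_verts[OF Su T(1)] by blast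
    then have "v \<notin> {a, b}" using ab dv u xy by auto
    then show ?thesis using e ab by blast
  qed
  obtain a b where x: "x \<noteq> X" "deg x = 5" "tri33 x a b" "v \<notin> {a, b}" using eng[of x] bg by auto
  have v3: "deg v = 3" using v by (simp add: three_def)
  show False
  proof (cases "four y")
    case True
    then show False
      using tri33_tri345[OF x(3,2), of y v] x xy v3 by (auto simp: four_def)
  next
    case False
    then have "big y" using n B by (auto simp: big_def)
    then obtain a' b' where y: "y \<noteq> X" "deg y = 5" "tri33 y a' b'" "v \<notin> {a', b'}" using eng[of y] by auto
    show False
      using tri33_tri33_tri355[OF x(3) y(3) x(2) y(2) v3] x y xy D_sym by auto
  qed
qed

text \<open>The tolls make up for the deficit 12, except that a generous triangle gets 6 of it from
  a big vertex. With one vertex of degree 3, the 6 it may claim is paid by a big vertex; with two,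
  the third vertex has to be big and pays the 12 they may claim.\<close>

lemma chf_tri:
  assumes S: "S \<in> F" "card S = 3"
  shows "chf S \<ge> 0"
proof -
  obtain a b where "(a, b) \<in> S" using S by (metis card.empty equals0I surj_pair zero_neq_numeral)
  then obtain c where c: "distinct [a, b, c]" "S = {(a, b), (b, c), (c, a)}" using face3[OF S] by metis
  then have dv: "dart_verts S = {a, b, c}" by auto
  have D: "(a, b) \<in> D" "(b, c) \<in> D" "(c, a) \<in> D" "(b, a) \<in> D" "(c, b) \<in> D" "(a, c) \<in> D"
    using c faceD(1)[OF S(1)] D_sym by auto
  have B: "a \<in> B" "b \<in> B" "c \<in> B" using dv face_verts_B[OF S(1)] by auto
  have ntr: "toll d = 0" if "d \<in> S" for d
    using tri_tri[OF S, of "fst d" "snd d"] that toll_not_tr[of d] by (auto simp: tr_def)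
  then have load: "load S = 0" using S by (simp add: load_def give_def)
  have tk: "toll (v, u) = (if generous S then 2 else 4)" if "(u, v) \<in> S" for u v
  proof -
    have "tr (v, u)" using that S by (auto simp: tr_def)
    moreover have "(\<exists>T\<in>F. card T = 3 \<and> (u, v) \<in> T \<and> generous T) \<longleftrightarrow> generous S"
      using that S face_unique by blast
    ultimately show ?thesis by (simp add: toll_def)
  qed
  have tks: "(\<Sum>d\<in>S. toll (snd d, fst d)) = (if generous S then 6 else 12)"
  proof -
    have "(\<Sum>d\<in>S. toll (snd d, fst d)) = (\<Sum>d\<in>S. if generous S then 2 else 4)"
      using tk by (intro sum.cong refl) auto
    then show ?thesis using S by simp
  qed
  let ?Q = "{q. q \<in> dart_verts S \<and> big q}"
  let ?A = "{v \<in> dart_verts S. clsA v}"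
  have finQ: "finite ?Q" using finite_dart_verts[OF S(1)] by simp
  have gnn: "gv q S \<ge> 0" for q by (simp add: gv_def)
  have sumQ: "(\<Sum>q\<in>?Q. gv q S) \<ge> gv q S" if "q \<in> ?Q" for q
    using that finQ gnn by (intro member_le_sum) auto
  have sum0: "(\<Sum>q\<in>?Q. gv q S) \<ge> 0" using gnn by (simp add: sum_nonneg)
  have ch: "chf S = - 12 + (if generous S then 6 else 12) + (\<Sum>q\<in>?Q. gv q S) - 6 * int (card ?A)"
    using S tks load by (simp add: chf_def gain_def)
  have A3: "?A \<subseteq> {v \<in> dart_verts S. three v}" by (auto simp: clsA_def)
  have cA: "card ?A \<le> n3 S" unfolding n3_def using A3 finite_dart_verts[OF S(1)] by (intro card_mono) auto
  have no333: "\<not> (three a \<and> three b \<and> three c)"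
    using no_3_path[of a b c] D c by (auto simp: three_def)
  show ?thesis
  proof (cases "n3 S = 0")
    case True
    then have "card ?A = 0" using cA by simp
    then show ?thesis
    proof (cases "generous S")
      case True
      then obtain q where "q \<in> ?Q" "gv q S = 6" unfolding generous_def by blast
      then show ?thesis using ch True \<open>card ?A = 0\<close> sumQ[of q] by simp
    next
      case False
      then show ?thesis using ch \<open>card ?A = 0\<close> sum0 by simp
    qed
  next
    case False
    then have ng: "\<not> generous S" by (simp add: generous_def)
    have key: "n3 S = 1 \<and> (clsA v \<longrightarrow> (\<exists>q\<in>?Q. gv q S = 6)) \<or> n3 S = 2 \<and> ?Q \<noteq> {}"
      if p: "dart_verts S = {v, x, y}" "distinct [v, x, y]" "(v, x) \<in> D" "(x, y) \<in> D" "(y, v) \<in> D"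
        "three v" "v \<in> B" "x \<in> B" "y \<in> B" for v x y
    proof -
      have v3: "deg v = 3" using p by (auto simp: three_def)
      have n33: "\<not> (three x \<and> three y)"
        using no_3_path[of v x y] p by (auto simp: three_def)
      consider "three x" "\<not> three y" | "three y" "\<not> three x" | "\<not> three x" "\<not> three y" using n33 by auto
      then show ?thesis
      proof cases
        case 1
        then have "{v \<in> dart_verts S. three v} = {v, x}" using p by auto
        then have "n3 S = 2" using p(2) by (simp add: n3_def)
        moreover have "\<not> four y" using no_334[of v x y] p 1 v3 by (auto simp: three_def four_def)
        then have "big y" using 1 p by (auto simp: big_def)
        ultimately show ?thesis using p by auto
      next
        case 2
        then have "{v \<in> dart_verts S. three v} = {v, y}" using p by auto
        then have "n3 S = 2" using p(2) by (simp add: n3_def)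
        moreover have "\<not> four x" using no_334[of v y x] p 2 v3 D_sym by (auto simp: three_def four_def)
        then have "big x" using 2 p by (auto simp: big_def)
        ultimately show ?thesis using p by auto
      next
        case 3
        then have "{v \<in> dart_verts S. three v} = {v}" using p by auto
        then have n1: "n3 S = 1" by (simp add: n3_def)
        have ST: "S \<in> TF v" using S p by (auto simp: TF_def)
        have "\<exists>q\<in>?Q. gv q S = 6" if A: "clsA v"
        proof -
          obtain T q where "T \<in> TF v" "q \<in> dart_verts T" "big q" using A by (auto simp: clsA_def)
          then have "q \<in> {v, x, y}" "big q" using TF_three_unique[OF p(6) ST] p by auto
          then have "big x \<or> big y" using p(6) by (auto simp: big_def)
          then show ?thesis
          proof
            assume "big x"
            then show ?thesis using tri_one_three[OF p(6) ST p(1-5) p(8,9) 3] p by auto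
          next
            assume b: "big y"
            have dv': "dart_verts S = {v, y, x}" using p by auto
            show ?thesis
              using tri_one_three[OF p(6) ST dv' _ _ _ _ p(9,8) 3(2,1) b] p D_sym[OF p(3)] D_sym[OF p(4)] D_sym[OF p(5)] by auto
          qed
        qed
        then show ?thesis using n1 by blast
      qed
    qed
    have "{v \<in> dart_verts S. three v} \<noteq> {}" using False unfolding n3_def by (metis card.empty)
    then obtain v where v: "v \<in> {a, b, c}" "three v" using dv by auto
    obtain x y where p: "dart_verts S = {v, x, y}" "distinct [v, x, y]" "(v, x) \<in> D" "(x, y) \<in> D" "(y, v) \<in> D"
        "v \<in> B" "x \<in> B" "y \<in> B"
    proof -
      from v(1) consider "v = a" | "v = b" | "v = c" by auto
      then show thesis
      proof cases
        case 1 show thesis by (rule that[of b c]) (use 1 dv c D B in auto)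
      next
        case 2 show thesis by (rule that[of c a]) (use 2 dv c D B in auto)
      next
        case 3 show thesis by (rule that[of a b]) (use 3 dv c D B in auto)
      qed
    qed
    from key[OF p(1-5) v(2) p(6-8)] show ?thesis
    proof
      assume h: "n3 S = 1 \<and> (clsA v \<longrightarrow> (\<exists>q\<in>?Q. gv q S = 6))"
      show ?thesis
      proof (cases "clsA v")
        case True
        then obtain q where "q \<in> ?Q" "gv q S = 6" using h by auto
        then show ?thesis using sumQ[of q] cA h ch ng by simp
      next
        case False
        have "{u \<in> dart_verts S. three u} = {v}"
        proof -
          have "{v} \<subseteq> {u \<in> dart_verts S. three u}" using v dv by auto
          moreover have "card {u \<in> dart_verts S. three u} = card {v}" using h by (simp add: n3_def)
          ultimately show ?thesis using finite_dart_verts[OF S(1)] by (metis (no_types, lifting) card_subset_eq finite_Collect_conjI Collect_mem_eq finite_subset mem_Collect_eq subsetI)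
        qed
        then have "?A = {}" using A3 False by auto
        then have "card ?A = 0" by (simp only: card.empty)
        then show ?thesis using sum0 ch ng by simp
      qed
    next
      assume h: "n3 S = 2 \<and> ?Q \<noteq> {}"
      then obtain q where "q \<in> ?Q" by blast
      moreover have "gv q S = 12" using h by (simp add: gv_def)
      ultimately show ?thesis using sumQ[of q] cA h ch ng by simp
    qed
  qed
qed

text \<open>Only one edge at \<open>u\<close> lies off the face \<open>S\<close>, so triangles
  across both sides of \<open>u\<close> would share that edge, contrary to
  \<open>tri_tri\<close>.\<close>

lemma three_sides:
  assumes u: "three u" and S: "S \<in> F" "card S \<noteq> 3" "(t, u) \<in> S" "(u, w) \<in> S"
  shows "\<not> (tr (t, u) \<and> tr (u, w))" "TF u \<noteq> {} \<longleftrightarrow> tr (t, u) \<or> tr (u, w)"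
proof -
  have u3: "deg u = 3" "u \<noteq> X" using u by (auto simp: three_def)
  have tw: "t \<noteq> w" using face_asym[OF S(1,3)] S(4) by auto
  have tn: "t \<in> D `` {u}" "w \<in> D `` {u}" using faceD(1)[OF S(1)] face_D_rev[OF S(1)] S by auto
  have no2: "p = q" if "p \<in> D `` {u}" "q \<in> D `` {u}" "p \<notin> {t, w}" "q \<notin> {t, w}" for p q
  proof (rule ccontr)
    assume "p \<noteq> q"
    then have "length [t, w, p, q] \<le> card (D `` {u})" using that tn tw by (intro card_ge_list) auto
    then show False using u3 by (simp add: deg_def)
  qed
  have nbr: "p \<in> D `` {u}" "q \<in> D `` {u}" "p \<noteq> q" if "T \<in> F" "(p, u) \<in> T" "(u, q) \<in> T" for T p q
    using faceD(1)[OF that(1,3)] face_D_rev[OF that(1,2)] face_asym[OF that(1,2)] that(3) by auto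
  show "\<not> (tr (t, u) \<and> tr (u, w))"
  proof
    assume "tr (t, u) \<and> tr (u, w)"
    then obtain T1 T2 where T: "T1 \<in> F" "card T1 = 3" "(u, t) \<in> T1" "T2 \<in> F" "card T2 = 3" "(w, u) \<in> T2"
      by (auto simp: tr_def)
    obtain p where p: "(p, u) \<in> T1" using face_next(2)[OF T(1,3)] by blast
    obtain q where q: "(u, q) \<in> T2" using face_next(1)[OF T(4,6)] by blast
    have "T1 \<noteq> S" "T2 \<noteq> S" using T S by auto
    then have pt: "p \<noteq> t" "q \<noteq> w" using p q T S face_unique by blast+
    have "p \<noteq> w" using digon_bad(1)[of S T1 t u w] S T p u3 by auto
    moreover have "q \<noteq> t" using digon_bad(1)[of S T2 t u w] S T q u3 by auto
    ultimately have "p = q" using no2 nbr T p q pt by blast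
    then show False using tri_tri[OF T(1,2) p T(4,5)] q by auto
  qed
  show "TF u \<noteq> {} \<longleftrightarrow> tr (t, u) \<or> tr (u, w)"
  proof
    assume "TF u \<noteq> {}"
    then obtain T where T: "T \<in> F" "card T = 3" "u \<in> dart_verts T" by (auto simp: TF_def)
    obtain p q where pq: "(p, u) \<in> T" "(u, q) \<in> T" using face_vert[OF T(1,3)] by blast
    have "T \<noteq> S" using T S by auto
    then have "p \<noteq> t" "q \<noteq> w" using pq T S face_unique by blast+
    then have "p = w \<or> q = t" using no2[of p q] nbr[OF T(1) pq] by auto
    then show "tr (t, u) \<or> tr (u, w)" using pq T by (auto simp: tr_def)
  next
    assume "tr (t, u) \<or> tr (u, w)"
    then show "TF u \<noteq> {}" unfolding tr_def TF_def using dart_vertsI by force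
  qed
qed

lemma clsB_tri344:
  assumes u: "clsB u" and T: "T \<in> F" "card T = 3" "dart_verts T = {u, x, y}" "distinct [u, x, y]"
     "(u, x) \<in> D" "(x, y) \<in> D" "(y, u) \<in> D" "x \<in> B" "y \<in> B"
  shows "tri344 u x y" "four x" "four y"
proof -
  have u3: "three u" "deg u = 3" using u by (auto simp: clsB_def three_def)
  have TT: "T \<in> TF u" using T by (auto simp: TF_def)
  then have nb: "\<not> big x" "\<not> big y" using u T by (auto simp: clsB_def clsA_def)
  have "\<not> (three x \<and> three y)" using no_3_path[of u x y] T u3 by (auto simp: three_def)
  moreover have "\<not> (three x \<and> four y)" using no_334[of u x y] T u3 by (auto simp: three_def four_def)
  moreover have "\<not> (four x \<and> three y)" using no_334[of u y x] T u3 D_sym by (auto simp: three_def four_def)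
  ultimately show f: "four x" "four y" using nb T by (auto simp: big_def)
  then show "tri344 u x y" using T u3 by (auto simp: tri344_def four_def)
qed

text \<open>By \<open>tri344_other_3\<close> the neighbour of degree 4 along the triangle is not
  followed by a vertex of degree 3. This gap of two vertices compensates for the large gift to a
  class B vertex.\<close>

lemma clsB_next:
  assumes u: "clsB u" and S: "S \<in> F" and t: "tr (u, w)" "(u, w) \<in> S" "(w, w') \<in> S"
  shows "\<exists>x. tri344 u x w" "four w" "\<not> three w'"
proof -
  obtain T where T: "T \<in> F" "card T = 3" "(w, u) \<in> T" using t by (auto simp: tr_def)
  obtain x where x: "distinct [w, u, x]" "T = {(w, u), (u, x), (x, w)}" using face3[OF T] by metis
  have d: "(u, x) \<in> D" "(x, w) \<in> D" "(w, u) \<in> D" "x \<in> B" "w \<in> B"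
    using x faceD[OF T(1)] by auto
  have "dart_verts T = {u, x, w}" using x by auto
  from clsB_tri344[OF u T(1,2) this _ d] x have *: "tri344 u x w" "four w" by auto
  then show "\<exists>x. tri344 u x w" "four w" by auto
  have "w' \<noteq> u" using face_asym[OF S t(2)] t(3) by auto
  then show "\<not> three w'" using tri344_other_3[OF *(1), of w'] faceD(1)[OF S t(3)] by (auto simp: three_def)
qed

lemma clsB_prev:
  assumes u: "clsB u" and S: "S \<in> F" and t: "tr (w, u)" "(w, u) \<in> S" "(w', w) \<in> S"
  shows "\<exists>x. tri344 u x w" "four w" "\<not> three w'"
proof -
  obtain T where T: "T \<in> F" "card T = 3" "(u, w) \<in> T" using t by (auto simp: tr_def)
  obtain x where x: "distinct [u, w, x]" "T = {(u, w), (w, x), (x, u)}" using face3[OF T] by metis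
  have d: "(u, x) \<in> D" "(x, w) \<in> D" "(w, u) \<in> D" "x \<in> B" "w \<in> B"
    using x faceD[OF T(1)] face_D_rev[OF T(1)] by auto
  have "dart_verts T = {u, x, w}" using x by auto
  from clsB_tri344[OF u T(1,2) this _ d] x have *: "tri344 u x w" "four w" by auto
  then show "\<exists>x. tri344 u x w" "four w" by auto
  have "w' \<noteq> u" using face_asym[OF S t(2)] t(3) by auto
  then show "\<not> three w'" using tri344_other_3[OF *(1), of w'] face_D_rev[OF S t(3)] by (auto simp: three_def)
qed

lemma side_facts:
  assumes S: "S \<in> F" "card S \<noteq> 3" "(t', t) \<in> S" "(t, u) \<in> S" "(u, w) \<in> S" "(w, w') \<in> S"
  shows "three u \<longrightarrow> \<not> (tr (t, u) \<and> tr (u, w))"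
    "clsN u \<longrightarrow> \<not> tr (t, u) \<and> \<not> tr (u, w)"
    "three u \<and> \<not> clsN u \<longrightarrow> tr (t, u) \<or> tr (u, w)"
    "clsB u \<longrightarrow> tr (u, w) \<and> \<not> three w \<and> \<not> three w' \<or> tr (t, u) \<and> \<not> three t \<and> \<not> three t'"
    "\<not> (three t \<and> three u \<and> three w)"
proof -
  show "three u \<longrightarrow> \<not> (tr (t, u) \<and> tr (u, w))" using three_sides(1) S by blast
  show "clsN u \<longrightarrow> \<not> tr (t, u) \<and> \<not> tr (u, w)" using three_sides(2) S unfolding clsN_def by blast
  show "three u \<and> \<not> clsN u \<longrightarrow> tr (t, u) \<or> tr (u, w)" using three_sides(2) S unfolding clsN_def by blast
  show "\<not> (three t \<and> three u \<and> three w)"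
    using no_3_path[of t u w] faceD(1)[OF S(1)] S face_asym[OF S(1)] unfolding three_def by blast
  show "clsB u \<longrightarrow> tr (u, w) \<and> \<not> three w \<and> \<not> three w' \<or> tr (t, u) \<and> \<not> three t \<and> \<not> three t'"
  proof
    assume B: "clsB u"
    then have "tr (t, u) \<or> tr (u, w)" using three_sides(2)[OF _ S(1,2,4,5)] by (auto simp: clsB_def)
    then show "tr (u, w) \<and> \<not> three w \<and> \<not> three w' \<or> tr (t, u) \<and> \<not> three t \<and> \<not> three t'"
      using clsB_next[OF B S(1) _ S(5,6)] clsB_prev[OF B S(1) _ S(4,3)] by (auto simp: four_def three_def)
  qed
qed

end

text \<open>\<open>p1\<close> is the side from vertex 1 to vertex 2, \<open>h\<close> means degree
  3, \<open>n\<close> and \<open>b\<close> mean classes N and B. No three vertices in a row have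
  degree 3, so at most three receive 2. If three do, none has the gap that class B demands; all are
  of class N, every side touches one of them, and there are no tolls. Otherwise two gifts and two
  tolls amount to at most 12.\<close>

lemma pentagon_bool:
  fixes p1 p2 p3 p4 p5 h1 h2 h3 h4 h5 n1 n2 n3 n4 n5 b1 b2 b3 b4 b5 :: bool
  assumes "(if p1 then 1 else 0) + (if p2 then 1 else 0) + (if p3 then 1 else 0) + (if p4 then 1 else 0) + (if p5 then 1 else 0) \<le> (2::int)"
    and "n1 \<or> b1 \<longrightarrow> h1" "n2 \<or> b2 \<longrightarrow> h2" "n3 \<or> b3 \<longrightarrow> h3" "n4 \<or> b4 \<longrightarrow> h4" "n5 \<or> b5 \<longrightarrow> h5"
    and "h1 \<longrightarrow> \<not> (p5 \<and> p1)" "h2 \<longrightarrow> \<not> (p1 \<and> p2)" "h3 \<longrightarrow> \<not> (p2 \<and> p3)" "h4 \<longrightarrow> \<not> (p3 \<and> p4)" "h5 \<longrightarrow> \<not> (p4 \<and> p5)"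
    and "n1 \<longrightarrow> \<not> p5 \<and> \<not> p1" "n2 \<longrightarrow> \<not> p1 \<and> \<not> p2" "n3 \<longrightarrow> \<not> p2 \<and> \<not> p3" "n4 \<longrightarrow> \<not> p3 \<and> \<not> p4" "n5 \<longrightarrow> \<not> p4 \<and> \<not> p5"
    and "\<not> (h5 \<and> h1 \<and> h2)" "\<not> (h1 \<and> h2 \<and> h3)" "\<not> (h2 \<and> h3 \<and> h4)" "\<not> (h3 \<and> h4 \<and> h5)" "\<not> (h4 \<and> h5 \<and> h1)"
    and "b1 \<longrightarrow> p1 \<and> \<not> h2 \<and> \<not> h3 \<or> p5 \<and> \<not> h5 \<and> \<not> h4"
    and "b2 \<longrightarrow> p2 \<and> \<not> h3 \<and> \<not> h4 \<or> p1 \<and> \<not> h1 \<and> \<not> h5"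
    and "b3 \<longrightarrow> p3 \<and> \<not> h4 \<and> \<not> h5 \<or> p2 \<and> \<not> h2 \<and> \<not> h1"
    and "b4 \<longrightarrow> p4 \<and> \<not> h5 \<and> \<not> h1 \<or> p3 \<and> \<not> h3 \<and> \<not> h2"
    and "b5 \<longrightarrow> p5 \<and> \<not> h1 \<and> \<not> h2 \<or> p4 \<and> \<not> h4 \<and> \<not> h3"
  shows "(if n1 \<or> b1 then 2 else 0) + (if n2 \<or> b2 then 2 else 0) + (if n3 \<or> b3 then 2 else 0) + (if n4 \<or> b4 then 2 else 0) + (if n5 \<or> b5 then 2 else 0)
    + ((if p1 then 4 else 0) + (if p2 then 4 else 0) + (if p3 then 4 else 0) + (if p4 then 4 else 0) + (if p5 then 4 else 0)) \<le> (12::int)"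
proof -
  define g1 g2 g3 g4 g5 where g: "g1 = (n1 \<or> b1)" "g2 = (n2 \<or> b2)" "g3 = (n3 \<or> b3)" "g4 = (n4 \<or> b4)" "g5 = (n5 \<or> b5)"
  let ?P = "\<not> p1 \<and> \<not> p2 \<and> \<not> p3 \<and> \<not> p4 \<and> \<not> p5"
  have "\<not> (g5 \<and> g1 \<and> g2)" "\<not> (g1 \<and> g2 \<and> g3)" "\<not> (g2 \<and> g3 \<and> g4)" "\<not> (g3 \<and> g4 \<and> g5)" "\<not> (g4 \<and> g5 \<and> g1)"
    unfolding g using assms(2-6,17-21) by blast+
  moreover have "g1 \<and> g2 \<and> g4 \<longrightarrow> ?P"
    unfolding g using assms(2-6,12-26) by blast
  moreover have "g2 \<and> g3 \<and> g5 \<longrightarrow> ?P"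
    unfolding g using assms(2-6,12-26) by blast
  moreover have "g3 \<and> g4 \<and> g1 \<longrightarrow> ?P"
    unfolding g using assms(2-6,12-26) by blast
  moreover have "g4 \<and> g5 \<and> g2 \<longrightarrow> ?P"
    unfolding g using assms(2-6,12-26) by blast
  moreover have "g5 \<and> g1 \<and> g3 \<longrightarrow> ?P"
    unfolding g using assms(2-6,12-26) by blast
  moreover define P :: int where "P = (if p1 then 1 else 0) + (if p2 then 1 else 0) + (if p3 then 1 else 0) + (if p4 then 1 else 0) + (if p5 then 1 else 0)"
  moreover have "(if p1 then 4 else 0) + (if p2 then 4 else 0) + (if p3 then 4 else 0) + (if p4 then 4 else 0) + (if p5 then 4 else 0) = 4 * P"
    by (simp add: P_def)
  moreover have "?P \<longrightarrow> P = 0" by (simp add: P_def)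
  moreover have "P \<le> 2" using assms(1) by (simp add: P_def)
  ultimately have *: "\<not> (g5 \<and> g1 \<and> g2)" "\<not> (g1 \<and> g2 \<and> g3)" "\<not> (g2 \<and> g3 \<and> g4)" "\<not> (g3 \<and> g4 \<and> g5)" "\<not> (g4 \<and> g5 \<and> g1)"
    "g1 \<and> g2 \<and> g4 \<longrightarrow> P = 0" "g2 \<and> g3 \<and> g5 \<longrightarrow> P = 0" "g3 \<and> g4 \<and> g1 \<longrightarrow> P = 0" "g4 \<and> g5 \<and> g2 \<longrightarrow> P = 0"
    "g5 \<and> g1 \<and> g3 \<longrightarrow> P = 0" "P \<le> 2"
    and eq: "(if p1 then 4 else 0) + (if p2 then 4 else 0) + (if p3 then 4 else 0) + (if p4 then 4 else 0) + (if p5 then 4 else 0) = 4 * P"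
    by blast+
  show ?thesis
    unfolding eq g[symmetric] using * by (cases g1; cases g2; cases g3; cases g4; cases g5) simp_all
qed

text \<open>The side between vertices 1 and 2 carries the only toll, which leaves 20 of the charge
  24. \<open>a1\<close>, \<open>a2\<close> mean class A and \<open>f1\<close>, \<open>f2\<close> an
  incident pentagon; whoever gets more because of a pentagon has no vertex of degree 3 opposite to
  it.\<close>

lemma hexagon_bool:
  fixes h1 h2 h3 h4 h5 h6 a1 a2 f1 f2 :: bool
  assumes "h1 \<and> \<not> a1 \<longrightarrow> \<not> h2 \<and> \<not> h3" "h2 \<and> \<not> a2 \<longrightarrow> \<not> h1 \<and> \<not> h6"
    and "f1 \<and> h1 \<longrightarrow> \<not> h4" "f2 \<and> h2 \<longrightarrow> \<not> h5"
    and "\<not> (h6 \<and> h1 \<and> h2)" "\<not> (h1 \<and> h2 \<and> h3)" "\<not> (h2 \<and> h3 \<and> h4)" "\<not> (h3 \<and> h4 \<and> h5)"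
      "\<not> (h4 \<and> h5 \<and> h6)" "\<not> (h5 \<and> h6 \<and> h1)"
  shows "(if h1 then if a1 then if f1 then 6 else 3 else if f1 then 10 else 6 else 0)
    + (if h2 then if a2 then if f2 then 6 else 3 else if f2 then 10 else 6 else 0)
    + (if h3 then 5 else 0) + (if h4 then 5 else 0) + (if h5 then 5 else 0) + (if h6 then 5 else 0) \<le> (20::int)"
proof -
  consider (1) h1 h2 | (2) h1 "\<not> h2" | (3) "\<not> h1" h2 | (4) "\<not> h1" "\<not> h2" by blast
  then show ?thesis
  proof cases
    case 1
    then have "a1" "a2" "\<not> h3" "\<not> h6" "f1 \<longrightarrow> \<not> h4" "f2 \<longrightarrow> \<not> h5" using assms by blast+
    then show ?thesis using 1 by (cases f1; cases f2; cases h4; cases h5) simp_all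
  next
    case 2
    then have *: "\<not> a1 \<longrightarrow> \<not> h3" "f1 \<longrightarrow> \<not> h4" "\<not> (h5 \<and> h6)" "\<not> (h3 \<and> h4 \<and> h5)" using assms by blast+
    then show ?thesis using 2 by (cases a1; cases f1; cases h3; cases h4; cases h5; cases h6) simp_all
  next
    case 3
    then have *: "\<not> a2 \<longrightarrow> \<not> h6" "f2 \<longrightarrow> \<not> h5" "\<not> (h3 \<and> h4)" "\<not> (h4 \<and> h5 \<and> h6)" using assms by blast+
    then show ?thesis using 3 by (cases a2; cases f2; cases h3; cases h4; cases h5; cases h6) simp_all
  next
    case 4
    then show ?thesis by simp
  qed
qed

section \<open>Loads of faces of length 5, 6 and 7\<close>

context plane_block
begin

text \<open>The third vertex of the triangle can equal the vertex before or after the side only if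
  triangle and face share two consecutive edges.\<close>

lemma tr_apex:
  assumes S: "S \<in> F" "(t, u) \<in> S" "(u, v) \<in> S" "(v, w) \<in> S" and tr: "tr (u, v)"
  shows "\<exists>x. apex x u v \<and> (x = w \<or> x = t \<longrightarrow> bad S)"
proof -
  obtain T where T: "T \<in> F" "card T = 3" "(v, u) \<in> T" using tr by (auto simp: tr_def)
  obtain x where x: "T = {(v, u), (u, x), (x, v)}" using face3[OF T] by metis
  then have m: "(u, x) \<in> T" "(x, v) \<in> T" by auto
  have "apex x u v" using apexI faceD(1)[OF T(1)] m by blast
  moreover have "bad S" if "x = w" using digon_bad(2)[OF S(1) T(1) S(3,4)] m T(3) that by auto
  moreover have "bad S" if "x = t" using digon_bad(2)[OF S(1) T(1) S(2,3)] m T(3) that by auto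
  ultimately show ?thesis by blast
qed

lemma give_card5: "card S = 5 \<Longrightarrow> give S v = (if clsN v \<or> clsB v then 2 else 0)"
  by (auto simp: give_def clsN_def clsB_def clsA_def)

lemma give_other:
  assumes "card S \<noteq> 3" "card S \<noteq> 5"
  shows "\<not> three v \<Longrightarrow> give S v = 0" "clsN v \<Longrightarrow> give S v \<le> 5"
    "three v \<Longrightarrow> \<not> clsN v \<Longrightarrow> give S v = (if clsA v then if has5 v then 6 else 3 else if has5 v then 10 else 6)"
    "give S v \<le> 10" "\<not> clsB v \<Longrightarrow> give S v \<le> 6"
  using assms by (auto simp: give_def clsN_def clsB_def)

lemma toll_if: "toll d \<le> (if tr d then 4 else 0)"
  using toll_le toll_not_tr by simp

lemma load_5:
  assumes S: "S \<in> F" "card S = 5"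
  shows "load S \<le> 12"
proof -
  obtain a b where ab: "(a, b) \<in> S" using S by (metis card.empty equals0I surj_pair zero_neq_numeral)
  obtain c d e where l: "distinct [a, b, c, d, e]" and Se: "S = {(a, b), (b, c), (c, d), (d, e), (e, a)}"
    using face5[OF S ab] .
  have m: "(a, b) \<in> S" "(b, c) \<in> S" "(c, d) \<in> S" "(d, e) \<in> S" "(e, a) \<in> S" using Se by auto
  note mD = faceD(1)[OF S(1) m(1)] faceD(1)[OF S(1) m(2)] faceD(1)[OF S(1) m(3)] faceD(1)[OF S(1) m(4)] faceD(1)[OF S(1) m(5)]
  have p: "cyc [a, b, c, d, e]" using l mD unfolding cyc5 by auto
  have p2: "cyc [b, c, d, e, a]" using cyc_rotate[OF p] by simp
  have p3: "cyc [c, d, e, a, b]" using cyc_rotate[OF p2] by simp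
  have p4: "cyc [d, e, a, b, c]" using cyc_rotate[OF p3] by simp
  have p5: "cyc [e, a, b, c, d]" using cyc_rotate[OF p4] by simp
  have x: "tr (a, b) \<Longrightarrow> \<exists>x. apex x a b" "tr (b, c) \<Longrightarrow> \<exists>x. apex x b c" "tr (c, d) \<Longrightarrow> \<exists>x. apex x c d"
    "tr (d, e) \<Longrightarrow> \<exists>x. apex x d e" "tr (e, a) \<Longrightarrow> \<exists>x. apex x e a"
    using tr_apex[OF S(1) m(5,1,2)] tr_apex[OF S(1) m(1,2,3)] tr_apex[OF S(1) m(2,3,4)] tr_apex[OF S(1) m(3,4,5)]
      tr_apex[OF S(1) m(4,5,1)] by blast+
  have t1: "\<not> (tr (a, b) \<and> tr (b, c) \<and> tr (c, d))" "\<not> (tr (a, b) \<and> tr (b, c) \<and> tr (d, e))"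
    using cyc5_three_apex[OF p] x by blast+
  have t2: "\<not> (tr (b, c) \<and> tr (c, d) \<and> tr (d, e))" "\<not> (tr (b, c) \<and> tr (c, d) \<and> tr (e, a))"
    using cyc5_three_apex[OF p2] x by blast+
  have t3: "\<not> (tr (c, d) \<and> tr (d, e) \<and> tr (e, a))" "\<not> (tr (c, d) \<and> tr (d, e) \<and> tr (a, b))"
    using cyc5_three_apex[OF p3] x by blast+
  have t4: "\<not> (tr (d, e) \<and> tr (e, a) \<and> tr (a, b))" "\<not> (tr (d, e) \<and> tr (e, a) \<and> tr (b, c))"
    using cyc5_three_apex[OF p4] x by blast+
  have t5: "\<not> (tr (e, a) \<and> tr (a, b) \<and> tr (b, c))" "\<not> (tr (e, a) \<and> tr (a, b) \<and> tr (c, d))"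
    using cyc5_three_apex[OF p5] x by blast+
  have two: "(if tr (a, b) then 1 else 0) + (if tr (b, c) then 1 else 0) + (if tr (c, d) then 1 else 0) +
     (if tr (d, e) then 1 else 0) + (if tr (e, a) then 1 else 0) \<le> (2::int)"
    using t1 t2 t3 t4 t5
    by (cases "tr (a, b)"; cases "tr (b, c)"; cases "tr (c, d)"; cases "tr (d, e)"; cases "tr (e, a)") simp_all
  have c3: "card S \<noteq> 3" using S by simp
  note sa = side_facts[OF S(1) c3 m(4,5,1,2)] and sb = side_facts[OF S(1) c3 m(5,1,2,3)]
    and sc = side_facts[OF S(1) c3 m(1,2,3,4)] and sd = side_facts[OF S(1) c3 m(2,3,4,5)]
    and se = side_facts[OF S(1) c3 m(3,4,5,1)]
  have cls: "clsN v \<or> clsB v \<longrightarrow> three v" for v by (auto simp: clsN_def clsB_def)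
  have "(\<Sum>d\<in>S. give S (fst d)) = (if clsN a \<or> clsB a then 2 else 0) + (if clsN b \<or> clsB b then 2 else 0)
     + (if clsN c \<or> clsB c then 2 else 0) + (if clsN d \<or> clsB d then 2 else 0) + (if clsN e \<or> clsB e then 2 else 0)"
    unfolding give_card5[OF S(2)] unfolding Se using l by simp
  moreover have "(\<Sum>d\<in>S. toll d) \<le> (if tr (a, b) then 4 else 0) + (if tr (b, c) then 4 else 0) + (if tr (c, d) then 4 else 0)
     + (if tr (d, e) then 4 else 0) + (if tr (e, a) then 4 else 0)"
  proof -
    have "(\<Sum>d\<in>S. toll d) \<le> (\<Sum>d\<in>S. if tr d then 4 else 0)" by (intro sum_mono toll_if)
    then show ?thesis unfolding Se using l by simp
  qed
  moreover have "(if clsN a \<or> clsB a then 2 else 0) + (if clsN b \<or> clsB b then 2 else 0)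
     + (if clsN c \<or> clsB c then 2 else 0) + (if clsN d \<or> clsB d then 2 else 0) + (if clsN e \<or> clsB e then 2 else 0)
     + ((if tr (a, b) then 4 else 0) + (if tr (b, c) then 4 else 0) + (if tr (c, d) then 4 else 0)
     + (if tr (d, e) then 4 else 0) + (if tr (e, a) then 4 else 0)) \<le> (12::int)"
    by (rule pentagon_bool[OF two cls cls cls cls cls sa(1) sb(1) sc(1) sd(1) se(1) sa(2) sb(2) sc(2) sd(2) se(2)
        sa(5) sb(5) sc(5) sd(5) se(5) sa(4) sb(4) sc(4) sd(4) se(4)])
  ultimately show ?thesis unfolding load_def by linarith
qed

lemma five_five_edge:
  assumes S: "S \<in> F" "card S = 5" "(u, w) \<in> S" and T: "T \<in> F" "card T = 5" "(w, u) \<in> T"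
  shows "bad S" "bad T"
proof -
  obtain c d e where s: "distinct [u, w, c, d, e]" "S = {(u, w), (w, c), (c, d), (d, e), (e, u)}"
    using face5[OF S] .
  obtain p q r where t: "distinct [w, u, p, q, r]" "T = {(w, u), (u, p), (p, q), (q, r), (r, w)}"
    using face5[OF T] .
  have "cyc [u, w, c, d, e]" using s faceD(1)[OF S(1)] unfolding cyc5 by auto
  moreover have "cyc [w, u, p, q, r]" using t faceD(1)[OF T(1)] unfolding cyc5 by auto
  ultimately have "p = e \<or> r = c" using cyc5_cyc5 by blast
  moreover have "(e, u) \<in> S" "(w, c) \<in> S" "(u, p) \<in> T" "(r, w) \<in> T" using s t by auto
  ultimately have "bad S \<and> bad T"
    using digon_bad(2,3)[OF S(1) T(1), of e u w] digon_bad(2,3)[OF S(1) T(1), of u w c] S(3) T(3) by metis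
  then show "bad S" "bad T" by auto
qed

text \<open>Each of the two faces uses two of the three edges at \<open>v\<close>, so they share an
  edge, where \<open>five_five_edge\<close> applies.\<close>

lemma five_five:
  assumes v: "three v" and S: "S \<in> F" "card S = 5" "v \<in> dart_verts S" and T: "T \<in> F" "card T = 5" "v \<in> dart_verts T"
    and ne: "S \<noteq> T"
  shows "bad S \<and> bad T"
proof -
  obtain p q where pq: "(p, v) \<in> S" "(v, q) \<in> S" using face_vert[OF S(1,3)] by blast
  obtain p' q' where pq': "(p', v) \<in> T" "(v, q') \<in> T" using face_vert[OF T(1,3)] by blast
  have n: "p \<noteq> p'" "q \<noteq> q'" using face_unique ne S T pq pq' by blast+
  have n2: "p \<noteq> q" "p' \<noteq> q'" using face_asym S T pq pq' by blast+
  have "p = q' \<or> q = p'"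
  proof (rule ccontr)
    assume "\<not> ?thesis"
    then have "length [p, q, p', q'] \<le> card (D `` {v})"
      using n n2 faceD(1)[OF S(1)] faceD(1)[OF T(1)] face_D_rev[OF S(1)] face_D_rev[OF T(1)] pq pq'
      by (intro card_ge_list) auto
    then show False using v by (simp add: three_def deg_def)
  qed
  then show ?thesis
    using five_five_edge[OF S(1,2) pq(1) T(1,2)] five_five_edge[OF S(1,2) pq(2) T(1,2)] pq' by auto
qed

lemma face6_cyc: "S \<in> F \<Longrightarrow> S = {(a, b), (b, c), (c, d), (d, e), (e, f), (f, a)} \<Longrightarrow> distinct [a, b, c, d, e, f] \<Longrightarrow>
    cyc [a, b, c, d, e, f]"
  using faceD(1)[of S] unfolding cyc6 by auto

text \<open>At an end of the side with the triangle, a pentagon is the third face around that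
  vertex, so the faces there are exactly those of \<open>cyc5_cyc6_triangle\<close>, with the
  hexagon read from this vertex.\<close>

lemma face6_opposite:
  assumes S: "S \<in> F" "card S = 6" "\<not> bad S" and l: "distinct [a, b, c, d, e, f]"
    and Se: "S = {(a, b), (b, c), (c, d), (d, e), (e, f), (f, a)}" and tr: "tr (a, b)"
  shows "has5 a \<Longrightarrow> three a \<Longrightarrow> \<not> three d" "has5 b \<Longrightarrow> three b \<Longrightarrow> \<not> three e"
proof -
  have m: "(a, b) \<in> S" "(b, c) \<in> S" "(c, d) \<in> S" "(d, e) \<in> S" "(e, f) \<in> S" "(f, a) \<in> S" using Se by auto
  have h: "cyc [a, b, c, d, e, f]" using face6_cyc[OF S(1) Se l] .
  have h2: "cyc [b, c, d, e, f, a]" using cyc_rotate[OF h] by simp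
  have hr: "cyc [a, f, e, d, c, b]" using cyc_rev[OF h2] by simp
  obtain T where T: "T \<in> F" "card T = 3" "(b, a) \<in> T" using tr by (auto simp: tr_def)
  obtain x where x: "distinct [b, a, x]" "T = {(b, a), (a, x), (x, b)}" using face3[OF T] by metis
  have mT: "(a, x) \<in> T" "(x, b) \<in> T" using x by auto
  have xD: "(a, x) \<in> D" "(x, b) \<in> D" "(x, a) \<in> D" "(b, x) \<in> D"
    using faceD(1)[OF T(1)] face_D_rev[OF T(1)] mT by auto
  have xf: "x \<noteq> f" using digon_bad(2)[OF S(1) T(1) m(6,1)] mT T(3) S(3) by auto
  have xc: "x \<noteq> c" using digon_bad(2)[OF S(1) T(1) m(1,2)] mT T(3) S(3) by auto
  have nb: "D `` {v} = {p, q, r}" if "deg v = 3" "distinct [p, q, r]" "(v, p) \<in> D" "(v, q) \<in> D" "(v, r) \<in> D" for v p q r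
  proof -
    have "{p, q, r} \<subseteq> D `` {v}" "card {p, q, r} = card (D `` {v})" using that by (auto simp: deg_def)
    then show ?thesis by (metis card_subset_eq finite_nbrs)
  qed
  {
    assume a: "has5 a" "three a"
    obtain P where P: "P \<in> F" "card P = 5" "a \<in> dart_verts P" using a by (auto simp: has5_def)
    obtain p q where pq: "(p, a) \<in> P" "(a, q) \<in> P" using face_vert[OF P(1,3)] by blast
    have nbr: "D `` {a} = {f, b, x}"
      using a l x xf xD faceD(1)[OF S(1) m(1)] face_D_rev[OF S(1) m(6)] by (intro nb) (auto simp: three_def)
    have "P \<noteq> S" "P \<noteq> T" using P S T by auto
    then have "p \<noteq> f" "p \<noteq> b" "q \<noteq> b" "q \<noteq> x" using pq m mT T S P face_unique by blast+
    moreover have "p \<in> D `` {a}" "q \<in> D `` {a}" using pq faceD(1)[OF P(1)] face_D_rev[OF P(1)] by auto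
    ultimately have "p = x" "q = f" using nbr by auto
    then have xa: "(x, a) \<in> P" "(a, f) \<in> P" using pq by auto
    obtain c' \<alpha> \<beta> where P5: "distinct [x, a, c', \<alpha>, \<beta>]" "P = {(x, a), (a, c'), (c', \<alpha>), (\<alpha>, \<beta>), (\<beta>, x)}"
      using face5[OF P(1,2) xa(1)] .
    have c': "c' = f" using xa(2) P5 by auto
    have mP: "(f, \<alpha>) \<in> P" using P5 c' by auto
    have "cyc [x, a, f, \<alpha>, \<beta>]" using P5 c' faceD(1)[OF P(1)] unfolding cyc5 by auto
    then have "cyc [a, f, \<alpha>, \<beta>, x]" using cyc_rotate by fastforce
    moreover have "\<alpha> \<noteq> e" using digon_bad(3)[OF P(1) S(1) xa(2) mP] m S(3) by auto
    ultimately have "deg d \<ge> 4" using cyc5_cyc6_triangle[OF _ hr xD(2)] xc by auto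
    then show "\<not> three d" by (auto simp: three_def)
  }
  {
    assume b: "has5 b" "three b"
    obtain P where P: "P \<in> F" "card P = 5" "b \<in> dart_verts P" using b by (auto simp: has5_def)
    obtain p q where pq: "(p, b) \<in> P" "(b, q) \<in> P" using face_vert[OF P(1,3)] by blast
    have nbr: "D `` {b} = {a, c, x}"
      using b l x xc xD face_D_rev[OF S(1) m(1)] faceD(1)[OF S(1) m(2)] by (intro nb) (auto simp: three_def)
    have "P \<noteq> S" "P \<noteq> T" using P S T by auto
    then have "p \<noteq> a" "p \<noteq> x" "q \<noteq> c" "q \<noteq> a" using pq m mT T S P face_unique by blast+
    moreover have "p \<in> D `` {b}" "q \<in> D `` {b}" using pq faceD(1)[OF P(1)] face_D_rev[OF P(1)] by auto
    ultimately have "p = c" "q = x" using nbr by auto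
    then have xa: "(c, b) \<in> P" "(b, x) \<in> P" using pq by auto
    obtain c' \<alpha> \<beta> where P5: "distinct [c, b, c', \<alpha>, \<beta>]" "P = {(c, b), (b, c'), (c', \<alpha>), (\<alpha>, \<beta>), (\<beta>, c)}"
      using face5[OF P(1,2) xa(1)] .
    have c': "c' = x" using xa(2) P5 by auto
    have mP: "(\<beta>, c) \<in> P" using P5 by auto
    have "cyc [c, b, x, \<alpha>, \<beta>]" using P5 c' faceD(1)[OF P(1)] unfolding cyc5 by auto
    then have "cyc [\<beta>, \<alpha>, x, b, c]" using cyc_rev by fastforce
    then have "cyc [b, c, \<beta>, \<alpha>, x]" unfolding cyc5 by auto
    moreover have "\<beta> \<noteq> d" using digon_bad(2)[OF S(1) P(1) m(2,3)] mP xa(1) S(3) by auto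
    ultimately have "deg e \<ge> 4" using cyc5_cyc6_triangle[OF _ h2 xD(3)] xf by auto
    then show "\<not> three e" by (auto simp: three_def)
  }
qed

lemma sum_cycle6:
  assumes "distinct [a, b, c, d, e, f]"
  shows "(\<Sum>x\<in>{(a, b), (b, c), (c, d), (d, e), (e, f), (f, a)}. g x) = g (a, b) + g (b, c) + g (c, d) + g (d, e) + g (e, f) + (g (f, a) :: int)"
  using assms by simp

text \<open>At most one side has a triangle across it, as two would give an 8-cycle. If there is
  none, all vertices of degree 3 are of class N, at most four of them occur, and each gets at most
  5.\<close>

lemma load_6:
  assumes S: "S \<in> F" "card S = 6" "\<not> bad S"
  shows "load S \<le> 24"
proof -
  have c3: "card S \<noteq> 3" and c5: "card S \<noteq> 5" using S by auto
  note gv = give_other[OF c3 c5]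
  \<comment> \<open>The hexagon is read starting from a side with a triangle whenever one
    exists.\<close>
  have ch: "\<exists>d. d \<in> S \<and> ((\<exists>d'\<in>S. tr d') \<longrightarrow> tr d)"
    using S by (metis card.empty ex_in_conv zero_neq_numeral)
  then obtain a b where ab: "(a, b) \<in> S" "(\<exists>d'\<in>S. tr d') \<longrightarrow> tr (a, b)" by auto
  obtain c d e f where l: "distinct [a, b, c, d, e, f]" and Se: "S = {(a, b), (b, c), (c, d), (d, e), (e, f), (f, a)}"
    using face6[OF S(1,2) ab(1)] .
  have m: "(a, b) \<in> S" "(b, c) \<in> S" "(c, d) \<in> S" "(d, e) \<in> S" "(e, f) \<in> S" "(f, a) \<in> S" using Se by auto
  note sa = side_facts[OF S(1) c3 m(5,6,1,2)] and sb = side_facts[OF S(1) c3 m(6,1,2,3)]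
    and sc = side_facts[OF S(1) c3 m(1,2,3,4)] and sd = side_facts[OF S(1) c3 m(2,3,4,5)]
    and se = side_facts[OF S(1) c3 m(3,4,5,6)] and sf = side_facts[OF S(1) c3 m(4,5,6,1)]
  have gs: "(\<Sum>x\<in>S. give S (fst x)) = give S a + give S b + give S c + give S d + give S e + give S f"
    using sum_cycle6[OF l, of "\<lambda>x. give S (fst x)"] unfolding Se[symmetric] by simp
  have ts: "(\<Sum>x\<in>S. toll x) = toll (a, b) + toll (b, c) + toll (c, d) + toll (d, e) + toll (e, f) + toll (f, a)"
    using sum_cycle6[OF l, of toll] unfolding Se[symmetric] .
  have gN: "give S v \<le> (if three v then 5 else 0)" if "three v \<Longrightarrow> clsN v" for v
    using that gv(1,2)[of v] by auto
  show ?thesis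
  proof (cases "tr (a, b)")
    case False
    then have nt: "\<not> tr (a, b)" "\<not> tr (b, c)" "\<not> tr (c, d)" "\<not> tr (d, e)" "\<not> tr (e, f)" "\<not> tr (f, a)"
      using ab m by blast+
    have g: "give S a \<le> (if three a then 5 else 0)" "give S b \<le> (if three b then 5 else 0)" "give S c \<le> (if three c then 5 else 0)"
       "give S d \<le> (if three d then 5 else 0)" "give S e \<le> (if three e then 5 else 0)" "give S f \<le> (if three f then 5 else 0)"
      using gN sa(3) sb(3) sc(3) sd(3) se(3) sf(3) nt by blast+
    have "\<not> (three a \<and> three b \<and> three c)" "\<not> (three d \<and> three e \<and> three f)" using sb(5) se(5) by blast+
    then have "(\<Sum>x\<in>S. give S (fst x)) \<le> 20"
      unfolding gs using g by (auto split: if_splits)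
    moreover have "(\<Sum>x\<in>S. toll x) = 0" unfolding ts using nt toll_not_tr by simp
    ultimately show ?thesis by (simp add: load_def)
  next
    case True
    have h: "cyc [a, b, c, d, e, f]" using face6_cyc[OF S(1) Se l] .
    have h2: "cyc [b, c, d, e, f, a]" using cyc_rotate[OF h] by simp
    have h3: "cyc [c, d, e, f, a, b]" using cyc_rotate[OF h2] by simp
    have h4: "cyc [d, e, f, a, b, c]" using cyc_rotate[OF h3] by simp
    have h5: "cyc [e, f, a, b, c, d]" using cyc_rotate[OF h4] by simp
    have h6: "cyc [f, a, b, c, d, e]" using cyc_rotate[OF h5] by simp
    obtain x where x: "apex x a b" "x \<notin> {a, b, c, d, e, f}"
      using tr_apex[OF S(1) m(6,1,2) True] cyc6_apex[OF h] S(3) by blast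
    have ap: "\<exists>y. apex y u v \<and> y \<notin> {a, b, c, d, e, f}" if "tr (u, v)" "(t, u) \<in> S" "(u, v) \<in> S" "(v, w) \<in> S"
       "cyc [u, v, w, w', t', t]" "{u, v, w, w', t', t} = {a, b, c, d, e, f}" for t u v w w' t'
      using tr_apex[OF S(1) that(2-4,1)] cyc6_apex[OF that(5)] S(3) unfolding that(6) by blast
    have nbc: "\<not> tr (b, c)"
    proof
      assume "tr (b, c)"
      from ap[OF this m(1,2,3) h2] obtain y where "apex y b c" "y \<notin> {a, b, c, d, e, f}" by auto
      then show False using cyc6_two_apex(1)[OF h x] by blast
    qed
    have ncd: "\<not> tr (c, d)"
    proof
      assume "tr (c, d)"
      from ap[OF this m(2,3,4) h3] obtain y where "apex y c d" "y \<notin> {a, b, c, d, e, f}" by auto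
      then show False using cyc6_two_apex(2)[OF h x] by blast
    qed
    have nde: "\<not> tr (d, e)"
    proof
      assume "tr (d, e)"
      from ap[OF this m(3,4,5) h4] obtain y where "apex y d e" "y \<notin> {a, b, c, d, e, f}" by auto
      then show False using cyc6_two_apex(3)[OF h x] by blast
    qed
    have nef: "\<not> tr (e, f)"
    proof
      assume "tr (e, f)"
      from ap[OF this m(4,5,6) h5] obtain y where "apex y e f" "y \<notin> {a, b, c, d, e, f}" by auto
      then show False using cyc6_two_apex(2)[OF h5, of y x] x by auto
    qed
    have nfa: "\<not> tr (f, a)"
    proof
      assume "tr (f, a)"
      from ap[OF this m(5,6,1) h6] obtain y where "apex y f a" "y \<notin> {a, b, c, d, e, f}" by auto
      then show False using cyc6_two_apex(1)[OF h6, of y x] x by auto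
    qed
    note nt = nbc ncd nde nef nfa
    have g: "give S c \<le> (if three c then 5 else 0)"
       "give S d \<le> (if three d then 5 else 0)" "give S e \<le> (if three e then 5 else 0)" "give S f \<le> (if three f then 5 else 0)"
      using gN sc(3) sd(3) se(3) sf(3) nt by blast+
    have nN: "\<not> clsN a" "\<not> clsN b" using sa(2) sb(2) True by blast+
    have ga: "give S a = (if three a then if clsA a then if has5 a then 6 else 3 else if has5 a then 10 else 6 else 0)"
      using gv(1)[of a] gv(3)[of a] nN(1) by simp
    have gb: "give S b = (if three b then if clsA b then if has5 b then 6 else 3 else if has5 b then 10 else 6 else 0)"
      using gv(1)[of b] gv(3)[of b] nN(2) by simp
    have Ba: "three a \<and> \<not> clsA a \<longrightarrow> clsB a" "three b \<and> \<not> clsA b \<longrightarrow> clsB b"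
      using sa(2) sb(2) True by (auto simp: clsB_def clsN_def)
    have "(if three a then if clsA a then if has5 a then 6 else 3 else if has5 a then 10 else 6 else 0)
      + (if three b then if clsA b then if has5 b then 6 else 3 else if has5 b then 10 else 6 else 0)
      + (if three c then 5 else 0) + (if three d then 5 else 0) + (if three e then 5 else 0) + (if three f then 5 else 0) \<le> (20::int)"
    proof (rule hexagon_bool)
      show "three a \<and> \<not> clsA a \<longrightarrow> \<not> three b \<and> \<not> three c"
        using clsB_next[OF _ S(1) True m(1,2)] Ba by (auto simp: four_def three_def)
      show "three b \<and> \<not> clsA b \<longrightarrow> \<not> three a \<and> \<not> three f"
        using clsB_prev[OF _ S(1) True m(1,6)] Ba by (auto simp: four_def three_def)
      show "has5 a \<and> three a \<longrightarrow> \<not> three d" "has5 b \<and> three b \<longrightarrow> \<not> three e"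
        using face6_opposite[OF S l Se True] by blast+
    qed (use sa(5) sb(5) sc(5) sd(5) se(5) sf(5) in blast)+
    then have "(\<Sum>x\<in>S. give S (fst x)) \<le> 20" unfolding gs ga gb using g by linarith
    moreover have "(\<Sum>x\<in>S. toll x) \<le> 4" unfolding ts using nt toll_not_tr toll_le[of "(a, b)"] by simp
    ultimately show ?thesis by (simp add: load_def)
  qed
qed

text \<open>A triangle across a side would give an 8-cycle. Hence there are no tolls, all vertices
  of degree 3 are of class N, and 7 * 5 = 35 stays below 36.\<close>

lemma load_7:
  assumes S: "S \<in> F" "card S = 7" "\<not> bad S"
  shows "load S \<le> 36"
proof -
  have c3: "card S \<noteq> 3" and c5: "card S \<noteq> 5" using S by auto
  have nt: "\<not> tr x" if "x \<in> S" for x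
  proof
    assume tr: "tr x"
    obtain a b where x: "x = (a, b)" by (cases x)
    have ab: "(a, b) \<in> S" using that x by simp
    obtain c d e f g where l: "distinct [a, b, c, d, e, f, g]"
      and Se: "S = {(a, b), (b, c), (c, d), (d, e), (e, f), (f, g), (g, a)}"
      using face7[OF S(1,2) ab] .
    have h: "cyc [a, b, c, d, e, f, g]" using l Se faceD(1)[OF S(1)] unfolding cyc7 by auto
    have "(g, a) \<in> S" "(b, c) \<in> S" using Se by auto
    then obtain y where "apex y a b" "y \<noteq> c" "y \<noteq> g"
      using tr_apex[OF S(1) _ ab, of g c] tr S(3) x by auto
    then show False using cyc7_apex[OF h] by blast
  qed
  have "give S (fst x) \<le> 5" if x: "x \<in> S" for x
  proof -
    obtain u w where uw: "x = (u, w)" by (cases x)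
    obtain t where t: "(t, u) \<in> S" using face_next(2)[OF S(1)] x uw by blast
    have "three u \<Longrightarrow> clsN u"
      using three_sides(2)[OF _ S(1) c3 t] x uw nt t by (auto simp: clsN_def)
    then show ?thesis using give_other(1,2)[OF c3 c5, of u] uw by fastforce
  qed
  then have "(\<Sum>x\<in>S. give S (fst x)) \<le> (\<Sum>x\<in>S. 5)" by (rule sum_mono)
  moreover have "(\<Sum>x\<in>S. toll x) = 0" using nt toll_not_tr by simp
  ultimately show ?thesis using S by (simp add: load_def)
qed

end

section \<open>Faces of length at least 9\<close>

text \<open>In \<open>cyclic_count\<close>, \<open>s\<close>, \<open>b\<close>, \<open>z\<close>,
  \<open>v\<close> are the sizes of \<open>T\<close>, of \<open>Bc\<close>, of the complement of
  \<open>T\<close> and of the set of shared vertices \<open>q\<close>; the conclusion is the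
  required bound divided by 4. It is tight for \<open>s = 6\<close>, \<open>b = 0\<close>,
  \<open>z = 3\<close>, \<open>v = 0\<close>, a face of length 9.\<close>

lemma large_face_arith:
  fixes s b z v :: nat
  assumes "s + 2 * b \<le> 2 * z" "2 * b \<le> z + v" "9 \<le> s + z" "b \<le> s"
  shows "b + 12 \<le> s + 2 * z + v"
proof -
  consider "z \<ge> 6" | "z = 5" | "z = 4" | "z \<le> 3" by linarith
  then show ?thesis
  proof cases
    case 2
    then show ?thesis using assms by presburger
  qed (use assms in linarith)+
qed

text \<open>
  Here \<open>T\<close> stands for the vertices of degree 3 along a facial cycle with successor \<open>f\<close> and \<open>Bc\<close> for
  those in a triangle with degrees 3, 4, 4. Each of the latter is followed, on the side \<open>cw\<close> of its
  triangle, by two vertices \<open>y\<close>, \<open>q\<close> of larger degree; only the vertices \<open>q\<close> can be shared.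
\<close>

lemma cyclic_count:
  fixes S T Bc :: "'b set" and f g :: "'b \<Rightarrow> 'b" and cw :: "'b \<Rightarrow> bool" and slack :: "'b \<Rightarrow> int"
  assumes fin: "finite S" and f: "\<And>d. d \<in> S \<Longrightarrow> f d \<in> S \<and> g (f d) = d" and g: "\<And>d. d \<in> S \<Longrightarrow> g d \<in> S \<and> f (g d) = d"
    and TS: "T \<subseteq> S" and BT: "Bc \<subseteq> T"
    and h1: "\<And>d. d \<in> T \<Longrightarrow> f d \<in> T \<Longrightarrow> f (f d) \<notin> T"
    and cwf: "\<And>d. d \<in> Bc \<Longrightarrow> cw d \<Longrightarrow> f d \<notin> T \<and> f (f d) \<notin> T"
    and ccwf: "\<And>d. d \<in> Bc \<Longrightarrow> \<not> cw d \<Longrightarrow> g d \<notin> T \<and> g (g d) \<notin> T"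
    and y: "\<And>d. y d = (if cw d then f d else g d)" and q: "\<And>d. q d = (if cw d then f (f d) else g (g d))"
    and yinj: "inj_on y Bc" and yq: "\<And>d e. d \<in> Bc \<Longrightarrow> e \<in> Bc \<Longrightarrow> y d \<noteq> q e"
    and s0: "\<And>d. d \<in> S \<Longrightarrow> slack d \<ge> 0"
    and s1: "\<And>d. d \<in> T \<Longrightarrow> slack d + slack (g d) \<ge> 4"
    and s2: "\<And>d e. d \<in> Bc \<Longrightarrow> e \<in> Bc \<Longrightarrow> cw d \<Longrightarrow> \<not> cw e \<Longrightarrow> q d = q e \<Longrightarrow> slack (q d) + slack (g (q d)) \<ge> 4"
    and k: "card S \<ge> 9"
  shows "4 * int (card Bc) + 6 * int (card T) + (\<Sum>d\<in>S. 4 - slack d) \<le> 12 * int (card S) - 48"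
proof -
  have finT: "finite T" using finite_subset[OF TS fin] .
  have finB: "finite Bc" using finite_subset[OF BT finT] .
  have inj_f: "inj_on f A" if "A \<subseteq> S" for A using f that by (metis inj_onI subsetD)
  have inj_g: "inj_on g A" if "A \<subseteq> S" for A using g that by (metis inj_onI subsetD)
  have BS: "Bc \<subseteq> S" using TS BT by blast
  let ?Z = "S - T"
  \<comment> \<open>A run of \<open>T\<close> has at most two elements and is followed by an element
    of \<open>R\<close>; \<open>ZZ\<close> collects the elements of the gaps from the second one
    on.\<close>
  define R where "R = {z \<in> ?Z. g z \<in> T}"
  define ZZ where "ZZ = {z \<in> ?Z. g z \<notin> T}"
  have cZ: "card ?Z = card R + card ZZ"
  proof -
    have "?Z = R \<union> ZZ" "R \<inter> ZZ = {}" by (auto simp: R_def ZZ_def)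
    then show ?thesis using fin by (metis card_Un_disjoint finite_Diff finite_Un)
  qed
  have cS: "card S = card T + card ?Z"
    using TS fin by (metis card_Diff_subset card_mono finT le_add_diff_inverse)
  have TR: "card T \<le> 2 * card R"
  proof -
    define T1 where "T1 = {d \<in> T. f d \<notin> T}"
    define T2 where "T2 = {d \<in> T. f d \<in> T}"
    have finR: "finite R" using fin by (simp add: R_def)
    have "f ` T1 \<subseteq> R" using f TS by (auto simp: T1_def R_def)
    moreover have "inj_on f T1" using TS unfolding T1_def by (intro inj_f) auto
    ultimately have 1: "card T1 \<le> card R" using card_inj_on_le finR by blast
    have "f (f d) \<in> R" if "d \<in> T2" for d
      using that f[of d] f[of "f d"] TS h1[of d] by (auto simp: T2_def R_def)
    then have "(\<lambda>d. f (f d)) ` T2 \<subseteq> R" by blast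
    moreover have "inj_on (\<lambda>d. f (f d)) T2"
      using f TS unfolding T2_def by (intro inj_onI) (metis (no_types, lifting) mem_Collect_eq subsetD)
    ultimately have 2: "card T2 \<le> card R" using card_inj_on_le finR by blast
    have "T = T1 \<union> T2" by (auto simp: T1_def T2_def)
    then have "card T \<le> card T1 + card T2" by (metis card_Un_le)
    then show ?thesis using 1 2 by linarith
  qed
  have BZZ: "card Bc \<le> card ZZ"
  proof -
    \<comment> \<open>Of the two gap elements \<open>y\<close> and \<open>q\<close> belonging to
      \<open>d\<close>, one has its predecessor outside \<open>T\<close> as well: \<open>q\<close>
      in the forward direction, \<open>y\<close> in the backward direction.\<close>
    define u where "u = (\<lambda>d. if cw d then f (f d) else g d)"
    have "u d \<in> ZZ" if "d \<in> Bc" for d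
    proof (cases "cw d")
      case True
      then show ?thesis using cwf[OF that] f[of d] f[of "f d"] that BS by (auto simp: u_def ZZ_def)
    next
      case False
      then show ?thesis using ccwf[OF that] g[of d] that BS by (auto simp: u_def ZZ_def)
    qed
    moreover have "inj_on u Bc"
    proof (rule inj_onI)
      fix d e assume de: "d \<in> Bc" "e \<in> Bc" "u d = u e"
      have S: "d \<in> S" "e \<in> S" using de BS by auto
      show "d = e"
      proof (cases "cw d")
        case c: True
        show ?thesis
        proof (cases "cw e")
          case True
          then have "f (f d) = f (f e)" using c de by (simp add: u_def)
          then show ?thesis using f S by metis
        next
          case False
          then have "q d = y e" using c de by (simp add: u_def y q)
          then show ?thesis using yq[OF de(2,1)] by simp
        qed
      next
        case c: False
        show ?thesis
        proof (cases "cw e")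
          case True
          then have "y d = q e" using c de by (simp add: u_def y q)
          then show ?thesis using yq[OF de(1,2)] by simp
        next
          case False
          then have "g d = g e" using c de by (simp add: u_def)
          then show ?thesis using g S by metis
        qed
      qed
    qed
    moreover have "finite ZZ" using fin by (simp add: ZZ_def)
    ultimately show ?thesis using card_inj_on_le[of u Bc ZZ] by blast
  qed
  define C where "C = {d \<in> Bc. cw d}"
  define C' where "C' = {d \<in> Bc. \<not> cw d}"
  \<comment> \<open>A value of \<open>q\<close> is taken at most once from each direction;
    \<open>SV\<close> consists of those taken from both.\<close>
  define SV where "SV = q ` C \<inter> q ` C'"
  have finC: "finite C" "finite C'" using finB by (auto simp: C_def C'_def)
  have qZ: "q ` Bc \<subseteq> ?Z" and yZ: "y ` Bc \<subseteq> ?Z"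
    using cwf ccwf f g BS unfolding y q by (auto simp: subset_iff)
  have iii: "2 * card Bc \<le> card ?Z + card SV"
  proof -
    have ffd: "d = e" if "d \<in> S" "e \<in> S" "f (f d) = f (f e)" for d e using f that by metis
    have ggd: "d = e" if "d \<in> S" "e \<in> S" "g (g d) = g (g e)" for d e using g that by metis
    have i1: "inj_on q C" unfolding C_def q by (rule inj_onI) (use ffd BS in auto)
    have i2: "inj_on q C'" unfolding C'_def q by (rule inj_onI) (use ggd BS in auto)
    have "card (q ` C) + card (q ` C') = card (q ` C \<union> q ` C') + card SV"
      unfolding SV_def using finC by (intro card_Un_Int) auto
    moreover have "card (q ` C) = card C" "card (q ` C') = card C'" using i1 i2 card_image by blast+
    moreover have "card Bc = card C + card C'"
    proof -
      have "Bc = C \<union> C'" "C \<inter> C' = {}" by (auto simp: C_def C'_def)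
      then show ?thesis using finC card_Un_disjoint by metis
    qed
    moreover have "q ` C \<union> q ` C' = q ` Bc" by (auto simp: C_def C'_def)
    ultimately have a: "card Bc = card (q ` Bc) + card SV" by simp
    have "card (y ` Bc \<union> q ` Bc) \<le> card ?Z" using qZ yZ fin by (intro card_mono) auto
    moreover have "card (y ` Bc \<union> q ` Bc) = card (y ` Bc) + card (q ` Bc)"
      using yq finB by (intro card_Un_disjoint) auto
    moreover have "card (y ` Bc) = card Bc" using yinj card_image by blast
    ultimately show ?thesis using a by linarith
  qed
  have slack: "(\<Sum>d\<in>S. slack d) \<ge> 2 * int (card T) + 4 * int (card SV)"
  proof -
    \<comment> \<open>An element \<open>d\<close> also stands for the dart from \<open>d\<close> to
      \<open>f d\<close>, and \<open>A\<close> holds the darts touching \<open>T\<close>. Each is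
      counted at most twice, from its start and from its end, so slack 4 per element of
      \<open>T\<close> yields 2. The darts on both sides of \<open>SV\<close> lie outside
      \<open>A\<close> and contribute in full.\<close>
    define A where "A = {d \<in> S. d \<in> T \<or> f d \<in> T}"
    have gT: "g ` T \<subseteq> A" using g TS by (auto simp: A_def)
    have TA: "T \<subseteq> A" using TS by (auto simp: A_def)
    have finA: "finite A" using fin by (simp add: A_def)
    have sA: "slack d \<ge> 0" if "d \<in> A" for d using that s0 by (auto simp: A_def)
    have "4 * int (card T) = (\<Sum>d\<in>T. 4)" by simp
    also have "\<dots> \<le> (\<Sum>d\<in>T. slack d + slack (g d))" by (intro sum_mono s1)
    also have "\<dots> = (\<Sum>d\<in>T. slack d) + (\<Sum>d\<in>g ` T. slack d)"
      using inj_g[OF TS] by (simp add: sum.distrib sum.reindex)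
    also have "(\<Sum>d\<in>T. slack d) \<le> (\<Sum>d\<in>A. slack d)" using TA finA sA by (intro sum_mono2) auto
    also have "(\<Sum>d\<in>g ` T. slack d) \<le> (\<Sum>d\<in>A. slack d)" using gT finA sA by (intro sum_mono2) auto
    finally have a: "2 * int (card T) \<le> (\<Sum>d\<in>A. slack d)" by linarith
    have SVq: "\<exists>d\<in>Bc. \<exists>e\<in>Bc. cw d \<and> \<not> cw e \<and> z = q d \<and> z = q e" if "z \<in> SV" for z
      using that by (auto simp: SV_def C_def C'_def)
    have SVZ: "SV \<subseteq> ?Z" using qZ by (auto simp: SV_def C_def)
    have SVs: "slack z + slack (g z) \<ge> 4" if "z \<in> SV" for z using SVq[OF that] s2 by blast
    have gz: "g z \<in> y ` Bc" "f z \<in> y ` Bc" if z: "z \<in> SV" for z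
    proof -
      obtain d e where de: "d \<in> Bc" "e \<in> Bc" "cw d" "\<not> cw e" "z = q d" "z = q e" using SVq[OF z] by blast
      have "g z = y d" using de f[of "f d"] f[of d] BS by (auto simp: q y)
      then show "g z \<in> y ` Bc" using de by blast
      have "f z = y e" using de g[of "g e"] g[of e] BS by (auto simp: q y)
      then show "f z \<in> y ` Bc" using de by blast
    qed
    have "4 * int (card SV) = (\<Sum>d\<in>SV. 4)" by simp
    also have "\<dots> \<le> (\<Sum>d\<in>SV. slack d + slack (g d))" by (intro sum_mono SVs)
    also have "\<dots> = (\<Sum>d\<in>SV. slack d) + (\<Sum>d\<in>g ` SV. slack d)"
      using inj_g[of SV] SVZ by (subst sum.reindex) (auto simp: sum.distrib)
    also have "\<dots> = (\<Sum>d\<in>SV \<union> g ` SV. slack d)"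
    proof (rule sum.union_disjoint[symmetric])
      show "SV \<inter> g ` SV = {}"
      proof -
        have False if zz: "z \<in> SV" "z \<in> g ` SV" for z
        proof -
          obtain d where "d \<in> Bc" "z = q d" using SVq[OF zz(1)] by blast
          moreover obtain z' where "z' \<in> SV" "z = g z'" using zz by blast
          then obtain e where "e \<in> Bc" "z = y e" using gz(1) by blast
          ultimately show False using yq by metis
        qed
        then show ?thesis by blast
      qed
      show "finite SV" using SVZ fin by (auto intro: finite_subset)
      then show "finite (g ` SV)" by simp
    qed
    also have "\<dots> \<le> (\<Sum>d\<in>S - A. slack d)"
    proof (rule sum_mono2)
      show "SV \<union> g ` SV \<subseteq> S - A"
      proof -
        have "z \<in> S - A" "g z \<in> S - A" if z: "z \<in> SV" for z
        proof -
          have zZ: "z \<in> ?Z" using SVZ z by blast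
          have "f z \<notin> T" "g z \<notin> T" using gz[OF z] yZ by auto
          then show "z \<in> S - A" "g z \<in> S - A" using zZ g[of z] by (auto simp: A_def)
        qed
        then show ?thesis by blast
      qed
    qed (use fin s0 in auto)
    finally have b: "4 * int (card SV) \<le> (\<Sum>d\<in>S - A. slack d)" .
    have "(\<Sum>d\<in>S. slack d) = (\<Sum>d\<in>S - A. slack d) + (\<Sum>d\<in>A. slack d)"
      using fin by (intro sum.subset_diff) (auto simp: A_def)
    then show ?thesis using a b by linarith
  qed
  have "card T + 2 * card Bc \<le> 2 * card ?Z" using TR BZZ cZ by linarith
  then have "card Bc + 12 \<le> card T + 2 * card ?Z + card SV"
    using large_face_arith iii k cS card_mono[OF finT BT] by simp
  moreover have "(\<Sum>d\<in>S. 4 - slack d) = 4 * int (card S) - (\<Sum>d\<in>S. slack d)"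
    by (simp add: sum_subtractf)
  ultimately show ?thesis using slack cS by linarith
qed

context plane_block
begin

text \<open>By \<open>tri344_other_3\<close> a vertex of degree 3 next to \<open>a\<close> must be
  \<open>v\<close>; but if \<open>q\<close> were adjacent to both \<open>v\<close> and
  \<open>a\<close>, it would close a 4-cycle with \<open>u\<close>.\<close>

lemma tri_near_344:
  assumes T: "T \<in> TF q" and v: "tri344 v u a" "a \<in> dart_verts T" "a \<noteq> q" "\<not> three a"
    and q: "\<not> three q" "deg q \<noteq> 4"
  shows "n3 T = 0"
proof -
  note n = tri344_facts[OF v(1)]
  obtain c1 c2 where c: "distinct [q, c1, c2]" "dart_verts T = {q, c1, c2}" "(c1, c2) \<in> D" "(c2, c1) \<in> D"
     "(q, c1) \<in> D" "(c1, q) \<in> D" "(q, c2) \<in> D" "(c2, q) \<in> D"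
    using tri_face_verts[OF T] by metis
  have no: "\<not> three o'" if o: "(a, o') \<in> D" "(q, o') \<in> D" "(a, q) \<in> D" for o'
  proof
    assume o3: "three o'"
    then have "o' = v" using tri344_other_3[OF v(1), of o'] o by (auto simp: three_def)
    then have "q = u \<or> v = a" using no4[OF _ n(4,6) o(3)] o(2) by blast
    then show False using n q(2) by auto
  qed
  have "a = c1 \<or> a = c2" using c(2) v(2,3) by auto
  then have "\<not> three c1 \<and> \<not> three c2"
    using no[of c1] no[of c2] c v(4) by auto
  then have "{w \<in> dart_verts T. three w} = {}" using c(2) q(1) by auto
  then show ?thesis by (simp only: n3_def card.empty)
qed

text \<open>By \<open>tri344_common_4\<close> the shared vertex \<open>q\<close> is big. Triangles
  across both sides contain no vertex of degree 3, and \<open>q\<close> pays 6 to each: at degree 5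
  it has no room for a third triangle that could engage it. So both triangles are generous and cost
  2 instead of 4.\<close>

lemma gap_saving:
  assumes S: "S \<in> F" "(a, q) \<in> S" "(q, b) \<in> S"
    and t: "tri344 v x a" "tri344 v' x' b" "v \<noteq> v'"
    and n: "\<not> three q" "\<not> three a" "\<not> three b"
  shows "toll (a, q) + toll (q, b) \<le> 4"
proof -
  have D: "(a, q) \<in> D" "(q, b) \<in> D" using faceD(1)[OF S(1)] S by auto
  have ne: "a \<noteq> q" "b \<noteq> q" using edge_neq D by blast+
  have q4: "deg q \<noteq> 4" using tri344_common_4[OF t _ D] by blast
  have qB: "q \<in> B" using faceD(2)[OF S(1,3)] .
  then have big: "big q" using n q4 by (simp add: big_def four_def)
  show ?thesis
  proof (cases "tr (a, q) \<and> tr (q, b)")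
    case False
    then have "toll (a, q) = 0 \<or> toll (q, b) = 0" using toll_not_tr by blast
    then show ?thesis using toll_le[of "(a, q)"] toll_le[of "(q, b)"] by linarith
  next
    case True
    then obtain T1 T2 where T: "T1 \<in> F" "card T1 = 3" "(q, a) \<in> T1" "T2 \<in> F" "card T2 = 3" "(b, q) \<in> T2"
      by (auto simp: tr_def)
    have TF: "T1 \<in> TF q" "T2 \<in> TF q"
      using T dart_vertsI(1)[OF T(3)] dart_vertsI(2)[OF T(6)] by (simp_all add: TF_def)
    have aT: "a \<in> dart_verts T1" "b \<in> dart_verts T2" using T dart_vertsI by metis+
    have n1: "n3 T1 = 0" by (rule tri_near_344[OF TF(1) t(1) aT(1) ne(1) n(2,1) q4])
    have n2: "n3 T2 = 0" by (rule tri_near_344[OF TF(2) t(2) aT(2) ne(2) n(3,1) q4])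
    have neng: "\<not> (q \<noteq> X \<and> deg q = 5 \<and> engaged q)"
    proof
      assume e: "q \<noteq> X \<and> deg q = 5 \<and> engaged q"
      then obtain T3 where T3: "T3 \<in> TF q" "n3 T3 = 2" unfolding engaged_def by blast
      have "T1 \<noteq> T2"
      proof
        assume eqT: "T1 = T2"
        obtain w where w: "T1 = {(q, a), (a, w), (w, q)}" using face3[OF T(1-3)] by metis
        then have m: "(w, q) \<in> T1" "(a, w) \<in> T1" by auto
        have "(b, q) \<in> T1" using T(6) eqT by simp
        then have "b = w" using face_snd[OF T(1)] m(1) by blast
        then have "(a, b) \<in> D" using faceD(1)[OF T(1) m(2)] by simp
        then show False using tri344_adjacent[OF t] by blast
      qed
      moreover have "T1 \<noteq> T3" "T2 \<noteq> T3" using n1 n2 T3 by auto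
      ultimately have "length [T1, T2, T3] \<le> card (TF q)" using TF T3 by (intro card_ge_list) auto
      then show False using TF_count[of q] degB_eq[OF qB] e by simp
    qed
    then have gq: "gv q T1 = 6" "gv q T2 = 6" using n1 n2 by (auto simp: gv_def)
    have "q \<in> dart_verts T1" "q \<in> dart_verts T2" using TF by (auto simp: TF_def)
    then have "generous T1" "generous T2" using n1 n2 big gq unfolding generous_def by blast+
    then have "toll (a, q) = 2" "toll (q, b) = 2" using T unfolding toll_def by auto
    then show ?thesis by simp
  qed
qed

lemma load_9:
  assumes S: "S \<in> F" "card S \<ge> 9"
  shows "load S \<le> 12 * (int (card S) - 4)"
proof -
  have c3: "card S \<noteq> 3" and c5: "card S \<noteq> 5" using S by auto
  have "\<exists>f. \<forall>d\<in>S. f d \<in> S \<and> fst (f d) = snd d"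
    by (rule bchoice) (use face_next(1)[OF S(1)] in force)
  then obtain f where f0: "\<And>d. d \<in> S \<Longrightarrow> f d \<in> S \<and> fst (f d) = snd d" by blast
  have "\<exists>g. \<forall>d\<in>S. g d \<in> S \<and> snd (g d) = fst d"
    by (rule bchoice) (use face_next(2)[OF S(1)] in force)
  then obtain g where g0: "\<And>d. d \<in> S \<Longrightarrow> g d \<in> S \<and> snd (g d) = fst d" by blast
  have feq: "d = e" if "d \<in> S" "e \<in> S" "fst d = fst e" for d e
    using face_fst[OF S(1)] that by (metis prod.collapse)
  have seq: "d = e" if "d \<in> S" "e \<in> S" "snd d = snd e" for d e
    using face_snd[OF S(1)] that by (metis prod.collapse)
  have f: "f d \<in> S \<and> g (f d) = d" if "d \<in> S" for d
    using f0[OF that] g0[of "f d"] seq[of "g (f d)" d] that by simp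
  have g: "g d \<in> S \<and> f (g d) = d" if "d \<in> S" for d
    using g0[OF that] f0[of "g d"] feq[of "f (g d)" d] that by simp
  have nx: "(fst d, fst (f d)) \<in> S" "(fst (f d), fst (f (f d))) \<in> S" if "d \<in> S" for d
    using f0[OF that] f0[of "f d"] that by (metis prod.collapse)+
  have pv: "(fst (g d), fst d) \<in> S" "(fst (g (g d)), fst (g d)) \<in> S" if "d \<in> S" for d
    using g0[OF that] g0[of "g d"] that by (metis prod.collapse)+
  have dp: "d = (fst d, fst (f d))" "g d = (fst (g d), fst d)" if "d \<in> S" for d
    using f0[OF that] g0[OF that] by (metis prod.collapse)+
  define T where "T = {d \<in> S. three (fst d)}"
  define Bc where "Bc = {d \<in> S. clsB (fst d)}"
  define y where "y = (\<lambda>d. if tr d then f d else g d)"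
  define q where "q = (\<lambda>d. if tr d then f (f d) else g (g d))"
  have BcS: "d \<in> S" "clsB (fst d)" "three (fst d)" if "d \<in> Bc" for d using that by (auto simp: Bc_def clsB_def)
  have trp: "tr (fst (g d), fst d)" if "d \<in> Bc" "\<not> tr d" for d
    using three_sides(2)[OF BcS(3)[OF that(1)] S(1) c3 pv(1) nx(1)] BcS[OF that(1)] that(2) dp(1)[of d] by (auto simp: clsB_def)
  have trn: "tr (fst d, fst (f d))" if "d \<in> Bc" "tr d" for d using that dp(1) BcS by metis
  have yt: "\<exists>x. tri344 (fst d) x (fst (y d))" "y d \<in> S" "q d \<in> S" "\<not> three (fst (y d))" "\<not> three (fst (q d))"
    "(fst (y d), fst (q d)) \<in> D" "y d \<noteq> q d" if d: "d \<in> Bc" for d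
  proof -
    note B = BcS[OF d]
    have "(\<exists>x. tri344 (fst d) x (fst (y d))) \<and> y d \<in> S \<and> q d \<in> S \<and> \<not> three (fst (y d)) \<and> \<not> three (fst (q d)) \<and>
      (fst (y d), fst (q d)) \<in> D"
    proof (cases "tr d")
      case True
      then show ?thesis
        using clsB_next[OF B(2) S(1) trn[OF d True] nx[OF B(1)]] f[OF B(1)] f[of "f d"] faceD(1)[OF S(1) nx(2)[OF B(1)]]
        by (auto simp: y_def q_def four_def three_def)
    next
      case False
      then show ?thesis
        using clsB_prev[OF B(2) S(1) trp[OF d False] pv[OF B(1)]] g[OF B(1)] g[of "g d"] face_D_rev[OF S(1) pv(2)[OF B(1)]]
        by (auto simp: y_def q_def four_def three_def)
    qed
    then show "\<exists>x. tri344 (fst d) x (fst (y d))" "y d \<in> S" "q d \<in> S" "\<not> three (fst (y d))" "\<not> three (fst (q d))"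
      "(fst (y d), fst (q d)) \<in> D" "y d \<noteq> q d" using D_irrefl by auto
  qed
  have yy: "fst (y d) \<noteq> fst (y e)" "(fst (y d), fst (y e)) \<notin> D" if de: "d \<in> Bc" "e \<in> Bc" "d \<noteq> e" for d e
  proof -
    obtain x x' where t: "tri344 (fst d) x (fst (y d))" "tri344 (fst e) x' (fst (y e))" using yt(1) de by meson
    have ne: "fst d \<noteq> fst e" using feq BcS de by blast
    show "fst (y d) \<noteq> fst (y e)" using tri344_distinct(1)[OF t ne] by auto
    show "(fst (y d), fst (y e)) \<notin> D" using tri344_adjacent[OF t ne] by blast
  qed
  have main: "4 * int (card Bc) + 6 * int (card T) + (\<Sum>d\<in>S. 4 - (4 - toll d)) \<le> 12 * int (card S) - 48"
  proof (rule cyclic_count[where f = f and g = g and cw = tr and y = y and q = q])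
    show "finite S" using face_finite[OF S(1)] .
    show "T \<subseteq> S" "Bc \<subseteq> T" by (auto simp: T_def Bc_def clsB_def)
    show "f (f d) \<notin> T" if "d \<in> T" "f d \<in> T" for d
    proof
      assume "f (f d) \<in> T"
      then have "three (fst d)" "three (fst (f d))" "three (fst (f (f d)))" "d \<in> S" using that by (auto simp: T_def)
      moreover have "fst d \<noteq> fst (f (f d))" using face_asym[OF S(1) nx(1)] nx(2) \<open>d \<in> S\<close> by metis
      ultimately show False
        using no_3_path[of "fst d" "fst (f d)" "fst (f (f d))"] faceD(1)[OF S(1) nx(1)] faceD(1)[OF S(1) nx(2)]
        by (auto simp: three_def)
    qed
    show "f d \<notin> T \<and> f (f d) \<notin> T" if "d \<in> Bc" "tr d" for d
      using yt(4,5)[OF that(1)] that(2) by (auto simp: T_def y_def q_def)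
    show "g d \<notin> T \<and> g (g d) \<notin> T" if "d \<in> Bc" "\<not> tr d" for d
      using yt(4,5)[OF that(1)] that(2) by (auto simp: T_def y_def q_def)
    show "inj_on y Bc" using yy(1) by (metis inj_onI)
    show "y d \<noteq> q e" if "d \<in> Bc" "e \<in> Bc" for d e
    proof
      assume eq: "y d = q e"
      then have "d \<noteq> e" using yt(7) that by metis
      then show False using yy(2)[of e d] yt(6)[OF that(2)] that eq by metis
    qed
    show "0 \<le> 4 - toll d" for d using toll_le[of d] by simp
    show "4 \<le> 4 - toll d + (4 - toll (g d))" if "d \<in> T" for d
    proof -
      have d: "d \<in> S" "three (fst d)" using that by (auto simp: T_def)
      have "\<not> (tr (g d) \<and> tr d)"
        using three_sides(1)[OF d(2) S(1) c3 pv(1)[OF d(1)] nx(1)[OF d(1)]] dp[OF d(1)] by auto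
      then have "toll d = 0 \<or> toll (g d) = 0" using toll_not_tr by blast
      then show ?thesis using toll_le[of d] toll_le[of "g d"] by linarith
    qed
    show "4 \<le> 4 - toll (q d) + (4 - toll (g (q d)))"
      if de: "d \<in> Bc" "e \<in> Bc" "tr d" "\<not> tr e" "q d = q e" for d e
    proof -
      have ne: "fst d \<noteq> fst e" using feq BcS de by blast
      obtain x x' where t: "tri344 (fst d) x (fst (y d))" "tri344 (fst e) x' (fst (y e))" using yt(1) de by meson
      have gz: "g (q d) = y d" using de f[of "f d"] f[of d] BcS(1)[OF de(1)] by (simp add: q_def y_def)
      have fz: "f (q e) = y e" using de g[of "g e"] g[of e] BcS(1)[OF de(2)] by (simp add: q_def y_def)
      have zS: "q d \<in> S" using yt(3) de by blast
      have z: "q d = (fst (q d), fst (y e))" "g (q d) = (fst (y d), fst (q d))"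
        using dp[OF zS] gz fz de(5) by simp_all
      have m: "(fst (y d), fst (q d)) \<in> S" "(fst (q d), fst (y e)) \<in> S"
        using z zS g[OF zS] by metis+
      have "toll (fst (y d), fst (q d)) + toll (fst (q d), fst (y e)) \<le> 4"
        by (rule gap_saving[OF S(1) m t ne yt(5)[OF de(1)] yt(4)[OF de(1)] yt(4)[OF de(2)]])
      then show ?thesis
        using arg_cong[OF z(1), of toll] arg_cong[OF z(2), of toll] by linarith
    qed
  qed (use f g S in \<open>auto simp: y_def q_def\<close>)
  have "(\<Sum>d\<in>S. give S (fst d)) \<le> (\<Sum>d\<in>S. (if d \<in> Bc then 4 else 0) + (if d \<in> T then 6 else 0))"
  proof (rule sum_mono)
    fix d assume "d \<in> S"
    then show "give S (fst d) \<le> (if d \<in> Bc then 4 else 0) + (if d \<in> T then 6 else 0)"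
      using give_other(1,4,5)[OF c3 c5, of "fst d"] by (auto simp: T_def Bc_def clsB_def)
  qed
  also have "\<dots> = 4 * int (card Bc) + 6 * int (card T)"
  proof -
    have "Bc \<subseteq> S" "T \<subseteq> S" by (auto simp: Bc_def T_def)
    then show ?thesis using face_finite[OF S(1)]
      by (simp add: sum.distrib sum.If_cases Int_absorb1)
  qed
  finally show ?thesis using main by (simp add: load_def)
qed

end

section \<open>Total charge\<close>

context plane_block
begin

lemma chf_nontri: "card S \<noteq> 3 \<Longrightarrow> chf S = 12 * (int (card S) - 4) - load S"
  by (simp add: chf_def gain_def)

lemma face_size_cases:
  assumes "S \<in> F"
  obtains "card S = 3" | "card S = 5" | "card S = 6" | "card S = 7" | "card S \<ge> 9"
  using face_card3[OF assms] face_not_4_8[OF assms] by linarith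

lemma chf_good:
  assumes S: "S \<in> F" and g: "\<not> bad S \<or> card S = 3 \<or> card S = 5 \<or> card S \<ge> 9"
  shows "chf S \<ge> 0"
  using S
proof (cases rule: face_size_cases)
  case 1
  then show ?thesis using chf_tri S by blast
next
  case 2
  then show ?thesis using load_5[OF S] chf_nontri[of S] by simp
next
  case 3
  then show ?thesis using load_6[OF S] g chf_nontri[of S] by simp
next
  case 4
  then show ?thesis using load_7[OF S] g chf_nontri[of S] by simp
next
  case 5
  then show ?thesis using load_9[OF S] chf_nontri[of S] by simp
qed

lemma no_three_consecutive:
  assumes "S \<in> F" "(a, b) \<in> S" "(b, c) \<in> S"
  shows "\<not> (three a \<and> three b \<and> three c)"
proof -
  have "a \<noteq> c" using face_asym[OF assms(1,2)] assms(3) by auto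
  then show ?thesis using no_3_path[of a b c] faceD(1)[OF assms(1)] assms(2,3) by (auto simp: three_def)
qed

text \<open>Crude bounds that avoid the overlap arguments: at most four vertices besides
  \<open>X\<close> receive up to 10 and every side costs up to 4, which gives 24 - 40 - 24 for a
  hexagon and 36 - 40 - 28 for a heptagon. Without a triangle at \<open>X\<close> the two sides
  there are free, saving 8 on the hexagon.\<close>

lemma chf_at_X:
  assumes S: "S \<in> F" "X \<in> dart_verts S"
  shows "chf S \<ge> - 40" "TF X = {} \<Longrightarrow> chf S \<ge> - 32"
proof -
  have nX: "\<not> three X" by (simp add: three_def)
  obtain b where Xb: "(X, b) \<in> S" using face_vert[OF S] by blast
  have ntr: "\<not> tr (X, v)" "\<not> tr (v, X)" if "TF X = {}" for v
    using that dart_vertsI unfolding tr_def TF_def by fastforce+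
  have tk: "toll d \<le> 4" "toll d \<ge> 0" for d by (rule toll_le, rule toll_nonneg)
  have "chf S \<ge> - 40 \<and> (TF X = {} \<longrightarrow> chf S \<ge> - 32)"
    using S(1)
  proof (cases rule: face_size_cases)
    case 3
    have c3: "card S \<noteq> 3" "card S \<noteq> 5" using 3 by auto
    obtain c d e f where l: "distinct [X, b, c, d, e, f]" and Se: "S = {(X, b), (b, c), (c, d), (d, e), (e, f), (f, X)}"
      using face6[OF S(1) 3 Xb] .
    have m: "(b, c) \<in> S" "(c, d) \<in> S" "(d, e) \<in> S" "(e, f) \<in> S" using Se by auto
    have gs: "(\<Sum>x\<in>S. give S (fst x)) = give S X + give S b + give S c + give S d + give S e + give S f"
      using sum_cycle6[OF l, of "\<lambda>x. give S (fst x)"] unfolding Se[symmetric] by simp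
    have ts: "(\<Sum>x\<in>S. toll x) = toll (X, b) + toll (b, c) + toll (c, d) + toll (d, e) + toll (e, f) + toll (f, X)"
      using sum_cycle6[OF l, of toll] unfolding Se[symmetric] .
    have "give S b + give S c + give S d \<le> 20 \<and> (give S d = 0 \<or> give S e = 0 \<or> give S f = 0) \<and> (give S b = 0 \<or> give S c = 0 \<or> give S d = 0)"
      using no_three_consecutive[OF S(1) m(1,2)] no_three_consecutive[OF S(1) m(3,4)] give_other(1,4)[OF c3]
      by (smt (verit, best))
    then have "(\<Sum>x\<in>S. give S (fst x)) \<le> 40"
      unfolding gs using give_other(1)[OF c3 nX] give_other(4)[OF c3] by (smt (verit, best))
    moreover have "(\<Sum>x\<in>S. toll x) \<le> 24"
      unfolding ts using tk(1)[of "(X, b)"] tk(1)[of "(b, c)"] tk(1)[of "(c, d)"] tk(1)[of "(d, e)"] tk(1)[of "(e, f)"] tk(1)[of "(f, X)"]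
      by linarith
    moreover have "(\<Sum>x\<in>S. toll x) \<le> 16" if "TF X = {}"
      unfolding ts using tk(1)[of "(b, c)"] tk(1)[of "(c, d)"] tk(1)[of "(d, e)"] tk(1)[of "(e, f)"]
        toll_not_tr[OF ntr(1)[OF that, of b]] toll_not_tr[OF ntr(2)[OF that, of f]] by linarith
    ultimately show ?thesis using chf_nontri[OF c3(1)] 3 by (auto simp: load_def)
  next
    case 4
    have c3: "card S \<noteq> 3" "card S \<noteq> 5" using 4 by auto
    obtain c d e f g where l: "distinct [X, b, c, d, e, f, g]"
      and Se: "S = {(X, b), (b, c), (c, d), (d, e), (e, f), (f, g), (g, X)}"
      using face7[OF S(1) 4 Xb] .
    have m: "(b, c) \<in> S" "(c, d) \<in> S" "(e, f) \<in> S" "(f, g) \<in> S" using Se by auto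
    have sum7: "(\<Sum>x\<in>S. h x) = h (X, b) + h (b, c) + h (c, d) + h (d, e) + h (e, f) + h (f, g) + h (g, X)"
      for h :: "'a \<times> 'a \<Rightarrow> int"
      unfolding Se using l by simp
    have gs: "(\<Sum>x\<in>S. give S (fst x)) = give S X + give S b + give S c + give S d + give S e + give S f + give S g"
      using sum7[of "\<lambda>x. give S (fst x)"] by simp
    have "(give S b = 0 \<or> give S c = 0 \<or> give S d = 0) \<and> (give S e = 0 \<or> give S f = 0 \<or> give S g = 0)"
      using no_three_consecutive[OF S(1) m(1,2)] no_three_consecutive[OF S(1) m(3,4)] give_other(1)[OF c3]
      by blast
    then have "(\<Sum>x\<in>S. give S (fst x)) \<le> 40"
      unfolding gs using give_other(1)[OF c3 nX] give_other(4)[OF c3, of b] give_other(4)[OF c3, of c] give_other(4)[OF c3, of d]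
        give_other(4)[OF c3, of e] give_other(4)[OF c3, of f] give_other(4)[OF c3, of g] by linarith
    moreover have "(\<Sum>x\<in>S. toll x) \<le> 28"
      unfolding sum7 using tk(1)[of "(X, b)"] tk(1)[of "(b, c)"] tk(1)[of "(c, d)"] tk(1)[of "(d, e)"] tk(1)[of "(e, f)"] tk(1)[of "(f, g)"]
        tk(1)[of "(g, X)"] by linarith
    ultimately show ?thesis using chf_nontri[OF c3(1)] 4 by (simp add: load_def)
  qed (use chf_good[OF S(1)] in auto)
  then show "chf S \<ge> - 40" "TF X = {} \<Longrightarrow> chf S \<ge> - 32" by auto
qed

lemma card_faces_X: "card {S \<in> F. X \<in> dart_verts S} \<le> degB X"
proof -
  let ?FX = "{S \<in> F. X \<in> dart_verts S}"
  define N :: "('a \<times> 'a) set \<Rightarrow> 'a set" where "N = (\<lambda>S. {w. (X, w) \<in> S})"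
  have N: "finite (N S) \<and> N S \<noteq> {} \<and> N S \<subseteq> E `` {X}" if "S \<in> ?FX" for S
  proof -
    have S: "S \<in> F" "X \<in> dart_verts S" using that by auto
    obtain b where b: "(X, b) \<in> S" using face_vert[OF S] by blast
    have sub: "N S \<subseteq> E `` {X}" using face_sub[OF S(1)] by (auto simp: N_def)
    then have "finite (N S)" using finite_E by (meson finite_Image finite_subset)
    then show ?thesis using sub b by (auto simp: N_def)
  qed
  have "card ?FX = (\<Sum>S\<in>?FX. 1)" by simp
  also have "\<dots> \<le> (\<Sum>S\<in>?FX. card (N S))"
    using N by (intro sum_mono) (simp add: Suc_le_eq card_gt_0_iff)
  also have "\<dots> = card (\<Union>S\<in>?FX. N S)"
  proof (rule card_UN_disjoint[symmetric])
    show "\<forall>S\<in>?FX. \<forall>T\<in>?FX. S \<noteq> T \<longrightarrow> N S \<inter> N T = {}"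
      using F_disj unfolding N_def by blast
  qed (use finite_F N in auto)
  also have "\<dots> \<le> degB X"
    unfolding degB_def using N finite_E by (intro card_mono) auto
  finally show ?thesis .
qed

text \<open>The available deficit stays above -96. If \<open>X\<close> has degree at least 3 in the
  block, no face is bad and only \<open>X\<close> can be negative, by at most 30. If it has degree
  2, then \<open>X\<close> accounts for -24, or -36 with a triangle. Either two pentagons are the
  faces at \<open>X\<close> and at most four vertices lack 12, in total -72; or only the at most two
  faces at \<open>X\<close> are negative, in total -24 - 64 = -88 or, with a triangle, -36 - 40 =
  -76.\<close>

theorem contradiction: False
proof -
  let ?FX = "{S \<in> F. X \<in> dart_verts S}"
  have dX: "degB X \<ge> 2" using X_deg by (simp add: degB_def)
  have finFX: "finite ?FX" using finite_F by simp
  have chX: "chv X \<ge> 12 * (int (degB X) - 4) - 12 * int (card (TF X))" by (rule chv_X)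
  have cls: "v = X \<or> three v \<or> four v \<or> big v" if "v \<in> B" for v using that by (auto simp: big_def)
  define M where "M = {v \<in> B. v \<noteq> X \<and> chv v < 0}"
  have finM: "finite M" using finite_B by (simp add: M_def)
  have M3: "three v" if "v \<in> M" for v
    using that cls[of v] chv_four[of v] chv_big[of v] by (auto simp: M_def)
  have sumV: "(\<Sum>v\<in>B. chv v) \<ge> chv X - 12 * int (card M)"
  proof -
    have "(\<Sum>v\<in>B. chv v) = chv X + (\<Sum>v\<in>B - {X}. chv v)"
      using finite_B X_B by (simp add: sum.remove)
    also have "(\<Sum>v\<in>B - {X}. chv v) \<ge> (\<Sum>v\<in>B - {X}. if v \<in> M then - 12 else 0)"
      using M3 chv_three(1) by (intro sum_mono) (auto simp: M_def)
    moreover have "(\<Sum>v\<in>B - {X}. if v \<in> M then - 12 else 0 :: int) = - 12 * int (card M)"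
    proof -
      have "(B - {X}) \<inter> M = M" by (auto simp: M_def)
      then show ?thesis using finite_B by (simp add: sum.If_cases)
    qed
    ultimately show ?thesis by linarith
  qed
  have bad2: "\<exists>S T. S \<in> F \<and> T \<in> F \<and> S \<noteq> T \<and> card S = 5 \<and> card T = 5 \<and> bad S \<and> bad T \<and> v \<in> dart_verts S \<and> v \<in> dart_verts T"
    if "v \<in> M" for v
  proof (rule ccontr)
    assume n: "\<not> ?thesis"
    have "chv v \<ge> 0"
      using chv_three(2)[OF M3[OF that]] five_five[OF M3[OF that]] n by blast
    then show False using that by (auto simp: M_def)
  qed
  show False
  proof (cases "degB X = 2")
    case False
    then have nb: "\<not> bad S" for S by (auto simp: bad_def)
    then have "M = {}" using bad2 by blast
    moreover have "(\<Sum>S\<in>F. chf S) \<ge> 0" using chf_good nb by (intro sum_nonneg) auto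
    moreover have "2 * int (card (TF X)) \<le> int (degB X)" using TF_count[of X] by linarith
    ultimately show False using total_charge sumV chX dX by simp
  next
    case True
    have FX2: "card ?FX \<le> 2" using card_faces_X True by simp
    have TF1: "card (TF X) \<le> 1" using TF_count[of X] True by simp
    have sumF: "(\<Sum>S\<in>F. chf S) \<ge> (\<Sum>S\<in>?FX. chf S)"
    proof (rule sum_mono2)
      show "0 \<le> chf S" if "S \<in> F - ?FX" for S
        using chf_good[of S] that by (auto simp: bad_def)
    qed (use finite_F in auto)
    show False
    proof (cases "M = {}")
      case False
      then obtain v where v: "v \<in> M" by blast
      obtain S T where ST: "S \<in> F" "T \<in> F" "S \<noteq> T" "card S = 5" "card T = 5" "bad S" "bad T"
        using bad2[OF v] by blast
      then have sub: "{S, T} \<subseteq> ?FX" by (auto simp: bad_def)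
      have FX: "?FX = {S, T}"
        using card_seteq[OF finFX sub] FX2 ST(3) by simp
      have "(\<Sum>S\<in>?FX. chf S) \<ge> 0" unfolding FX using chf_good[OF ST(1)] chf_good[OF ST(2)] ST by simp
      moreover have "TF X = {}"
      proof -
        have "TF X \<subseteq> {S \<in> ?FX. card S = 3}" by (auto simp: TF_def)
        then show ?thesis unfolding FX using ST by auto
      qed
      moreover have "card M \<le> 4"
      proof -
        have "M \<subseteq> dart_verts S - {X}"
        proof
          fix w assume w: "w \<in> M"
          obtain S' T' where "S' \<in> F" "T' \<in> F" "S' \<noteq> T'" "bad S'" "bad T'" "w \<in> dart_verts S'" "w \<in> dart_verts T'"
            using bad2[OF w] by blast
          then have "S' \<in> {S, T}" "T' \<in> {S, T}" unfolding FX[symmetric] by (auto simp: bad_def)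
          then have "w \<in> dart_verts S" using \<open>S' \<noteq> T'\<close> \<open>w \<in> dart_verts S'\<close> \<open>w \<in> dart_verts T'\<close> by auto
          then show "w \<in> dart_verts S - {X}" using w by (auto simp: M_def)
        qed
        moreover have "card (dart_verts S) = 5"
        proof -
          obtain xs where "distinct xs" "3 \<le> length xs" "S = cycle_darts xs" using F_cycle[OF ST(1)] by blast
          then show ?thesis
            using set_cycle_darts[of xs] card_cycle_darts[of xs] ST(4) distinct_card[of xs] by simp
        qed
        moreover have "X \<in> dart_verts S" using ST by (simp add: bad_def)
        ultimately show ?thesis
          using card_mono[of "dart_verts S - {X}" M] finite_dart_verts[OF ST(1)] by simp
      qed
      ultimately show False using total_charge sumV sumF chX True by simp
    next
      case M0: True
      show False
      proof (cases "TF X = {}")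
        case TF0: True
        have "(\<Sum>S\<in>?FX. - 32) \<le> (\<Sum>S\<in>?FX. chf S)"
          using chf_at_X(2) TF0 by (intro sum_mono) auto
        then have "(\<Sum>S\<in>?FX. chf S) \<ge> - 64" using FX2 by simp
        then show False using total_charge sumV sumF chX True M0 TF0 by simp
      next
        case False
        then obtain T where T: "T \<in> TF X" by blast
        then have TX: "T \<in> ?FX" "card T = 3" by (auto simp: TF_def)
        have "(\<Sum>S\<in>?FX. chf S) = chf T + (\<Sum>S\<in>?FX - {T}. chf S)"
          using TX finFX by (simp add: sum.remove)
        moreover have "chf T \<ge> 0" using chf_tri[of T] TX by simp
        moreover have "(\<Sum>S\<in>?FX - {T}. - 40) \<le> (\<Sum>S\<in>?FX - {T}. chf S)"
          using chf_at_X(1) by (intro sum_mono) auto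
        moreover have "card (?FX - {T}) \<le> 1" using FX2 TX finFX by simp
        ultimately have "(\<Sum>S\<in>?FX. chf S) \<ge> - 40" by simp
        then show False using total_charge sumV sumF chX True M0 TF1 by simp
      qed
    qed
  qed
qed

end

section \<open>Minimal uncolourable sets\<close>

fun path_arcs :: "'a list \<Rightarrow> ('a \<times> 'a) list" where
  "path_arcs (x # y # zs) = (x, y) # path_arcs (y # zs)"
| "path_arcs _ = []"

lemma set_path_arcs: "set (path_arcs xs) = path_darts xs"
  by (induction xs rule: path_arcs.induct) auto

lemma length_path_arcs: "length (path_arcs xs) = length xs - 1"
  by (induction xs rule: path_arcs.induct) auto

lemma pcas_path_arcs: "xs \<noteq> [] \<Longrightarrow> pcas (hd xs) (path_arcs xs) (last xs)"
  by (induction xs rule: path_arcs.induct) auto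

lemma pawalk_verts_path_arcs: "xs \<noteq> [] \<Longrightarrow> pawalk_verts (hd xs) (path_arcs xs) = xs"
  by (induction xs rule: path_arcs.induct) auto

lemma has_cycle_of_lengthI:
  assumes G: "pair_graph G" and xs: "distinct xs" "xs \<noteq> []" "cycle_darts xs \<subseteq> parcs G"
  shows "has_cycle_of_length G (length xs)"
proof -
  interpret pair_graph G by (rule G)
  obtain a ys where a: "xs = a # ys" using xs by (cases xs) auto
  let ?p = "path_arcs (xs @ [a])"
  have set: "set ?p \<subseteq> parcs G"
    using xs(3) a by (simp add: set_path_arcs cycle_darts_def)
  have len: "length ?p = length xs" by (simp add: length_path_arcs)
  then have ne: "?p \<noteq> []" using xs(2) by auto
  have "\<exists>b. (a, b) \<in> set ?p" using a by (cases ys) auto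
  then have "a \<in> pverts G" using set in_arcsD1 by blast
  then have "awalk a ?p a"
    using set pcas_path_arcs[of "xs @ [a]"] a by (simp add: awalk_def)
  moreover have "distinct (tl (pawalk_verts a ?p))"
    using pawalk_verts_path_arcs[of "xs @ [a]"] a xs(1) by simp
  ultimately have "cycle ?p" unfolding cycle_def using ne by blast
  then show ?thesis unfolding has_cycle_of_length_def using len by blast
qed

context cover_relation
begin

lemma DP_BA_coloring_of_good:
  assumes l: "good l" "fst ` set l = pverts G" and K: "K = parcs H"
    and L: "\<And>u. u \<in> pverts G \<Longrightarrow> L u = {1..3}" and H: "pverts H = (SIGMA u:pverts G. L u)"
  shows "DP_BA_coloring G L H (set l)"
proof -
  have dist: "distinct l" using good_distinct[OF l(1)] by (simp add: distinct_map)
  let ?r = "{(l ! i, l ! j) | i j. i \<le> j \<and> j < length l}"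
  have app: "appendable p x" if "l = p @ x # s" for p x s using good_split[OF l(1) that] .
  have rng: "c \<in> {1..3} \<and> v \<in> pverts G" if vc: "(v, c) \<in> set l" for v c
  proof -
    obtain p s where "l = p @ (v, c) # s" using vc by (auto simp: in_set_conv_decomp)
    then have "appendable p (v, c)" by (rule app)
    then have "c \<in> {1..3}" by (simp add: appendable_def)
    then show ?thesis using vc l(2) by force
  qed
  have "transversal G L H (set l)"
    unfolding transversal_def
  proof (intro conjI ballI)
    show "set l \<subseteq> pverts H" using rng L H by auto
    fix u assume u: "u \<in> pverts G"
    then obtain c where c: "(u, c) \<in> set l" using l(2) by (metis (no_types, lifting) imageE prod.collapse)
    then have "set l \<inter> {u} \<times> L u = {(u, c)}"
      using rng[OF c] L[OF u] good_inj[OF l(1)] by auto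
    then show "card (set l \<inter> {u} \<times> L u) = 1" by simp
  qed
  moreover have "linear_order_on (set l) ?r" using linear_order_on_list(1)[OF dist] .
  moreover have "(c = 1 \<longrightarrow> left_neighbours H (set l) ?r (v, c) (v, c) = {}) \<and>
           (c \<noteq> 1 \<longrightarrow> card (left_neighbours H (set l) ?r (v, c) (v, c)) \<le> 1 \<and>
              (\<forall>w \<in> left_neighbours H (set l) ?r (v, c) (v, c). card (left_neighbours H (set l) ?r (v, c) w) \<le> 1))"
    if vc: "(v, c) \<in> set l" for v c
  proof -
    obtain p s where p: "l = p @ (v, c) # s" using vc by (auto simp: in_set_conv_decomp)
    have "left_neighbours H (set l) ?r (v, c) w =
        {z \<in> {z \<in> set l. (z, (v, c)) \<in> ?r \<and> z \<noteq> (v, c)}. (w, z) \<in> parcs H}" for w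
      unfolding left_neighbours_def by auto
    then have eq: "left_neighbours H (set l) ?r (v, c) w = nb p w" for w
      unfolding linear_order_on_list(2)[OF dist p] K[symmetric] nb_def .
    show ?thesis unfolding eq using app[OF p] unfolding appendable_def fst_conv snd_conv by blast
  qed
  ultimately show ?thesis unfolding DP_BA_coloring_def by blast
qed

end

lemma cover_imp_cover_relation:
  assumes G: "pair_graph G" and c: "cover G L H"
  shows "cover_relation (parcs G) (parcs H)"
proof -
  interpret pair_graph G by (rule G)
  obtain M where M: "\<And>u v. (u, v) \<in> parcs G \<Longrightarrow> matching_between ({u} \<times> L u) ({v} \<times> L v) (M u v) \<and> M v u = (M u v)\<inverse>"
    and H: "parcs H = (\<Union>(u, v) \<in> parcs G. M u v)"
    using c unfolding cover_def by blast
  have sym: "(v, u) \<in> parcs G" if "(u, v) \<in> parcs G" for u v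
    using that pair_sym_arcs by (auto simp: symmetric_def dest: symD)
  \<comment> \<open>The first components of an arc of the cover determine the edge whose matching
    contains it, so the union over all edges can be undone.\<close>
  have mem: "(u, v) \<in> parcs G \<and> ((u, a), (v, b)) \<in> M u v" if h: "((u, a), (v, b)) \<in> parcs H" for u a v b
  proof -
    obtain u' v' where uv: "(u', v') \<in> parcs G" "((u, a), (v, b)) \<in> M u' v'" using h H by auto
    then have "u' = u" "v' = v" using M[OF uv(1)] unfolding matching_between_def by auto
    then show ?thesis using uv by simp
  qed
  show ?thesis
  proof
    show "(y, x) \<in> parcs H" if h: "(x, y) \<in> parcs H" for x y
    proof -
      obtain u a v b where xy: "x = (u, a)" "y = (v, b)" by (cases x; cases y)
      then have m: "(u, v) \<in> parcs G" "((u, a), (v, b)) \<in> M u v" using mem h by auto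
      then have "((v, b), (u, a)) \<in> M v u" using M by auto
      then show ?thesis using sym[OF m(1)] xy H by auto
    qed
    show "(u, v) \<in> parcs G" if "((u, a), (v, b)) \<in> parcs H" for u a v b using mem[OF that] by simp
    show "a = a'" if h: "((u, a), (v, b)) \<in> parcs H" "((u, a'), (v, b)) \<in> parcs H" for u a v b a'
      using mem[OF h(1)] mem[OF h(2)] M[of u v] unfolding matching_between_def by fastforce
    show "(u, u) \<notin> parcs G" for u using pair_no_loops by fastforce
  qed
qed

context irreducible_graph
begin

text \<open>
  A smallest set all of whose vertices but one have all their neighbours inside is an end block: it
  induces a subgraph without cut vertices.
\<close>

lemma ex_end_block:
  assumes "U \<noteq> {}"
  obtains B X where "B \<subseteq> U" "X \<in> B" "\<And>v w. v \<in> B \<Longrightarrow> v \<noteq> X \<Longrightarrow> (v, w) \<in> D \<Longrightarrow> w \<in> B" "card B \<ge> 3"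
    "no_cut_vertex B (D \<inter> B \<times> B)"
proof -
  define ok where "ok = (\<lambda>B. B \<subseteq> U \<and> card B \<ge> 2 \<and> (\<exists>X\<in>B. \<forall>v\<in>B. \<forall>w. v \<noteq> X \<longrightarrow> (v, w) \<in> D \<longrightarrow> w \<in> B))"
  obtain u0 where u0: "u0 \<in> U" using assms by blast
  have nbr: "\<exists>w. (u, w) \<in> D" if "u \<in> U" for u
  proof -
    have "D `` {u} \<noteq> {}" using deg_ge3[OF that] by (auto simp: deg_def)
    then show ?thesis by blast
  qed
  have two: "card A \<ge> 2" if "u \<in> A" "w \<in> A" "u \<noteq> w" "A \<subseteq> U" for A u w
    using card_ge_list[of "[u, w]" A] that finite_subset[OF that(4) finite_U] by simp
  have "ok U"
    unfolding ok_def using u0 nbr[OF u0] two[of u0 U] edge_U edge_neq by blast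
  then obtain B where B: "ok B" and mn: "\<And>A. ok A \<Longrightarrow> card B \<le> card A"
    using ex_has_least_nat[of ok U card] by blast
  obtain X where BU: "B \<subseteq> U" and B2: "card B \<ge> 2" and X: "X \<in> B"
    and full: "\<And>v w. v \<in> B \<Longrightarrow> v \<noteq> X \<Longrightarrow> (v, w) \<in> D \<Longrightarrow> w \<in> B"
    using B unfolding ok_def by blast
  have finB: "finite B" using finite_subset[OF BU finite_U] .
  have B3: "card B \<ge> 3"
  proof -
    obtain v where v: "v \<in> B" "v \<noteq> X"
      using B2 by (metis card_le_Suc0_iff_eq finB X not_less_eq_eq numeral_2_eq_2)
    then have "D `` {v} \<subseteq> B" using full by blast
    then have "card (D `` {v}) \<le> card B" using finB card_mono by blast
    then show ?thesis using deg_ge3[of v] v BU by (auto simp: deg_def)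
  qed
  have "(u, v) \<in> ((D \<inter> B \<times> B) \<inter> (B - {x}) \<times> (B - {x}))\<^sup>*"
    if uv: "u \<in> B - {x}" "v \<in> B - {x}" for x u v
  proof (rule ccontr)
    let ?R = "(D \<inter> B \<times> B) \<inter> (B - {x}) \<times> (B - {x})"
    assume n: "(u, v) \<notin> ?R\<^sup>*"
    have "sym ?R" using D_sym by (auto simp: sym_def)
    then have symR: "sym (?R\<^sup>*)" by (rule sym_rtrancl)
    \<comment> \<open>Of two vertices separated by \<open>x\<close>, at least one is also separated
      from \<open>X\<close>. Its component has all neighbours inside except possibly
      \<open>x\<close>, so adding \<open>x\<close> gives a smaller candidate with \<open>x\<close>
      as the exceptional vertex.\<close>
    have "\<exists>w w'. w \<in> B - {x} \<and> w' \<in> B - {x} \<and> (w, w') \<notin> ?R\<^sup>* \<and> (w, X) \<notin> ?R\<^sup>*"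
    proof (cases "(u, X) \<in> ?R\<^sup>*")
      case True
      then have "(v, X) \<notin> ?R\<^sup>*" using n symR by (meson rtrancl_trans symD)
      moreover have "(v, u) \<notin> ?R\<^sup>*" using n symR by (meson symD)
      ultimately show ?thesis using uv by blast
    next
      case False
      then show ?thesis using n uv by blast
    qed
    then obtain w w' where w: "w \<in> B - {x}" "w' \<in> B - {x}" "(w, w') \<notin> ?R\<^sup>*" "(w, X) \<notin> ?R\<^sup>*" by blast
    define C where "C = ?R\<^sup>* `` {w}"
    have CB: "C \<subseteq> B - {x}"
    proof
      fix c assume "c \<in> C"
      then have "(w, c) \<in> ?R\<^sup>*" by (simp add: C_def)
      then show "c \<in> B - {x}" using w(1) by (cases rule: rtranclE) auto
    qed
    have wC: "w \<in> C" "w' \<notin> C" "X \<notin> C" using w by (auto simp: C_def)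
    have step: "z \<in> C \<or> z = x" if c: "c \<in> C" "(c, z) \<in> D" for c z
    proof -
      have "c \<in> B - {x}" "c \<noteq> X" using c CB wC by auto
      then have "z \<in> B" using full c(2) by blast
      show ?thesis
      proof (cases "z = x")
        case False
        then have "(c, z) \<in> ?R" using c \<open>c \<in> B - {x}\<close> \<open>z \<in> B\<close> by auto
        then show ?thesis using c(1) by (auto simp: C_def intro: rtrancl_into_rtrancl)
      qed simp
    qed
    \<comment> \<open>The intersection covers the case that \<open>x\<close> is not in
      \<open>B\<close>: then \<open>C\<close> is closed under adjacency and any of its vertices
      serves as the exceptional one.\<close>
    let ?B' = "C \<union> ({x} \<inter> B)"
    have sub: "?B' \<subseteq> B" using CB by auto
    have "w' \<in> B - ?B'" using w wC by auto
    then have "card ?B' < card B" using sub finB by (intro psubset_card_mono) auto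
    moreover have "ok ?B'"
    proof -
      obtain z where z: "(w, z) \<in> D" using nbr w BU by blast
      have zB: "z \<in> B" using full[OF _ _ z] w wC by auto
      then have zB': "z \<in> ?B'" using step[OF wC(1) z] by auto
      have c2: "card ?B' \<ge> 2"
        using two[of w ?B' z] wC zB' edge_neq[OF z] sub BU by auto
      have ex: "\<exists>Y\<in>?B'. \<forall>v\<in>?B'. \<forall>w. v \<noteq> Y \<longrightarrow> (v, w) \<in> D \<longrightarrow> w \<in> ?B'"
      proof (cases "x \<in> B")
        case True
        show ?thesis
        proof (rule bexI[of _ x])
          show "\<forall>v\<in>?B'. \<forall>w. v \<noteq> x \<longrightarrow> (v, w) \<in> D \<longrightarrow> w \<in> ?B'" using step True by auto
        qed (use True in simp)
      next
        case False
        have "c' \<in> C" if "c \<in> C" "(c, c') \<in> D" for c c'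
        proof -
          have "c \<in> B" "c \<noteq> X" using that CB wC by auto
          then have "c' \<in> B" using full that by blast
          then show ?thesis using step[OF that] False by auto
        qed
        then show ?thesis using wC False by blast
      qed
      show ?thesis unfolding ok_def using c2 ex sub BU by blast
    qed
    ultimately show False using mn by fastforce
  qed
  then have "no_cut_vertex B (D \<inter> B \<times> B)" unfolding no_cut_vertex_def by blast
  then show ?thesis using that[of B X] BU X full B3 by blast
qed

lemma not_drawable:
  assumes ne: "U \<noteq> {}" and dr: "\<And>B. B \<subseteq> U \<Longrightarrow> drawn_graph B (D \<inter> B \<times> B) pos crv"
  shows False
proof -
  obtain B X where B: "B \<subseteq> U" and X: "X \<in> B" and full: "\<And>v w. v \<in> B \<Longrightarrow> v \<noteq> X \<Longrightarrow> (v, w) \<in> D \<Longrightarrow> w \<in> B"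
    and B3: "card B \<ge> 3"
    and conn: "no_cut_vertex B (D \<inter> B \<times> B)"
    using ex_end_block[OF ne] by metis
  interpret drawn_graph B "D \<inter> B \<times> B" pos crv by (rule dr[OF B])
  obtain F where F: "finite F" "\<forall>S\<in>F. \<exists>xs. distinct xs \<and> 3 \<le> length xs \<and> S = cycle_darts xs"
     "\<Union>F = D \<inter> B \<times> B" "\<forall>S\<in>F. \<forall>T\<in>F. S \<noteq> T \<longrightarrow> S \<inter> T = {}"
     "2 * card F + 2 * card B = card (D \<inter> B \<times> B) + 4"
     "\<forall>S\<in>F. \<forall>T\<in>F. \<forall>a b c. (a, b) \<in> S \<and> (b, c) \<in> S \<and> (c, b) \<in> T \<and> (b, a) \<in> T \<longrightarrow>
        (D \<inter> B \<times> B) `` {b} = {a, c}"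
    using ex_faces[OF B3 conn] by (elim exE conjE) (rule that, assumption+)
  have X2: "card ((D \<inter> B \<times> B) `` {X}) \<ge> 2"
  proof -
    obtain z1 where z1: "(X, z1) \<in> D \<inter> B \<times> B"
      using edge_avoiding[OF B3 conn X] card_ge_3_ex_other[OF B3] by metis
    then have "X \<noteq> z1" using edge_neq by blast
    then obtain z2 where z2: "(X, z2) \<in> D \<inter> B \<times> B" "z2 \<noteq> z1" using edge_avoiding[OF B3 conn X] by metis
    then show ?thesis
      using card_ge_list[of "[z1, z2]" "(D \<inter> B \<times> B) `` {X}"] z1 finite_D by (simp add: finite_Image)
  qed
  have "plane_block U D B X F"
  proof
    fix S T a b c
    assume "S \<in> F" "T \<in> F" "(a, b) \<in> S" "(b, c) \<in> S" "(c, b) \<in> T" "(b, a) \<in> T"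
    then show "(D \<inter> B \<times> B) `` {b} = {a, c}" using F(6) by blast
  qed (use B X full F(1-5) X2 in blast)+
  then show False by (rule plane_block.contradiction)
qed

end

theorem theorem1:
  fixes G :: "'a pair_pre_digraph"
  assumes "pair_graph G"
    and "planar G"
    and "\<not> has_cycle_of_length G 4"
    and "\<not> has_cycle_of_length G 8"
  shows "DP_BA_colorable 3 G"
  unfolding DP_BA_colorable_def
proof (intro allI impI)
  fix L H assume L: "k_assignment 3 G L" and H: "cover G L H"
  interpret G: pair_graph G by (rule assms(1))
  interpret cover_relation "parcs G" "parcs H" by (rule cover_imp_cover_relation[OF assms(1) H])
  let ?V = "pverts G" and ?D = "parcs G"
  have finV: "finite ?V" by (rule G.pair_finite_verts)
  have sym: "(v, u) \<in> ?D" if "(u, v) \<in> ?D" for u v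
    using that G.pair_sym_arcs by (auto simp: symmetric_def dest: symD)
  have finN: "finite (?D `` {u})" for u using G.pair_finite_arcs by (simp add: finite_Image)
  have "colorable ?V"
  proof (rule ccontr)
    assume "\<not> colorable ?V"
    then have "\<exists>U. (U \<subseteq> ?V \<and> \<not> colorable U) \<and> (\<forall>A. A \<subseteq> ?V \<and> \<not> colorable A \<longrightarrow> card U \<le> card A)"
      using ex_has_least_nat[of "\<lambda>U. U \<subseteq> ?V \<and> \<not> colorable U" ?V card] by blast
    then obtain U where UV: "U \<subseteq> ?V" and nc: "\<not> colorable U"
      and mn: "\<And>A. A \<subseteq> ?V \<Longrightarrow> \<not> colorable A \<Longrightarrow> card U \<le> card A" by blast
    have finU: "finite U" using finite_subset[OF UV finV] .
    have smaller: "colorable A" if "A \<subset> U" for A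
      using mn[of A] that UV psubset_card_mono[OF finU that] by fastforce
    have "colorable {}" unfolding colorable_def using good.intros(1) by force
    then have ne: "U \<noteq> {}" using nc by auto
    have cyc: "\<not> cycle_darts xs \<subseteq> ?D" if "distinct xs" "length xs = 4 \<or> length xs = 8" for xs
    proof
      assume c: "cycle_darts xs \<subseteq> ?D"
      have "xs \<noteq> []" using that(2) by auto
      then have "has_cycle_of_length G (length xs)"
        using has_cycle_of_lengthI[OF assms(1) that(1) _ c] by blast
      then show False using that(2) assms(3,4) by auto
    qed
    interpret irreducible_graph U "?D \<inter> U \<times> U"
    proof
      show "finite U" by (rule finU)
      show "(v, u) \<in> ?D \<inter> U \<times> U" if "(u, v) \<in> ?D \<inter> U \<times> U" for u v using that sym by auto
      show "(u, u) \<notin> ?D \<inter> U \<times> U" for u using G.pair_no_loops by fastforce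
      show "a = c \<or> b = d"
        if "(a, b) \<in> ?D \<inter> U \<times> U" "(b, c) \<in> ?D \<inter> U \<times> U" "(c, d) \<in> ?D \<inter> U \<times> U" "(d, a) \<in> ?D \<inter> U \<times> U" for a b c d
      proof (rule ccontr)
        assume "\<not> ?thesis"
        then have "distinct [a, b, c, d]" using that G.pair_no_loops by fastforce
        then show False using cyc[of "[a, b, c, d]"] that by (auto simp: cycle_darts_def)
      qed
      show "\<not> cycle_darts xs \<subseteq> ?D \<inter> U \<times> U" if "distinct xs" "length xs = 8" for xs
        using cyc[of xs] that by auto
      fix us J
      assume us: "distinct us" "us \<noteq> []" "set us \<subseteq> U"
        and st: "\<And>ps u rs. us = ps @ u # rs \<Longrightarrow> card ((?D \<inter> U \<times> U) `` {u} - set rs) \<le> 2 \<or>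
         u \<in> J \<and> card ((?D \<inter> U \<times> U) `` {u} - set rs) \<le> 3 \<and> card ((?D \<inter> U \<times> U) `` {u} - set us) \<le> 1"
        and ld: "\<And>ps w rs. us = ps @ w # rs \<Longrightarrow> (if w \<in> J then 1 else 0) + card {u \<in> set rs \<inter> J. (w, u) \<in> ?D \<inter> U \<times> U} \<le> 2"
      have nb: "?D `` {u} \<inter> U = (?D \<inter> U \<times> U) `` {u}" if "u \<in> U" for u using that by auto
      \<comment> \<open>A nonempty \<open>us\<close> leaves a proper subset of \<open>U\<close>,
        which is colourable by the minimal choice of \<open>U\<close>.\<close>
      have "U - set us \<subset> U" using us by (cases us) auto
      then have base: "colorable (U - set us)" by (rule smaller)
      have "colorable U"
      proof (rule colorable_extend[OF us(1,3) finU base, of J])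
        fix ps u rs assume e: "us = ps @ u # rs"
        then have u: "u \<in> U" "set rs \<subseteq> U" using us(3) by auto
        show "card (?D `` {u} \<inter> U - set rs) \<le> 2 \<or>
          u \<in> J \<and> card (?D `` {u} \<inter> U - set rs) \<le> 3 \<and> card (?D `` {u} \<inter> U - set us) \<le> 1"
          unfolding nb[OF u(1)] by (rule st[OF e])
        have "{v \<in> set rs \<inter> J. (u, v) \<in> ?D} = {v \<in> set rs \<inter> J. (u, v) \<in> ?D \<inter> U \<times> U}" using u by auto
        then show "(if u \<in> J then 1 else 0) + card {v \<in> set rs \<inter> J. (u, v) \<in> ?D} \<le> 2"
          using ld[OF e] by simp
      qed (rule finN)
      then show False using nc by blast
    qed auto
    obtain pos crv where dr: "plane_drawing G pos crv" using assms(2) by (auto simp: planar_def)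
    \<comment> \<open>The end block is chosen only within \<open>not_drawable\<close>, so the
      restricted drawing is supplied for every subset.\<close>
    have "drawn_graph B ((?D \<inter> U \<times> U) \<inter> B \<times> B) pos crv" if B: "B \<subseteq> U" for B
    proof
      show "finite B" using finite_subset[OF B finU] .
      show "inj_on pos B" using dr B UV unfolding plane_drawing_def by (meson inj_on_subset subset_trans)
      fix u v assume e: "(u, v) \<in> (?D \<inter> U \<times> U) \<inter> B \<times> B"
      then have uv: "(u, v) \<in> ?D" "u \<in> B" "v \<in> B" by auto
      show "(v, u) \<in> (?D \<inter> U \<times> U) \<inter> B \<times> B" using e sym by auto
      have *: "arc (crv (u, v)) \<and> pathstart (crv (u, v)) = pos u \<and> pathfinish (crv (u, v)) = pos v \<and>
        crv (v, u) = reversepath (crv (u, v)) \<and> path_image (crv (u, v)) \<inter> pos ` pverts G = {pos u, pos v}"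
        using dr uv(1) unfolding plane_drawing_def by blast
      then show "arc (crv (u, v))" "pathstart (crv (u, v)) = pos u" "pathfinish (crv (u, v)) = pos v"
        "crv (v, u) = reversepath (crv (u, v))" by auto
      have "path_image (crv (u, v)) \<inter> pos ` B \<subseteq> {pos u, pos v}" using * B UV by blast
      moreover have "{pos u, pos v} \<subseteq> path_image (crv (u, v)) \<inter> pos ` B" using * uv by blast
      ultimately show "path_image (crv (u, v)) \<inter> pos ` B = {pos u, pos v}" by (rule equalityI)
      fix x y assume xy: "(x, y) \<in> (?D \<inter> U \<times> U) \<inter> B \<times> B" and n: "{u, v} \<noteq> {x, y}"
      have "\<forall>(u, v) \<in> ?D. \<forall>(x, y) \<in> ?D. {u, v} \<noteq> {x, y} \<longrightarrow>
        path_image (crv (u, v)) \<inter> path_image (crv (x, y)) \<subseteq> pos ` ({u, v} \<inter> {x, y})"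
        using dr unfolding plane_drawing_def by blast
      then show "path_image (crv (u, v)) \<inter> path_image (crv (x, y)) \<subseteq> pos ` ({u, v} \<inter> {x, y})"
        using uv(1) xy n by fastforce
    qed (use G.pair_no_loops in fastforce)+
    then show False by (rule not_drawable[OF ne])
  qed
  then obtain l where "good l" "fst ` set l = ?V" unfolding colorable_def by blast
  then show "\<exists>T. DP_BA_coloring G L H T"
    using DP_BA_coloring_of_good[OF _ _ refl, of l G L] L H unfolding k_assignment_def cover_def by blast
qed

end
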